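(* Let $E\subset\mathbb C$ be a compact set with $\mathrm{cap}(E)>0$, empty interior and connected complement. Let $B_k(z)=\sum_{j=0}^k b_{j,k}z^j$, $k=0,1,2,\dots$, be polynomials with $b_{k,k}\ne0$ for all $k$ satisfying $$\limsup_{k\to\infty}\|B_k\|_E^{1/k}\le 1\quad\text{and}\quad \lim_{k\to\infty}|b_{k,k}|^{1/k}=1/\mathrm{cap}(E). \qquad (2.3)$$ Let $A_0,A_1,\dots$ be complex random variables satisfying Assumptions 1 and 2. Then, almost surely, the zero counting measures $\tau_n$ of $P_n(z)=\sum_{k=0}^n A_kB_k(z)$ converge weakly to $\mu_E$ as $n\to\infty$.
   Context: $\mathrm{cap}(E)$ is the logarithmic capacity, $\mu_E$ the equilibrium measure of $E$, and $\|B\|_E=\sup_{z\in E}|B(z)|$. The random variables $A_k$ need not be independent nor identically distributed; $F_k(x)=\mathbb P(|A_k|\le x)$. Assumption 1: there are $a>1$ and a decreasing $f:[a,\infty)\to[0,1]$ with $\int_a^\infty f(x)\,dx/x<\infty$ and $1-F_k(x)\le f(x)$ for all $x\ge a$, all $k\ge0$. Assumption 2: there are $0<b<1$ and an increasing $g:[0,b]\to[0,1]$ with $\int_0^b g(x)\,dx/x<\infty$ and $F_k(x)\le g(x)$ for all $x\in[0,b]$, all $k\ge0$. The zero counting measure of a degree-$n$ polynomial with zeros $Z_1,\dots,Z_n$ is $\tau_n=\frac1n\sum_j\delta_{Z_j}$. *)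

theory Defs
  imports "HOL-Probability.Probability" "HOL-Computational_Algebra.Polynomial"
begin

definition log_kernel_pos :: "complex \<Rightarrow> complex \<Rightarrow> ennreal" where
  "log_kernel_pos z w = (if z = w then \<top> else ennreal (max 0 (- ln (cmod (z - w)))))"

definition log_kernel_neg :: "complex \<Rightarrow> complex \<Rightarrow> real" where
  "log_kernel_neg z w = (if z = w then 0 else max 0 (ln (cmod (z - w))))"

definition log_energy :: "complex measure \<Rightarrow> ereal" where
  "log_energy \<mu> =
     enn2ereal (\<integral>\<^sup>+ p. log_kernel_pos (fst p) (snd p) \<partial>(\<mu> \<Otimes>\<^sub>M \<mu>))
     - ereal (\<integral> p. log_kernel_neg (fst p) (snd p) \<partial>(\<mu> \<Otimes>\<^sub>M \<mu>))"

definition prob_measures_on :: "complex set \<Rightarrow> complex measure set" where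
  "prob_measures_on E =
     {\<mu>. prob_space \<mu> \<and> sets \<mu> = sets borel \<and> emeasure \<mu> (- E) = 0}"

definition min_energy :: "complex set \<Rightarrow> ereal" where
  "min_energy E = (INF \<mu>\<in>prob_measures_on E. log_energy \<mu>)"

definition log_capacity :: "complex set \<Rightarrow> real" where
  "log_capacity E = (if min_energy E = \<infinity> then 0 else exp (- real_of_ereal (min_energy E)))"

definition equilibrium_measure :: "complex set \<Rightarrow> complex measure" where
  "equilibrium_measure E =
     (THE \<mu>. \<mu> \<in> prob_measures_on E \<and> log_energy \<mu> = min_energy E)"

definition sup_norm_on :: "complex set \<Rightarrow> complex poly \<Rightarrow> real" where
  "sup_norm_on E p = (SUP z\<in>E. cmod (poly p z))"

definition zero_counting_measure :: "complex poly \<Rightarrow> complex measure" where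
  "zero_counting_measure p = measure_of UNIV (sets borel)
     (\<lambda>A. ennreal ((\<Sum>z\<in>{z\<in>A. poly p z = 0}. real (order z p)) / real (degree p)))"

definition weak_conv_cmplx :: "(nat \<Rightarrow> complex measure) \<Rightarrow> complex measure \<Rightarrow> bool" where
  "weak_conv_cmplx \<mu>s \<mu> \<longleftrightarrow>
     (\<forall>f::complex \<Rightarrow> real. continuous_on UNIV f \<and> bounded (range f) \<longrightarrow>
        (\<lambda>n. \<integral>z. f z \<partial>(\<mu>s n)) \<longlonglongrightarrow> (\<integral>z. f z \<partial>\<mu>))"

end

theory Submission
  imports Defs "HOL-Complex_Analysis.Complex_Analysis" "HOL-Real_Asymp.Real_Asymp"
    "HOL-Computational_Algebra.Fundamental_Theorem_Algebra"
begin

text \<open>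
  By Borel--Cantelli the hypotheses on the coefficients give \<open>|A n|^(1/n) \<longlongrightarrow> 1\<close> almost surely, so that
  almost surely the polynomials \<open>P n\<close>, divided by their leading coefficients, have sup norm at most
  \<open>exp (n (\<epsilon> - V))\<close> on \<open>E\<close> for large \<open>n\<close>, where \<open>V = - ln (cap E)\<close> is the minimal energy.

  Let \<open>\<mu>\<close> be the minimizer and \<open>U\<close> its potential; by Frostman \<open>U \<le> V\<close> everywhere, and \<open>U < V\<close> off \<open>E\<close>.
  Integrating \<open>ln |P n|\<close> against \<open>\<mu>\<close> shows that the average of \<open>V - U\<close> over the zeros of \<open>P n\<close> tends
  to \<open>0\<close>, so the zeros concentrate on \<open>E\<close> and every subsequence of the counting measures has a
  subsequence converging weakly to some probability measure \<open>\<tau>\<close> on \<open>E\<close>. The maximum principle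
  (Bernstein--Walsh) gives \<open>U\<^sup>\<tau> \<ge> U\<close> off \<open>E\<close>; as both potentials have the same mean over large circles and
  the complement of \<open>E\<close> is connected, \<open>U\<^sup>\<tau> = U \<le> V\<close> there. Since \<open>E\<close> has empty interior, lower
  semicontinuity carries \<open>U\<^sup>\<tau> \<le> V\<close> over to \<open>E\<close>. Hence the energy of \<open>\<tau>\<close> is at most \<open>V\<close>, and \<open>\<tau> = \<mu>\<close> by
  uniqueness of the minimizer.

  Infinite values are avoided by working with the kernels \<open>- ln (|z - w|\<^sup>2 + d) / 2\<close>, which increase to
  \<open>- ln |z - w|\<close> as \<open>d\<close> decreases to \<open>0\<close> and are mixtures of Gaussian kernels up to a constant.
\<close>

section \<open>Growth of the random coefficients\<close>

text \<open>Randomness enters only through one almost sure event; everything later concerns a single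
  outcome, that is, a deterministic sequence of polynomials that are small on \<open>E\<close>
  relative to their leading coefficients. This smallness does not determine the limit when
  \<open>E\<close> has interior: on the closed unit disc the polynomials z^n satisfy it with all
  zeros at 0, and the potential of the point mass at 0 agrees with the equilibrium potential off the
  disc. Empty interior makes the complement dense, so that bounds on potentials reach
  \<open>E\<close>. Two obstacles shape the rest. Zeros may lie close to a point where ln |P n| is
  evaluated, or far from \<open>E\<close>; so potentials are compared through circle means, and
  zeros are first projected to a disc. Energies may be infinite; so uniqueness of the minimizer
  rests on a bound uniform in the regularisation. A Gaussian kernel is a series of products of
  moments, hence its quadratic form at \<mu> - \<nu> is a sum of squares; mixing Gaussians gives 1 /
  (x + u), and integrating that in u gives differences of ln (x + u).\<close>

text \<open>An integral test: as the blocks are disjoint, the step function with value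
  \<open>c n\<close> on \<open>I n\<close> lies below \<open>h\<close>, and its integral is the
  series.\<close>

lemma summable_disjoint_blocks:
  fixes h :: "real \<Rightarrow> ennreal"
  assumes disj: "disjoint_family I" and [measurable]: "\<And>n. I n \<in> sets lborel"
    and fin: "\<And>n. emeasure lborel (I n) < \<infinity>"
    and cpos: "\<And>n. 0 \<le> c n" and le: "\<And>n x. x \<in> I n \<Longrightarrow> ennreal (c n) \<le> h x"
    and int: "(\<integral>\<^sup>+x. h x \<partial>lborel) < \<infinity>"
  shows "summable (\<lambda>n. c n * measure lborel (I n))"
proof -
  have step: "(\<Sum>n. ennreal (c n) * indicator (I n) x) \<le> h x" for x
  proof (cases "\<exists>n. x \<in> I n")
    case True
    then obtain n where n: "x \<in> I n" by auto
    have "(\<Sum>m. ennreal (c m) * indicator (I m) x) = (\<Sum>m\<in>{n}. ennreal (c m) * indicator (I m) x)"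
      by (rule suminf_finite)
        (use disj n in \<open>auto simp: disjoint_family_on_def split: split_indicator\<close>)
    then show ?thesis using n le by simp
  qed simp
  have "(\<Sum>n. ennreal (c n * measure lborel (I n))) = (\<Sum>n. \<integral>\<^sup>+x. ennreal (c n) * indicator (I n) x \<partial>lborel)"
  proof (rule suminf_cong)
    fix n
    have "(\<integral>\<^sup>+x. ennreal (c n) * indicator (I n) x \<partial>lborel) = ennreal (c n) * emeasure lborel (I n)"
      by (rule nn_integral_cmult_indicator) measurable
    also have "emeasure lborel (I n) = ennreal (measure lborel (I n))"
      using fin[of n] by (intro emeasure_eq_ennreal_measure) auto
    finally show "ennreal (c n * measure lborel (I n)) = (\<integral>\<^sup>+x. ennreal (c n) * indicator (I n) x \<partial>lborel)"
      using cpos[of n] by (simp add: ennreal_mult)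
  qed
  also have "\<dots> = (\<integral>\<^sup>+x. (\<Sum>n. ennreal (c n) * indicator (I n) x) \<partial>lborel)"
    by (rule nn_integral_suminf[symmetric]) auto
  also have "\<dots> \<le> (\<integral>\<^sup>+x. h x \<partial>lborel)"
    by (rule nn_integral_mono) (rule step)
  finally have "(\<Sum>n. ennreal (c n * measure lborel (I n))) < \<infinity>"
    using int by (rule le_less_trans)
  then show ?thesis
    by (intro summable_suminf_not_top) (use cpos in auto)
qed

lemma disjoint_family_Ioc_incseq:
  fixes y :: "nat \<Rightarrow> real"
  assumes "incseq y"
  shows "disjoint_family (\<lambda>n. {y n<..y (Suc n)})"
proof -
  have "{y m<..y (Suc m)} \<inter> {y n<..y (Suc n)} = {}" if "m < n" for m n
    using incseqD[OF assms, of "Suc m" n] that by auto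
  then show ?thesis
    unfolding disjoint_family_on_def by (metis Int_commute linorder_neqE_nat)
qed

lemma disjoint_family_Ioc_decseq:
  fixes y :: "nat \<Rightarrow> real"
  assumes "decseq y"
  shows "disjoint_family (\<lambda>n. {y (Suc n)<..y n})"
proof -
  have "{y (Suc m)<..y m} \<inter> {y (Suc n)<..y n} = {}" if "m < n" for m n
    using decseqD[OF assms, of "Suc m" n] that by auto
  then show ?thesis
    unfolding disjoint_family_on_def by (metis Int_commute linorder_neqE_nat)
qed

text \<open>For dx/x the blocks between consecutive points \<open>exp (e * n)\<close> all have mass
  \<open>e\<close>. Hence a finite integral of f(x)/x is strong enough to sum \<open>f\<close> along
  exponential thresholds of every rate.\<close>

lemma summable_antimono_exp:
  fixes f :: "real \<Rightarrow> real"
  assumes e: "e > 0"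
    and anti: "\<And>x y. a \<le> x \<Longrightarrow> x \<le> y \<Longrightarrow> f y \<le> f x"
    and pos: "\<And>x. x \<ge> a \<Longrightarrow> 0 \<le> f x"
    and int: "(\<integral>\<^sup>+ x\<in>{a..}. ennreal (f x / x) \<partial>lborel) < \<infinity>"
    and N: "a \<le> exp (e * real N)"
  shows "summable (\<lambda>n. f (exp (e * real (Suc (n + N)))))"
proof -
  define y where "y n = exp (e * real (n + N))" for n
  have ypos: "0 < y n" for n by (simp add: y_def)
  have inc: "incseq y" unfolding y_def using e by (intro incseq_SucI) simp
  have le: "y n \<le> y (Suc n)" for n using incseqD[OF inc] by simp
  have ge: "a \<le> y n" for n
    using order_trans[OF _ incseqD[OF inc, of 0 n], of a] N by (simp add: y_def)
  \<comment> \<open>Both \<open>f\<close> and 1/x are smallest at the right end of a block, and the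
    block length is \<open>1 - exp (- e)\<close> times that end, so the series is a constant
    multiple of the desired one.\<close>
  have "summable (\<lambda>n. f (y (Suc n)) / y (Suc n) * measure lborel {y n<..y (Suc n)})"
  proof (rule summable_disjoint_blocks[OF disjoint_family_Ioc_incseq[OF inc] _ _ _ _ int])
    fix n x assume x: "x \<in> {y n<..y (Suc n)}"
    then have "0 < x" "a \<le> x" using ypos[of n] ge[of n] by auto
    then have "f (y (Suc n)) / y (Suc n) \<le> f x / x"
      using x anti[of x "y (Suc n)"] pos[of x] by (intro frac_le) auto
    then show "ennreal (f (y (Suc n)) / y (Suc n)) \<le> ennreal (f x / x) * indicator {a..} x"
      using \<open>a \<le> x\<close> by (simp add: ennreal_leI)
  qed (use ypos pos ge le in \<open>auto simp: less_imp_le\<close>)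
  also have "(\<lambda>n. f (y (Suc n)) / y (Suc n) * measure lborel {y n<..y (Suc n)})
      = (\<lambda>n. (1 - exp (- e)) * f (y (Suc n)))"
    using le by (auto simp: fun_eq_iff y_def field_simps exp_add exp_minus)
  finally show ?thesis
    using e unfolding y_def by (subst (asm) summable_cmult_iff) auto
qed

lemma summable_mono_exp:
  fixes g :: "real \<Rightarrow> real"
  assumes e: "e > 0"
    and mono: "\<And>x y. 0 \<le> x \<Longrightarrow> x \<le> y \<Longrightarrow> y \<le> b \<Longrightarrow> g x \<le> g y"
    and pos: "\<And>x. x \<in> {0..b} \<Longrightarrow> 0 \<le> g x"
    and int: "(\<integral>\<^sup>+ x\<in>{0..b}. ennreal (g x / x) \<partial>lborel) < \<infinity>"
    and N: "exp (- (e * real N)) \<le> b"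
  shows "summable (\<lambda>n. g (exp (- (e * real (Suc (n + N))))))"
proof -
  define y where "y n = exp (- (e * real (n + N)))" for n
  have ypos: "0 < y n" for n by (simp add: y_def)
  have dec: "decseq y" unfolding y_def using e by (intro decseq_SucI) simp
  have le: "y (Suc n) \<le> y n" for n using decseqD[OF dec] by simp
  have ge: "y n \<le> b" for n
    using order_trans[OF decseqD[OF dec, of 0 n], of b] N by (simp add: y_def)
  \<comment> \<open>Here \<open>g\<close> is smallest at the left end but 1/x at the right end. The
    mixed quotient is still a lower bound, and the block length is \<open>1 - exp (- e)\<close>
    times the right end.\<close>
  have "summable (\<lambda>n. g (y (Suc n)) / y n * measure lborel {y (Suc n)<..y n})"
  proof (rule summable_disjoint_blocks[OF disjoint_family_Ioc_decseq[OF dec] _ _ _ _ int])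
    fix n x assume x: "x \<in> {y (Suc n)<..y n}"
    then have "0 < x" "x \<le> b" using ypos[of "Suc n"] ge[of n] by auto
    then have "g (y (Suc n)) / y n \<le> g x / x"
      using x mono[of "y (Suc n)" x] pos[of x] ypos[of "Suc n"] by (intro frac_le) auto
    then show "ennreal (g (y (Suc n)) / y n) \<le> ennreal (g x / x) * indicator {0..b} x"
      using \<open>x \<le> b\<close> \<open>0 < x\<close> by (simp add: ennreal_leI)
  qed (use ypos pos ge le in \<open>auto simp: less_imp_le\<close>)
  also have "(\<lambda>n. g (y (Suc n)) / y n * measure lborel {y (Suc n)<..y n})
      = (\<lambda>n. (1 - exp (- e)) * g (y (Suc n)))"
  proof
    fix n
    have "y (Suc n) = exp (- e) * y n" by (simp add: y_def algebra_simps flip: exp_add)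
    then show "g (y (Suc n)) / y n * measure lborel {y (Suc n)<..y n} = (1 - exp (- e)) * g (y (Suc n))"
      using ypos[of n] le[of n] by (simp add: field_simps)
  qed
  finally show ?thesis
    using e unfolding y_def by (subst (asm) summable_cmult_iff) auto
qed

text \<open>Only the convergence half of Borel--Cantelli enters, which puts no condition on the
  joint law of the \<open>A k\<close>.\<close>

lemma (in prob_space) AE_eventually_exp_bounds:
  fixes A :: "nat \<Rightarrow> 'a \<Rightarrow> complex" and f g :: "real \<Rightarrow> real"
  assumes [measurable]: "\<And>k. A k \<in> borel_measurable M"
    and f: "\<And>x y. a \<le> x \<Longrightarrow> x \<le> y \<Longrightarrow> f y \<le> f x" "\<And>x. x \<ge> a \<Longrightarrow> 0 \<le> f x"
      "(\<integral>\<^sup>+ x\<in>{a..}. ennreal (f x / x) \<partial>lborel) < \<infinity>"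
      "\<And>x k. x \<ge> a \<Longrightarrow> 1 - measure M {\<omega>\<in>space M. cmod (A k \<omega>) \<le> x} \<le> f x"
    and b: "0 < b"
    and g: "\<And>x y. 0 \<le> x \<Longrightarrow> x \<le> y \<Longrightarrow> y \<le> b \<Longrightarrow> g x \<le> g y" "\<And>x. x \<in> {0..b} \<Longrightarrow> 0 \<le> g x"
      "(\<integral>\<^sup>+ x\<in>{0..b}. ennreal (g x / x) \<partial>lborel) < \<infinity>"
      "\<And>x k. x \<in> {0..b} \<Longrightarrow> measure M {\<omega>\<in>space M. cmod (A k \<omega>) \<le> x} \<le> g x"
    and e: "e > 0"
  shows "AE \<omega> in M. \<forall>\<^sub>F n in sequentially.
    exp (- (e * real n)) < cmod (A n \<omega>) \<and> cmod (A n \<omega>) \<le> exp (e * real n)"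
proof -
  have "filterlim (\<lambda>n. exp (e * real n)) at_top sequentially"
    using e by (intro filterlim_compose[OF exp_at_top] filterlim_tendsto_pos_mult_at_top[OF tendsto_const _ filterlim_real_sequentially])
  then have "\<forall>\<^sub>F n in sequentially. a \<le> exp (e * real n) \<and> 1 / b \<le> exp (e * real n)"
    by (intro eventually_conj) (auto simp: filterlim_at_top)
  then obtain N where N: "a \<le> exp (e * real n)" "1 / b \<le> exp (e * real n)" if "n \<ge> N" for n
    by (auto simp: eventually_sequentially)
  have N': "exp (- (e * real n)) \<le> b" if "n \<ge> N" for n
    using N(2)[OF that] b by (simp add: exp_minus field_simps)
  \<comment> \<open>Indices start at \<open>Suc N\<close>, matching the two series lemmas, whose
    first block begins at the threshold with index \<open>N\<close>.\<close>
  define S where "S n = {\<omega>\<in>space M. \<not> cmod (A (Suc (n + N)) \<omega>) \<le> exp (e * real (Suc (n + N)))}" for n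
  define T where "T n = {\<omega>\<in>space M. cmod (A (Suc (n + N)) \<omega>) \<le> exp (- (e * real (Suc (n + N))))}" for n
  have meas: "S n \<in> events" "T n \<in> events" for n unfolding S_def T_def by measurable
  have Sle: "prob (S n) \<le> f (exp (e * real (Suc (n + N))))" for n
  proof -
    have "prob (S n) = 1 - prob {\<omega>\<in>space M. cmod (A (Suc (n + N)) \<omega>) \<le> exp (e * real (Suc (n + N)))}"
      unfolding S_def by (rule prob_neg) measurable
    also have "\<dots> \<le> f (exp (e * real (Suc (n + N))))" by (rule f(4)) (rule N, simp)
    finally show ?thesis .
  qed
  have Tle: "prob (T n) \<le> g (exp (- (e * real (Suc (n + N)))))" for n
    unfolding T_def by (rule g(4)) (use N'[of "Suc (n + N)"] in simp)
  have "summable (\<lambda>n. prob (S n))"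
    by (rule summable_comparison_test'[OF summable_antimono_exp[OF e f(1,2,3) N(1)[OF order.refl]]])
       (use Sle in auto)
  then have 1: "AE \<omega> in M. eventually (\<lambda>n. \<omega> \<in> space M - S n) sequentially"
    by (intro borel_cantelli_AE1) (use meas in \<open>auto simp: less_top[symmetric]\<close>)
  have "summable (\<lambda>n. prob (T n))"
    by (rule summable_comparison_test'[OF summable_mono_exp[OF e g(1,2,3) N'[OF order.refl]]])
       (use Tle in auto)
  then have 2: "AE \<omega> in M. eventually (\<lambda>n. \<omega> \<in> space M - T n) sequentially"
    by (intro borel_cantelli_AE1) (use meas in \<open>auto simp: less_top[symmetric]\<close>)
  show ?thesis
    using 1 2
  proof eventually_elim
    case (elim \<omega>)
    then have "\<forall>\<^sub>F n in sequentially. exp (- (e * real (n + Suc N))) < cmod (A (n + Suc N) \<omega>) \<and>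
        cmod (A (n + Suc N) \<omega>) \<le> exp (e * real (n + Suc N))"
      by eventually_elim (auto simp: S_def T_def)
    then show ?case
      by (subst (asm) eventually_sequentially_seg)
  qed
qed


section \<open>Sup norms of the polynomials for a fixed outcome\<close>

text \<open>The bound is relative to the leading coefficient because ln |p| minus ln |leading
  coefficient|, divided by the degree, is the average of ln |z - t| over the zeros t. Upper bounds
  enter for all k up to n, lower bounds only at k = n.\<close>

lemma extremal_polynomials_bound:
  fixes a :: "nat \<Rightarrow> complex" and B :: "nat \<Rightarrow> complex poly"
  assumes E: "compact E"
    and a: "\<And>e. e > 0 \<Longrightarrow> \<forall>\<^sub>F n in sequentially. exp (- (e * real n)) < cmod (a n) \<and> cmod (a n) \<le> exp (e * real n)"
    and deg: "\<And>k. degree (B k) \<le> k" and nz: "\<And>k. coeff (B k) k \<noteq> 0"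
    and sup: "limsup (\<lambda>k. ereal (sup_norm_on E (B k) powr (1 / real k))) \<le> 1"
    and lead: "(\<lambda>k. cmod (coeff (B k) k) powr (1 / real k)) \<longlonglongrightarrow> exp V"
    and e: "e > 0"
  defines "p \<equiv> \<lambda>n. \<Sum>k\<le>n. smult (a k) (B k)"
  shows "\<forall>\<^sub>F n in sequentially. degree (p n) = n \<and> p n \<noteq> 0 \<and>
    (\<forall>z\<in>E. cmod (poly (p n) z) \<le> cmod (lead_coeff (p n)) * exp (real n * (e - V)))"
proof -
  \<comment> \<open>Five losses of size \<open>d\<close>: the sup norm of \<open>B k\<close>, the
    size of \<open>a k\<close>, the factor \<open>real (Suc n) * C\<close>, and the lower bounds on
    \<open>a n\<close> and on the leading coefficient of \<open>B n\<close>.\<close>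
  define d where "d = e / 5"
  have d: "d > 0" using e by (simp add: d_def)
  have norm_le: "cmod (poly (B k) z) \<le> sup_norm_on E (B k)" if "z \<in> E" for z k
  proof -
    have "compact ((\<lambda>z. cmod (poly (B k) z)) ` E)"
      by (intro compact_continuous_image E continuous_intros)
    then show ?thesis unfolding sup_norm_on_def
      by (intro cSUP_upper that bounded_imp_bdd_above compact_imp_bounded)
  qed
  have "\<forall>\<^sub>F k in sequentially. ereal (sup_norm_on E (B k) powr (1 / real k)) < ereal (exp d)"
    by (rule Limsup_lessD) (use sup d in \<open>auto intro: le_less_trans simp: one_ereal_def\<close>)
  then have supB: "\<forall>\<^sub>F k in sequentially. \<forall>z\<in>E. cmod (poly (B k) z) \<le> exp (d * real k)"
    using eventually_gt_at_top[of 0]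
  proof eventually_elim
    case (elim k)
    show ?case
    proof
      fix z assume z: "z \<in> E"
      have "0 \<le> sup_norm_on E (B k)" using norm_le[OF z, of k] norm_ge_zero order_trans by blast
      then have "sup_norm_on E (B k) = (sup_norm_on E (B k) powr (1 / real k)) powr real k"
        using elim by (simp add: powr_powr)
      also have "\<dots> \<le> exp d powr real k"
        using elim by (intro powr_mono2) auto
      also have "\<dots> = exp (d * real k)" by (simp add: powr_def mult.commute)
      finally show "cmod (poly (B k) z) \<le> exp (d * real k)" using norm_le[OF z, of k] by linarith
    qed
  qed
  have "\<forall>\<^sub>F k in sequentially. exp (V - d) < cmod (coeff (B k) k) powr (1 / real k)"
    using order_tendstoD(1)[OF lead, of "exp (V - d)"] d by simp
  then have leadB: "\<forall>\<^sub>F k in sequentially. exp (real k * (V - d)) \<le> cmod (coeff (B k) k)"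
    using eventually_gt_at_top[of 0]
  proof eventually_elim
    case (elim k)
    have "exp (real k * (V - d)) = exp (V - d) powr real k" by (simp add: powr_def)
    also have "\<dots> \<le> (cmod (coeff (B k) k) powr (1 / real k)) powr real k"
      using elim by (intro powr_mono2) auto
    also have "\<dots> = cmod (coeff (B k) k)"
      using elim by (simp add: powr_powr)
    finally show ?case .
  qed
  have "\<forall>\<^sub>F k in sequentially. \<forall>z\<in>E. cmod (a k) * cmod (poly (B k) z) \<le> exp (2 * d * real k)"
    using supB a[OF d]
  proof eventually_elim
    case (elim k)
    show ?case
    proof
      fix z assume "z \<in> E"
      then have "cmod (a k) * cmod (poly (B k) z) \<le> exp (d * real k) * exp (d * real k)"
        using elim by (intro mult_mono) auto
      then show "cmod (a k) * cmod (poly (B k) z) \<le> exp (2 * d * real k)"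
        by (simp add: mult.assoc flip: exp_add)
    qed
  qed
  then obtain N where N: "\<And>k z. k \<ge> N \<Longrightarrow> z \<in> E \<Longrightarrow> cmod (a k) * cmod (poly (B k) z) \<le> exp (2 * d * real k)"
    by (auto simp: eventually_sequentially)
  \<comment> \<open>\<open>C\<close> absorbs the finitely many indices below \<open>N\<close>, where
    no asymptotic bound is available; the absolute value gives \<open>C \<ge> 1\<close> also for
    empty \<open>E\<close>.\<close>
  define C where "C = 1 + (\<Sum>k<N. cmod (a k) * \<bar>sup_norm_on E (B k)\<bar>)"
  have C1: "C \<ge> 1" unfolding C_def by (simp add: sum_nonneg)
  have term_le: "cmod (a k) * cmod (poly (B k) z) \<le> C * exp (2 * d * real k)" if z: "z \<in> E" for k z
  proof (cases "k < N")
    case True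
    have "cmod (a k) * cmod (poly (B k) z) \<le> cmod (a k) * \<bar>sup_norm_on E (B k)\<bar>"
      using norm_le[OF z, of k] by (intro mult_left_mono) auto
    also have "\<dots> \<le> (\<Sum>k<N. cmod (a k) * \<bar>sup_norm_on E (B k)\<bar>)"
      using True by (intro member_le_sum[where f = "\<lambda>k. cmod (a k) * \<bar>sup_norm_on E (B k)\<bar>"]) auto
    also have "\<dots> \<le> C * 1" by (simp add: C_def)
    also have "\<dots> \<le> C * exp (2 * d * real k)" using C1 d by (intro mult_left_mono) auto
    finally show ?thesis .
  next
    case False
    then have "cmod (a k) * cmod (poly (B k) z) \<le> 1 * exp (2 * d * real k)" using N z by simp
    also have "\<dots> \<le> C * exp (2 * d * real k)" using C1 by (intro mult_right_mono) auto
    finally show ?thesis .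
  qed
  have bound: "cmod (poly (p n) z) \<le> real (Suc n) * C * exp (2 * d * real n)" if z: "z \<in> E" for n z
  proof -
    have "cmod (poly (p n) z) \<le> (\<Sum>k\<le>n. cmod (a k) * cmod (poly (B k) z))"
      unfolding p_def poly_sum by (rule sum_norm_le) (simp add: norm_mult)
    also have "\<dots> \<le> (\<Sum>k\<le>n. C * exp (2 * d * real n))"
    proof (rule sum_mono)
      fix k assume "k \<in> {..n}"
      then have "C * exp (2 * d * real k) \<le> C * exp (2 * d * real n)"
        using C1 d by (intro mult_left_mono) auto
      then show "cmod (a k) * cmod (poly (B k) z) \<le> C * exp (2 * d * real n)"
        using term_le[OF z, of k] by linarith
    qed
    finally show ?thesis by simp
  qed
  have asym: "\<forall>\<^sub>F n in sequentially. real (Suc n) * C \<le> exp (d * real n)"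
    using d by real_asymp
  show ?thesis
    using asym leadB a[OF d]
  proof eventually_elim
    case (elim n)
    have coeff_n: "coeff (p n) n = a n * coeff (B n) n"
    proof -
      have "coeff (p n) n = (\<Sum>k\<le>n. a k * coeff (B k) n)" by (simp add: p_def coeff_sum)
      also have "\<dots> = (\<Sum>k\<in>{n}. a k * coeff (B k) n)"
      proof (rule sum.mono_neutral_right)
        show "\<forall>k\<in>{..n} - {n}. a k * coeff (B k) n = 0"
          by (auto intro!: coeff_eq_0 le_less_trans[OF deg])
      qed auto
      finally show ?thesis by simp
    qed
    have "a n \<noteq> 0" using elim by (metis exp_gt_zero less_asym norm_zero)
    then have nz': "coeff (p n) n \<noteq> 0" using coeff_n nz by simp
    have "degree (p n) \<le> n" unfolding p_def
      by (rule degree_sum_le) (auto intro: order_trans[OF degree_smult_le] order_trans[OF deg])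
    then have degn: "degree (p n) = n" using nz' le_degree le_antisym by blast
    have "exp (real n * (V - 2 * d)) = exp (- (d * real n)) * exp (real n * (V - d))"
      by (simp add: algebra_simps flip: exp_add)
    also have "\<dots> \<le> cmod (a n) * cmod (coeff (B n) n)"
      using elim by (intro mult_mono) auto
    finally have l: "exp (real n * (V - 2 * d)) \<le> cmod (lead_coeff (p n))"
      using degn coeff_n by (simp add: norm_mult)
    show ?case
    proof (intro conjI ballI)
      show "degree (p n) = n" "p n \<noteq> 0" using degn nz' by auto
      fix z assume "z \<in> E"
      then have "cmod (poly (p n) z) \<le> real (Suc n) * C * exp (2 * d * real n)" by (rule bound)
      also have "\<dots> \<le> exp (d * real n) * exp (2 * d * real n)"
        using elim by (intro mult_right_mono) auto
      also have "\<dots> = exp (real n * (V - 2 * d)) * exp (real n * (e - V))"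
        unfolding d_def by (simp add: field_simps flip: exp_add)
      also have "\<dots> \<le> cmod (lead_coeff (p n)) * exp (real n * (e - V))"
        using l by (intro mult_right_mono) auto
      finally show "cmod (poly (p n) z) \<le> cmod (lead_coeff (p n)) * exp (real n * (e - V))" .
    qed
  qed
qed

section \<open>Sequential compactness of planar probability measures\<close>

text \<open>Schoenberg's auxiliary function: continuous, of period 2, equal to 0 on [0, 1/3] and to
  1 on [2/3, 1]. A truncated cosine makes continuity and periodicity immediate.\<close>

definition schoenberg_step :: "real \<Rightarrow> real" where
  "schoenberg_step t = max 0 (min 1 (1 / 2 - cos (pi * t)))"

text \<open>For \<open>e\<close> with values 0 and 1, the point of the Cantor set with ternary
  digits \<open>2 * e m\<close>.\<close>

definition ternary :: "(nat \<Rightarrow> real) \<Rightarrow> real" where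
  "ternary e = (\<Sum>m. 2 * e m / 3 ^ Suc m)"

lemma schoenberg_step_bounds: "0 \<le> schoenberg_step t" "schoenberg_step t \<le> 1"
  by (auto simp: schoenberg_step_def)

lemma schoenberg_step_periodic: "schoenberg_step (2 * of_int k + t) = schoenberg_step t"
proof -
  have "cos (pi * (2 * of_int k + t)) = cos (pi * t + 2 * pi * of_int k)"
    by (simp add: algebra_simps)
  also have "\<dots> = cos (pi * t)" by (simp add: cos_add)
  finally show ?thesis by (simp add: schoenberg_step_def)
qed

lemma schoenberg_step_low:
  assumes "0 \<le> t" "t \<le> 1 / 3"
  shows "schoenberg_step t = 0"
proof -
  have "pi * t \<le> pi * (1 / 3)" using assms by (intro mult_left_mono) auto
  then have "cos (pi / 3) \<le> cos (pi * t)"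
    using assms by (intro cos_monotone_0_pi_le) auto
  then show ?thesis by (simp add: schoenberg_step_def cos_60)
qed

lemma schoenberg_step_high:
  assumes "2 / 3 \<le> t" "t \<le> 1"
  shows "schoenberg_step t = 1"
proof -
  have "cos (pi * t) = - cos (pi * (1 - t))"
    by (simp add: right_diff_distrib cos_diff)
  moreover have "pi * (1 - t) \<le> pi * (1 / 3)" using assms by (intro mult_left_mono) auto
  then have "cos (pi / 3) \<le> cos (pi * (1 - t))"
    using assms by (intro cos_monotone_0_pi_le) auto
  ultimately show ?thesis by (simp add: schoenberg_step_def cos_60)
qed

context
  fixes e :: "nat \<Rightarrow> real"
  assumes e: "\<And>m. e m \<in> {0, 1}"
begin

lemma ternary_summable: "summable (\<lambda>m. 2 * e m / 3 ^ Suc m)"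
proof (rule summable_comparison_test')
  show "summable (\<lambda>m. (1 / 3 :: real) ^ m)" by (simp add: summable_geometric)
  fix m show "norm (2 * e m / 3 ^ Suc m) \<le> (1 / 3) ^ m"
    using e[of m] by (auto simp: field_simps power_divide)
qed

lemma ternary_bounds: "0 \<le> ternary e" "ternary e \<le> 1"
proof -
  show "0 \<le> ternary e" unfolding ternary_def
    by (rule suminf_nonneg[OF ternary_summable])
      (metis e insertE singletonD divide_nonneg_nonneg mult_nonneg_nonneg order_refl zero_le_numeral zero_le_one zero_le_power)
  have "(\<lambda>m. (1 / 3 :: real) ^ m) sums (1 / (1 - 1 / 3))" by (rule geometric_sums) simp
  then have s: "(\<lambda>m. 2 / 3 * (1 / 3 :: real) ^ m) sums (2 / 3 * (1 / (1 - 1 / 3)))" by (rule sums_mult)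
  have "ternary e \<le> (\<Sum>m. 2 / 3 * (1 / 3 :: real) ^ m)" unfolding ternary_def
  proof (rule suminf_le[OF _ ternary_summable sums_summable[OF s]])
    fix m show "2 * e m / 3 ^ Suc m \<le> 2 / 3 * (1 / 3) ^ m"
      using e[of m] by (auto simp: field_simps power_divide)
  qed
  then show "ternary e \<le> 1" using sums_unique[OF s] by simp
qed

text \<open>Multiplication by 3 shifts the digits; what moves in front of the point is the even
  integer \<open>2 * e 0\<close>, invisible to a function of period 2.\<close>

lemma ternary_unfold: "3 * ternary e = 2 * e 0 + ternary (\<lambda>m. e (Suc m))"
proof -
  have "ternary e = 2 * e 0 / 3 + (\<Sum>m. 2 * e (Suc m) / 3 ^ Suc (Suc m))"
    unfolding ternary_def using suminf_split_head[OF ternary_summable] by simp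
  also have "(\<Sum>m. 2 * e (Suc m) / 3 ^ Suc (Suc m)) = (\<Sum>m. (1 / 3) * (2 * e (Suc m) / 3 ^ Suc m))"
    by (intro suminf_cong) simp
  also have "\<dots> = 1 / 3 * ternary (\<lambda>m. e (Suc m))"
  proof -
    have "summable (\<lambda>m. 2 * e (Suc m) / 3 ^ Suc (Suc m))"
      using ternary_summable by (subst summable_Suc_iff)
    then have "summable (\<lambda>m. 3 * (2 * e (Suc m) / 3 ^ Suc (Suc m)))" by (rule summable_mult)
    then have "summable (\<lambda>m. 2 * e (Suc m) / 3 ^ Suc m)" by (simp add: field_simps)
    then show ?thesis unfolding ternary_def by (rule suminf_mult)
  qed
  finally show ?thesis by simp
qed

end

text \<open>After a shift by \<open>m\<close> digits the point lies, modulo 2, in the lower or the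
  upper third of [0, 1] according to digit \<open>m\<close>, and the step function tells
  which.\<close>

lemma schoenberg_step_ternary:
  assumes "\<And>m. e m \<in> {0, 1}"
  shows "schoenberg_step (3 ^ m * ternary e) = e m"
  using assms
proof (induction m arbitrary: e)
  case 0
  then have e': "\<And>m. e (Suc m) \<in> {0, 1}" by blast
  have "ternary e = (2 * e 0 + ternary (\<lambda>m. e (Suc m))) / 3"
    using ternary_unfold[of e, OF 0] by simp
  then show ?case
    using ternary_bounds[of "\<lambda>m. e (Suc m)", OF e'] 0[of 0]
    by (auto intro!: schoenberg_step_low schoenberg_step_high)
next
  case (Suc m)
  then have e': "\<And>m. e (Suc m) \<in> {0, 1}" by blast
  obtain k :: int where k: "e 0 = of_int k" using Suc.prems[of 0] by (auto intro: that[of 0] that[of 1])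
  have "3 ^ Suc m * ternary e = 3 ^ m * (3 * ternary e)" by simp
  also have "\<dots> = 2 * of_int (3 ^ m * k) + 3 ^ m * ternary (\<lambda>m. e (Suc m))"
    unfolding ternary_unfold[of e, OF Suc.prems] using k by (simp add: algebra_simps)
  finally have "schoenberg_step (3 ^ Suc m * ternary e) = schoenberg_step (3 ^ m * ternary (\<lambda>m. e (Suc m)))"
    by (simp only: schoenberg_step_periodic)
  then show ?case using Suc.IH[OF e'] by simp
qed

text \<open>Floors select one binary expansion and make each digit a Borel function of
  \<open>x\<close>; this is the source of measurability of the right inverse.\<close>

definition bin_digit :: "real \<Rightarrow> nat \<Rightarrow> real" where
  "bin_digit x k = of_int (\<lfloor>2 ^ Suc k * x\<rfloor> mod 2)"

lemma bin_digit_sums: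
  assumes "0 \<le> x" "x < 1"
  shows "(\<lambda>k. bin_digit x k / 2 ^ Suc k) sums x"
proof -
  have partial: "(\<Sum>k<n. bin_digit x k / 2 ^ Suc k) = of_int \<lfloor>2 ^ n * x\<rfloor> / 2 ^ n" for n
  proof (induction n)
    case 0
    have "\<lfloor>x\<rfloor> = 0" using assms by (simp add: floor_eq_iff)
    then show ?case by simp
  next
    case (Suc n)
    have "\<lfloor>2 * y\<rfloor> = 2 * \<lfloor>y\<rfloor> + \<lfloor>2 * y\<rfloor> mod 2" for y :: real
    proof -
      have "\<lfloor>2 * y\<rfloor> = 2 * \<lfloor>y\<rfloor> \<or> \<lfloor>2 * y\<rfloor> = 2 * \<lfloor>y\<rfloor> + 1" by linarith
      then show ?thesis by auto
    qed
    from this[of "2 ^ n * x"]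
    have "of_int \<lfloor>2 ^ Suc n * x\<rfloor> = 2 * of_int \<lfloor>2 ^ n * x\<rfloor> + bin_digit x n"
      by (metis bin_digit_def mult.assoc of_int_add of_int_mult of_int_numeral power_Suc)
    then show ?case using Suc by (simp add: field_simps)
  qed
  have "(\<lambda>n. of_int \<lfloor>2 ^ n * x\<rfloor> / 2 ^ n) \<longlonglongrightarrow> x"
  proof (rule tendsto_sandwich)
    show "\<forall>\<^sub>F n in sequentially. x - (1 / 2) ^ n \<le> of_int \<lfloor>2 ^ n * x\<rfloor> / 2 ^ n"
    proof (intro always_eventually allI)
      fix n
      have "2 ^ n * x - 1 \<le> of_int \<lfloor>2 ^ n * x\<rfloor>" by linarith
      then have "(2 ^ n * x - 1) / 2 ^ n \<le> of_int \<lfloor>2 ^ n * x\<rfloor> / 2 ^ n"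
        by (intro divide_right_mono) auto
      then show "x - (1 / 2) ^ n \<le> of_int \<lfloor>2 ^ n * x\<rfloor> / 2 ^ n"
        by (simp add: diff_divide_distrib power_one_over inverse_eq_divide)
    qed
    show "\<forall>\<^sub>F n in sequentially. of_int \<lfloor>2 ^ n * x\<rfloor> / 2 ^ n \<le> x"
      by (intro always_eventually allI) (simp add: field_simps)
    have "(\<lambda>n. x - (1 / 2) ^ n) \<longlonglongrightarrow> x - 0"
      by (intro tendsto_intros LIMSEQ_power_zero) simp
    then show "(\<lambda>n. x - (1 / 2) ^ n) \<longlonglongrightarrow> x" by simp
  qed auto
  then show ?thesis unfolding sums_def partial .
qed

lemma bin_digit_in: "bin_digit x k \<in> {0, 1}"
  unfolding bin_digit_def by (simp add: mod2_eq_if)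

text \<open>The binary digits of coordinate \<open>i\<close> are read from the ternary digits at
  positions \<open>2 * k + i\<close>: even positions for the real part, odd ones for the imaginary
  part.\<close>

definition schoenberg_coord :: "nat \<Rightarrow> real \<Rightarrow> real" where
  "schoenberg_coord i t = (\<Sum>k. schoenberg_step (3 ^ (2 * k + i) * t) / 2 ^ Suc k)"

lemma continuous_schoenberg_coord: "continuous_on UNIV (schoenberg_coord i)"
proof -
  have "uniform_limit UNIV (\<lambda>n t. \<Sum>k<n. schoenberg_step (3 ^ (2 * k + i) * t) / 2 ^ Suc k)
      (schoenberg_coord i) sequentially"
    unfolding schoenberg_coord_def
  proof (rule Weierstrass_m_test)
    show "summable (\<lambda>k. (1 / 2 :: real) ^ Suc k)" by (subst summable_Suc_iff) (simp add: summable_geometric)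
    show "norm (schoenberg_step (3 ^ (2 * k + i) * t) / 2 ^ Suc k) \<le> (1 / 2) ^ Suc k" for k t
      using schoenberg_step_bounds[of "3 ^ (2 * k + i) * t"] by (simp add: field_simps power_divide)
  qed
  then show ?thesis
    by (rule uniform_limit_theorem[rotated])
      (auto intro!: always_eventually continuous_intros simp: schoenberg_step_def)
qed

definition interleaved_digits :: "complex \<Rightarrow> nat \<Rightarrow> real" where
  "interleaved_digits z m = bin_digit (if even m then Re z else Im z) (m div 2)"

definition schoenberg_curve :: "real \<Rightarrow> complex" where
  "schoenberg_curve t = Complex (schoenberg_coord 0 t) (schoenberg_coord 1 t)"

lemma continuous_schoenberg_curve: "continuous_on UNIV schoenberg_curve"
  unfolding schoenberg_curve_def Complex_eq
  by (intro continuous_intros continuous_on_of_real continuous_schoenberg_coord)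

text \<open>The bounds are half-open because the floors give only digits 0 for the number 1.\<close>

lemma schoenberg_curve_ternary:
  assumes "0 \<le> Re z" "Re z < 1" "0 \<le> Im z" "Im z < 1"
  shows "schoenberg_curve (ternary (interleaved_digits z)) = z"
proof -
  have e: "interleaved_digits z m \<in> {0, 1}" for m
    unfolding interleaved_digits_def by (rule bin_digit_in)
  have "schoenberg_coord 0 (ternary (interleaved_digits z)) = Re z"
    unfolding schoenberg_coord_def schoenberg_step_ternary[OF e]
    using sums_unique[OF bin_digit_sums[OF assms(1,2)]] by (simp add: interleaved_digits_def)
  moreover have "schoenberg_coord 1 (ternary (interleaved_digits z)) = Im z"
    unfolding schoenberg_coord_def schoenberg_step_ternary[OF e]
    using sums_unique[OF bin_digit_sums[OF assms(3,4)]] by (simp add: interleaved_digits_def)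
  ultimately show ?thesis by (simp add: schoenberg_curve_def)
qed

lemma measurable_ternary_digits: "(\<lambda>z. ternary (interleaved_digits z)) \<in> borel_measurable borel"
proof -
  have [measurable]: "(\<lambda>x. bin_digit x k) \<in> borel_measurable borel" for k
    unfolding bin_digit_def by measurable
  have "(\<lambda>z. interleaved_digits z m) \<in> borel_measurable borel" for m
    unfolding interleaved_digits_def
    by (cases "even m") (auto intro!: measurable_compose[OF borel_measurable_continuous_onI] continuous_intros)
  then show ?thesis unfolding ternary_def by measurable
qed

text \<open>Helly's selection theorem and Skorohod's theorem are transferred from the line to the plane:
  measures are pulled back along a Borel right inverse of Schoenberg's space-filling curve.\<close>

lemma Skorohod_complex:
  fixes \<mu> :: "nat \<Rightarrow> complex measure"
  assumes prob: "\<And>n. prob_space (\<mu> n)" and sets: "\<And>n. sets (\<mu> n) = sets borel"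
    and R: "\<And>n. AE z in \<mu> n. cmod z \<le> R"
  obtains r and \<Omega> :: "real measure" and Zs :: "nat \<Rightarrow> real \<Rightarrow> complex" and Z
  where "strict_mono (r :: nat \<Rightarrow> nat)" "prob_space \<Omega>"
    "\<And>n. Zs n \<in> borel_measurable \<Omega>" "Z \<in> borel_measurable \<Omega>"
    "\<And>n. distr \<Omega> borel (Zs n) = \<mu> (r n)"
    "\<And>x. x \<in> space \<Omega> \<Longrightarrow> (\<lambda>n. Zs n x) \<longlonglongrightarrow> Z x"
proof -
  \<comment> \<open>The map z to (z + w) / c sends the disc of radius \<open>R\<close> well inside
    the half-open unit square; \<open>\<bar>R\<bar> + 1\<close> keeps \<open>c\<close> positive for
    every real \<open>R\<close>.\<close>
  define c where "c = 4 * (\<bar>R\<bar> + 1)"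
  define w where "w = Complex (\<bar>R\<bar> + 1) (\<bar>R\<bar> + 1)"
  define \<Phi> where "\<Phi> t = of_real c * schoenberg_curve t - w" for t
  define \<psi> where "\<psi> z = ternary (interleaved_digits ((z + w) / of_real c))" for z
  have cpos: "c > 0" by (simp add: c_def add_nonneg_pos)
  have [measurable]: "\<Phi> \<in> borel_measurable borel"
    unfolding \<Phi>_def
    by (intro borel_measurable_continuous_onI continuous_intros continuous_schoenberg_curve)
  have [measurable]: "\<psi> \<in> borel_measurable borel"
    unfolding \<psi>_def by (rule measurable_compose[OF _ measurable_ternary_digits]) measurable
  have \<Phi>\<psi>: "\<Phi> (\<psi> z) = z" if "cmod z \<le> R" for z
  proof -
    have "\<bar>Re z\<bar> \<le> R" "\<bar>Im z\<bar> \<le> R"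
      using that abs_Re_le_cmod[of z] abs_Im_le_cmod[of z] by linarith+
    then have "schoenberg_curve (\<psi> z) = (z + w) / of_real c"
      unfolding \<psi>_def by (intro schoenberg_curve_ternary) (auto simp: w_def c_def field_simps)
    then show ?thesis using cpos by (simp add: \<Phi>_def)
  qed
  have \<psi>_bounds: "0 \<le> \<psi> z" "\<psi> z \<le> 1" for z
    unfolding \<psi>_def by (intro ternary_bounds; simp only: interleaved_digits_def bin_digit_in)+
  define \<nu> where "\<nu> n = distr (\<mu> n) borel \<psi>" for n
  have [measurable_cong]: "sets (\<mu> n) = sets borel" for n by (rule sets)
  have \<nu>: "real_distribution (\<nu> n)" for n
    unfolding \<nu>_def by (rule prob_space.real_distribution_distr[OF prob]) measurable
  have "tight \<nu>"
    unfolding tight_def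
  proof (intro conjI allI impI, rule \<nu>, rule exI[of _ "-1"], rule exI[of _ 1], intro conjI allI)
    fix \<epsilon> :: real and n assume "0 < \<epsilon>"
    interpret \<mu>: prob_space "\<mu> n" by (rule prob)
    have "measure (\<nu> n) {-1<..1} = measure (\<mu> n) (\<psi> -` {-1<..1} \<inter> space (\<mu> n))"
      unfolding \<nu>_def by (rule measure_distr) auto
    also have "\<psi> -` {-1<..1} \<inter> space (\<mu> n) = space (\<mu> n)"
    proof -
      have "-1 < \<psi> x" for x using \<psi>_bounds(1)[of x] by linarith
      then show ?thesis using \<psi>_bounds(2) by auto
    qed
    finally show "1 - \<epsilon> < measure (\<nu> n) {-1<..1}" using \<open>0 < \<epsilon>\<close> by (simp add: \<mu>.prob_space)
  qed auto
  from tight_imp_convergent_subsubsequence[OF this strict_mono_id]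
  obtain r N where r: "strict_mono (r :: nat \<Rightarrow> nat)" and N: "real_distribution N"
    and conv: "weak_conv_m (\<nu> \<circ> r) N" by (auto simp: o_def id_def)
  have "\<forall>n. real_distribution ((\<nu> \<circ> r) n)" using \<nu> by simp
  from Skorohod[OF _ N conv] this
  obtain \<Omega> :: "real measure" and Ys Y where *: "prob_space \<Omega> \<and> (\<forall>n. Ys n \<in> borel_measurable \<Omega>) \<and>
      (\<forall>n. distr \<Omega> borel (Ys n) = (\<nu> \<circ> r) n) \<and> Y \<in> measurable \<Omega> lborel \<and> distr \<Omega> borel Y = N \<and>
      (\<forall>x\<in>space \<Omega>. (\<lambda>n. Ys n x) \<longlonglongrightarrow> Y x)" by metis
  then have \<Omega>: "prob_space \<Omega>" and Ys[measurable]: "\<And>n. Ys n \<in> borel_measurable \<Omega>"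
    and d: "\<And>n. distr \<Omega> borel (Ys n) = \<nu> (r n)"
    and lim: "\<And>x. x \<in> space \<Omega> \<Longrightarrow> (\<lambda>n. Ys n x) \<longlonglongrightarrow> Y x"
    by auto
  have [measurable]: "Y \<in> borel_measurable \<Omega>" using * by simp
  show thesis
  \<comment> \<open>Pulling back uses only measurability of \<open>\<psi>\<close>; the pointwise
    convergence is carried to the plane by continuity of \<open>\<Phi>\<close>.\<close>
  proof (rule that[OF r \<Omega>, of "\<lambda>n x. \<Phi> (Ys n x)" "\<lambda>x. \<Phi> (Y x)"])
    fix n
    have "distr \<Omega> borel (\<lambda>x. \<Phi> (Ys n x)) = distr (distr \<Omega> borel (Ys n)) borel \<Phi>"
      by (subst distr_distr) (auto simp: o_def)
    also have "\<dots> = distr (\<mu> (r n)) borel (\<lambda>z. \<Phi> (\<psi> z))"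
      unfolding d \<nu>_def by (subst distr_distr) (auto simp: o_def)
    also have "\<dots> = distr (\<mu> (r n)) (\<mu> (r n)) (\<lambda>z. z)"
    proof (rule distr_cong_AE)
      show "AE z in \<mu> (r n). \<Phi> (\<psi> z) = z" using R[of "r n"] by eventually_elim (rule \<Phi>\<psi>)
    qed (auto simp: sets)
    finally show "distr \<Omega> borel (\<lambda>x. \<Phi> (Ys n x)) = \<mu> (r n)" by (simp add: distr_id)
  next
    fix x assume "x \<in> space \<Omega>"
    moreover have "isCont \<Phi> y" for y
      unfolding \<Phi>_def using continuous_schoenberg_curve
      by (intro continuous_intros) (simp add: continuous_on_eq_continuous_at)
    ultimately show "(\<lambda>n. \<Phi> (Ys n x)) \<longlonglongrightarrow> \<Phi> (Y x)"
      using lim isCont_tendsto_compose by blast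
  qed measurable
qed

section \<open>Mean value property and maximum principles\<close>

definition unit_interval_measure :: "real measure" where
  "unit_interval_measure = restrict_space lborel {0..1}"

lemma prob_space_unit_interval: "prob_space unit_interval_measure"
  unfolding unit_interval_measure_def
  by (rule prob_spaceI) (simp add: emeasure_restrict_space space_restrict_space)

lemma space_unit_interval [simp]: "space unit_interval_measure = {0..1}"
  by (simp add: unit_interval_measure_def space_restrict_space)

lemma
  fixes f :: "real \<Rightarrow> real"
  assumes "continuous_on {0..1} f"
  shows integrable_unit_interval: "integrable unit_interval_measure f"
    and integral_unit_interval: "(\<integral>x. f x \<partial>unit_interval_measure) = integral {0..1} f"
proof -
  have s: "set_integrable lborel {0..1} f"
    using assms by (rule borel_integrable_atLeastAtMost')
  then show "integrable unit_interval_measure f"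
    unfolding unit_interval_measure_def by (simp add: integrable_restrict_space set_integrable_def)
  have "(\<integral>x. f x \<partial>unit_interval_measure) = (LINT x:{0..1}|lborel. f x)"
    unfolding unit_interval_measure_def set_lebesgue_integral_def by (subst integral_restrict_space) auto
  then show "(\<integral>x. f x \<partial>unit_interval_measure) = integral {0..1} f"
    using set_borel_integral_eq_integral(2)[OF s] by simp
qed

lemma circlepath_in_sphere: "0 \<le> r \<Longrightarrow> circlepath z r x \<in> sphere z r"
  by (simp add: circlepath dist_norm norm_mult)

lemma continuous_on_circlepath_comp:
  assumes "continuous_on (sphere z r) u" "0 \<le> r"
  shows "continuous_on {0..1} (\<lambda>x. u (circlepath z r x))"
proof (rule continuous_on_compose2[OF assms(1)])
  show "continuous_on {0..1} (circlepath z r)" unfolding circlepath by (intro continuous_intros)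
  show "circlepath z r ` {0..1} \<subseteq> sphere z r" using circlepath_in_sphere[OF assms(2)] by blast
qed

lemma zero_mean_imp_zero_on_sphere:
  fixes u :: "complex \<Rightarrow> real"
  assumes cont: "continuous_on (sphere z r) u" and r: "0 < r"
    and nonneg: "\<And>w. w \<in> sphere z r \<Longrightarrow> 0 \<le> u w"
    and mean: "(\<integral>x. u (circlepath z r x) \<partial>unit_interval_measure) = 0"
    and w: "w \<in> sphere z r"
  shows "u w = 0"
proof -
  note c = continuous_on_circlepath_comp[OF cont less_imp_le[OF r]]
  have "w \<in> path_image (circlepath z r)" using w r by simp
  then obtain x where x: "x \<in> {0..1}" "w = circlepath z r x" by (auto simp: path_image_def)
  have "((\<lambda>x. u (circlepath z r x)) has_integral 0) (cbox 0 1)"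
    using mean integral_unit_interval[OF c] integrable_integral[OF integrable_continuous_real[OF c]] by simp
  then have "u (circlepath z r x) = 0"
    by (rule has_integral_0_cbox_imp_0[rotated 2])
      (use c x r in \<open>auto intro!: nonneg circlepath_in_sphere simp del: mem_sphere simp: less_imp_le\<close>)
  then show ?thesis using x by simp
qed

text \<open>The real part of Cauchy's formula at 0 for \<open>Ln (1 + a * u)\<close>: for |a| < 1
  the argument has positive real part on the closed unit disc, and the value at the centre is
  \<open>Ln 1\<close>.\<close>

lemma mean_ln_norm_one_plus:
  assumes "cmod a < 1"
  shows "(\<integral>x. ln (cmod (1 + a * exp (2 * of_real pi * \<i> * of_real x))) \<partial>unit_interval_measure) = 0"
proof -
  have re: "1 + a * u \<notin> \<real>\<^sub>\<le>\<^sub>0" if "cmod u \<le> 1" for u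
  proof -
    have "cmod (a * u) < 1" using assms that by (simp add: norm_mult) (metis mult_left_le norm_ge_zero order_le_less_trans)
    then have "Re (a * u) > -1" using abs_Re_le_cmod[of "a * u"] by linarith
    then show ?thesis by (auto simp: complex_nonpos_Reals_iff)
  qed
  have "((\<lambda>u. Ln (1 + a * u) / (u - 0)) has_contour_integral (2 * of_real pi * \<i> * Ln (1 + a * 0))) (circlepath 0 1)"
    by (rule Cauchy_integral_circlepath_simple) (auto intro!: holomorphic_intros simp: re)
  then have "((\<lambda>u. Ln (1 + a * u) / u) has_contour_integral 0) (circlepath 0 1)" by simp
  then have "((\<lambda>x. Ln (1 + a * exp (2 * of_real pi * \<i> * of_real x)) * (2 * pi * \<i>)) has_integral 0) {0..1}"
    unfolding has_contour_integral_def
    by (rule has_integral_eq[rotated], simp add: vector_derivative_circlepath01, simp add: circlepath)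
  from has_integral_mult_left[OF this, of "1 / (2 * pi * \<i>)"]
  have "((\<lambda>x. Ln (1 + a * exp (2 * of_real pi * \<i> * of_real x))) has_integral 0) {0..1}"
    by (simp add: field_simps)
  from has_integral_linear[OF this bounded_linear_Re]
  have hi: "((\<lambda>x. Re (Ln (1 + a * exp (2 * of_real pi * \<i> * of_real x)))) has_integral 0) {0..1}"
    by (simp add: o_def)
  have nz: "1 + a * exp (2 * of_real pi * \<i> * of_real x) \<noteq> 0" for x
    using re[of "exp (2 * of_real pi * \<i> * of_real x)"] by auto
  have "continuous_on {0..1} (\<lambda>x. ln (cmod (1 + a * exp (2 * of_real pi * \<i> * of_real x))))"
    by (intro continuous_intros) (use nz in auto)
  from integral_unit_interval[OF this] integral_unique[OF hi] nz show ?thesis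
    by simp
qed

text \<open>Jensen's formula for a single zero \<open>t\<close>. The case of \<open>t\<close> on the
  circle is excluded so that the integrand stays continuous.\<close>

lemma circle_mean_ln_dist:
  assumes r: "0 < r" and t: "cmod (z - t) \<noteq> r"
  shows "(\<integral>x. ln (cmod (circlepath z r x - t)) \<partial>unit_interval_measure) = ln (max r (cmod (z - t)))"
proof -
  interpret I: prob_space unit_interval_measure by (rule prob_space_unit_interval)
  let ?e = "\<lambda>x. exp (2 * of_real pi * \<i> * of_real x) :: complex"
  have nz1: "1 + a * ?e x \<noteq> 0" if "cmod a < 1" for a x
  proof
    assume "1 + a * ?e x = 0"
    then have "a * ?e x = -1" by (simp add: eq_neg_iff_add_eq_0 add.commute)
    then have "cmod (a * ?e x) = 1" by simp
    then show False using that by (simp add: norm_mult)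
  qed
  have mean: "(\<integral>x. c + ln (cmod (1 + a * ?e x)) \<partial>unit_interval_measure) = c" if "cmod a < 1" for a c
  proof -
    have "integrable unit_interval_measure (\<lambda>x. ln (cmod (1 + a * ?e x)))"
      using nz1[OF that] by (intro integrable_unit_interval continuous_intros) auto
    then show ?thesis using mean_ln_norm_one_plus[OF that] I.prob_space by simp
  qed
  consider "cmod (z - t) < r" | "r < cmod (z - t)" using t by linarith
  then show ?thesis
  proof cases
    case 2
    then have nz: "z - t \<noteq> 0" using r by auto
    define a where "a = of_real r / (z - t)"
    have a: "cmod a < 1" using 2 r nz by (simp add: a_def norm_divide divide_less_eq_1)
    have "ln (cmod (circlepath z r x - t)) = ln (cmod (z - t)) + ln (cmod (1 + a * ?e x))" for x
    proof -
      have "circlepath z r x - t = (z - t) * (1 + a * ?e x)"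
        using nz by (simp add: a_def circlepath field_simps)
      moreover have "1 + a * ?e x \<noteq> 0" by (rule nz1[OF a])
      ultimately show ?thesis using nz by (simp add: norm_mult ln_mult)
    qed
    then show ?thesis using mean[OF a, of "ln (cmod (z - t))"] 2 by simp
  next
    case 1
    \<comment> \<open>For \<open>t\<close> inside the circle, the point on the unit circle times
      \<open>r\<close> is factored out; the remaining factor is the conjugate of one of the form
      \<open>1 + a * ?e x\<close>, so it has the same modulus.\<close>
    define a where "a = cnj ((z - t) / of_real r)"
    have a: "cmod a < 1" using 1 r by (simp add: a_def norm_divide del: complex_cnj_diff complex_cnj_divide)
    have "ln (cmod (circlepath z r x - t)) = ln r + ln (cmod (1 + a * ?e x))" for x
    proof -
      have cnj_e: "cnj (?e x) * ?e x = 1"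
        by (simp add: exp_cnj flip: exp_add)
      have "circlepath z r x - t = of_real r * ?e x * (1 + cnj a * cnj (?e x))"
        using r cnj_e by (simp add: a_def circlepath field_simps)
      also have "1 + cnj a * cnj (?e x) = cnj (1 + a * ?e x)" by simp
      finally have "cmod (circlepath z r x - t) = r * cmod (1 + a * ?e x)"
        using r by (simp add: norm_mult del: complex_cnj_add complex_cnj_mult)
      moreover have "1 + a * ?e x \<noteq> 0" by (rule nz1[OF a])
      ultimately show ?thesis using r by (simp add: ln_mult)
    qed
    then show ?thesis using mean[OF a, of "ln r"] 1 by simp
  qed
qed

section \<open>Harmonicity through circle means\<close>

text \<open>For open \<open>S\<close> these are the harmonic functions on \<open>S\<close>. The mean
  value form is linear in \<open>u\<close> and suits both potentials and averages of ln |z -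
  t|.\<close>

definition mean_value_on :: "complex set \<Rightarrow> (complex \<Rightarrow> real) \<Rightarrow> bool" where
  "mean_value_on S u \<longleftrightarrow> continuous_on S u \<and>
     (\<forall>z r. 0 < r \<longrightarrow> cball z r \<subseteq> S \<longrightarrow>
        (\<integral>x. u (circlepath z r x) \<partial>unit_interval_measure) = u z)"

lemma mean_value_on_integrable:
  assumes "mean_value_on S u" "cball z r \<subseteq> S" "0 < r"
  shows "integrable unit_interval_measure (\<lambda>x. u (circlepath z r x))"
  using assms unfolding mean_value_on_def
  by (intro integrable_unit_interval continuous_on_circlepath_comp)
     (auto elim!: continuous_on_subset)

lemma mean_value_on_add:
  assumes "mean_value_on S u" "mean_value_on S v"
  shows "mean_value_on S (\<lambda>z. u z + v z)"
  using assms mean_value_on_integrable[OF assms(1)] mean_value_on_integrable[OF assms(2)]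
  unfolding mean_value_on_def by (auto intro!: continuous_intros)

lemma mean_value_on_cmult:
  assumes "mean_value_on S u"
  shows "mean_value_on S (\<lambda>z. c * u z)"
  using assms unfolding mean_value_on_def by (auto intro!: continuous_intros)

lemma mean_value_on_const: "mean_value_on S (\<lambda>z. c)"
  using prob_space.prob_space[OF prob_space_unit_interval] unfolding mean_value_on_def
  by (auto intro!: continuous_intros)

lemma mean_value_on_diff:
  assumes "mean_value_on S u" "mean_value_on S v"
  shows "mean_value_on S (\<lambda>z. u z - v z)"
  using mean_value_on_add[OF assms(1) mean_value_on_cmult[OF assms(2), of "-1"]] by simp

lemma mean_value_on_sum:
  assumes "\<And>i. i \<in> A \<Longrightarrow> mean_value_on S (u i)"
  shows "mean_value_on S (\<lambda>z. \<Sum>i\<in>A. u i z)"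
  using assms
  by (induction A rule: infinite_finite_induct) (auto intro: mean_value_on_const mean_value_on_add)

lemma mean_value_on_subset: "mean_value_on S u \<Longrightarrow> T \<subseteq> S \<Longrightarrow> mean_value_on T u"
  unfolding mean_value_on_def by (meson continuous_on_subset subset_trans)

lemma mean_value_on_zero_sphere:
  assumes u: "mean_value_on S u" and nonneg: "\<And>w. w \<in> S \<Longrightarrow> 0 \<le> u w"
    and z: "u z = 0" and r: "0 < r" "cball z r \<subseteq> S" and w: "w \<in> sphere z r"
  shows "u w = 0"
proof -
  have s: "sphere z r \<subseteq> S" using r by (auto simp: subset_iff)
  have c: "continuous_on (sphere z r) u" using u s unfolding mean_value_on_def by (meson continuous_on_subset)
  have m: "(\<integral>x. u (circlepath z r x) \<partial>unit_interval_measure) = 0"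
    using u r z unfolding mean_value_on_def by auto
  show ?thesis
    by (rule zero_mean_imp_zero_on_sphere[OF c r(1) _ m w]) (use nonneg s in blast)
qed

text \<open>Boundary behaviour is packed into compactness of the superlevel set: each application
  shows that points with \<open>s \<le> u z\<close> accumulate neither at the boundary of
  \<open>S\<close> nor at infinity.\<close>

lemma mean_value_on_max_principle:
  assumes S: "open S" and u: "mean_value_on S u" and K: "compact {z\<in>S. s \<le> u z}" and w: "w \<in> S"
  shows "u w < s"
proof (rule ccontr)
  assume "\<not> u w < s"
  define K where "K = {z\<in>S. s \<le> u z}"
  have cont: "continuous_on K u" using u unfolding mean_value_on_def K_def by (auto elim: continuous_on_subset)
  have "compact K" "K \<noteq> {}" using K \<open>\<not> u w < s\<close> w unfolding K_def by auto
  then obtain z0 where z0: "z0 \<in> K" "\<And>z. z \<in> K \<Longrightarrow> u z \<le> u z0"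
    using continuous_attains_sup[OF _ _ cont] by auto
  define K1 where "K1 = {z\<in>K. u z = u z0}"
  have "compact K1"
  proof -
    have "closedin (top_of_set K) (K \<inter> u -` {u z0})"
      using cont by (rule continuous_closedin_preimage) simp
    then have "compact (K \<inter> u -` {u z0})" using \<open>compact K\<close> closedin_compact by blast
    moreover have "K \<inter> u -` {u z0} = K1" by (auto simp: K1_def)
    ultimately show ?thesis by simp
  qed
  moreover have "K1 \<noteq> {}" using z0 by (auto simp: K1_def)
  moreover have "continuous_on K1 Re" by (intro continuous_intros)
  \<comment> \<open>A rightmost maximum point: a small circle around it also consists of maximum
    points, and one of them lies further right.\<close>
  ultimately obtain z1 where z1: "z1 \<in> K1" "\<And>z. z \<in> K1 \<Longrightarrow> Re z \<le> Re z1"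
    using continuous_attains_sup[of K1 Re] by blast
  then have "z1 \<in> S" by (auto simp: K1_def K_def)
  then obtain r where r: "0 < r" "cball z1 r \<subseteq> S" using S open_contains_cball by blast
  have le: "u z \<le> u z0" if "z \<in> S" for z
    using z0 that by (cases "s \<le> u z") (auto simp: K_def)
  have "u z0 - u (z1 + of_real r) = 0"
    by (rule mean_value_on_zero_sphere[OF mean_value_on_diff[OF mean_value_on_const u] _ _ r])
      (use le z1 r in \<open>auto simp: K1_def dist_norm\<close>)
  moreover have "z1 + of_real r \<in> S" using r by (auto simp: subset_iff dist_norm)
  ultimately have "z1 + of_real r \<in> K1" using z0 by (auto simp: K1_def K_def)
  then show False using z1(2)[of "z1 + of_real r"] r by simp
qed

text \<open>The zero set is closed by continuity, and open because every circle in \<open>S\<close>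
  centred at a zero consists of zeros.\<close>

lemma mean_value_on_strong_min_principle:
  assumes S: "open S" "connected S" and u: "mean_value_on S u" and nonneg: "\<And>w. w \<in> S \<Longrightarrow> 0 \<le> u w"
    and z: "z \<in> S" "u z = 0" and w: "w \<in> S"
  shows "u w = 0"
proof -
  define Z where "Z = S \<inter> u -` {0}"
  have "closedin (top_of_set S) Z"
    unfolding Z_def using u by (intro continuous_closedin_preimage) (auto simp: mean_value_on_def)
  moreover have "open Z"
    unfolding open_contains_ball
  proof
    fix a assume a: "a \<in> Z"
    then obtain r where r: "0 < r" "cball a r \<subseteq> S" using S open_contains_cball unfolding Z_def by blast
    have "b \<in> Z" if b: "b \<in> ball a r" for b
    proof (cases "b = a")
      case False
      have sub: "cball a (dist a b) \<subseteq> S" using r b by (auto simp: subset_iff)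
      have "u b = 0"
        by (rule mean_value_on_zero_sphere[OF u nonneg _ _ sub]) (use a False in \<open>auto simp: Z_def\<close>)
      then show ?thesis using r b by (auto simp: Z_def subset_iff)
    qed (use a in simp)
    then show "\<exists>e>0. ball a e \<subseteq> Z" using r by (intro exI[of _ r]) auto
  qed
  then have "openin (top_of_set S) Z" by (intro open_subset) (auto simp: Z_def)
  moreover have "Z \<noteq> {}" using z by (auto simp: Z_def)
  ultimately have "Z = S" using S(2) by (auto simp: connected_clopen)
  then show ?thesis using w by (auto simp: Z_def)
qed

section \<open>Potentials off a compact set that carries the measure\<close>

text \<open>A Bochner integral, with value 0 where the kernel is not integrable. It is therefore
  used off a compact carrier only, until integrability at every point is known for the
  minimizer.\<close>

definition log_potential :: "complex measure \<Rightarrow> complex \<Rightarrow> real" where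
  "log_potential \<mu> z = (\<integral>t. - ln (cmod (z - t)) \<partial>\<mu>)"

lemma abs_ln_le:
  fixes x :: real
  assumes "a > 0" "a \<le> x" "x \<le> b"
  shows "\<bar>ln x\<bar> \<le> \<bar>ln a\<bar> + \<bar>ln b\<bar>"
proof -
  have "ln a \<le> ln x" "ln x \<le> ln b" using assms by auto
  then show ?thesis by linarith
qed

lemma compact_ln_dist_bounded:
  assumes "compact F" "compact K" "K \<inter> F = {}"
  obtains C where "\<And>z t. z \<in> K \<Longrightarrow> t \<in> F \<Longrightarrow> \<bar>ln (cmod (z - t))\<bar> \<le> C"
proof -
  have "compact ((\<lambda>p. ln (cmod (fst p - snd p))) ` (K \<times> F))"
    by (intro compact_continuous_image compact_Times assms continuous_intros) (use assms(3) in auto)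
  then obtain C where "\<And>y. y \<in> (\<lambda>p. ln (cmod (fst p - snd p))) ` (K \<times> F) \<Longrightarrow> norm y \<le> C"
    using compact_imp_bounded bounded_iff by metis
  then show ?thesis by (intro that[of C]) (force simp: image_iff)
qed

context
  fixes \<mu> :: "complex measure" and F :: "complex set"
  assumes prob: "prob_space \<mu>" and sets: "sets \<mu> = sets borel"
    and F: "compact F" and supp: "AE t in \<mu>. t \<in> F"
begin

lemma integrable_ln_off_support:
  assumes "z \<notin> F"
  shows "integrable \<mu> (\<lambda>t. ln (cmod (z - t)))"
proof -
  interpret prob_space \<mu> by (rule prob)
  obtain C where C: "\<And>w t. w \<in> {z} \<Longrightarrow> t \<in> F \<Longrightarrow> \<bar>ln (cmod (w - t))\<bar> \<le> C"
    by (rule compact_ln_dist_bounded[OF F, of "{z}"]) (use assms in auto)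
  have [measurable_cong]: "sets \<mu> = sets borel" by (rule sets)
  show ?thesis
    by (rule integrable_const_bound[where B = C]) (use supp C in \<open>auto elim: eventually_mono\<close>)
qed

lemma continuous_log_potential: "continuous_on (- F) (log_potential \<mu>)"
proof -
  interpret prob_space \<mu> by (rule prob)
  have [measurable_cong]: "sets \<mu> = sets borel" by (rule sets)
  have "isCont (log_potential \<mu>) z" if z: "z \<in> - F" for z
  proof -
    have "open (- F)" using F compact_imp_closed by blast
    then obtain e where e: "0 < e" "cball z e \<subseteq> - F" using z open_contains_cball by blast
    obtain C where C: "\<And>w t. w \<in> cball z e \<Longrightarrow> t \<in> F \<Longrightarrow> \<bar>ln (cmod (w - t))\<bar> \<le> C"
      using compact_ln_dist_bounded[OF F compact_cball, of z e] e by blast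
    show ?thesis
      unfolding log_potential_def
    proof (rule continuous_at_sequentiallyI)
      fix u assume u: "u \<longlonglongrightarrow> z"
      have "\<forall>\<^sub>F n in sequentially. u n \<in> ball z e"
        by (rule topological_tendstoD[OF u]) (use e in auto)
      then obtain N where N: "\<And>n. n \<ge> N \<Longrightarrow> u n \<in> ball z e"
        unfolding eventually_sequentially by blast
      have "(\<lambda>n. \<integral>t. - ln (cmod (u (n + N) - t)) \<partial>\<mu>) \<longlonglongrightarrow> (\<integral>t. - ln (cmod (z - t)) \<partial>\<mu>)"
      proof (rule integral_dominated_convergence[where w = "\<lambda>_. C"])
        show "AE t in \<mu>. (\<lambda>n. - ln (cmod (u (n + N) - t))) \<longlonglongrightarrow> - ln (cmod (z - t))"
          using supp
        proof eventually_elim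
          case (elim t)
          then have "cmod (z - t) \<noteq> 0" using z by auto
          then show ?case
            by (intro tendsto_intros LIMSEQ_ignore_initial_segment[OF u]) auto
        qed
        show "AE t in \<mu>. norm (- ln (cmod (u (n + N) - t))) \<le> C" for n
          using supp by eventually_elim (use C[of "u (n + N)"] N[of "n + N"] in auto)
      qed auto
      then show "(\<lambda>n. \<integral>t. - ln (cmod (u n - t)) \<partial>\<mu>) \<longlonglongrightarrow> (\<integral>t. - ln (cmod (z - t)) \<partial>\<mu>)"
        by (rule LIMSEQ_offset)
    qed
  qed
  then show ?thesis by (intro continuous_at_imp_continuous_on) auto
qed

lemma circle_mean_log_potential:
  assumes r: "0 < r" and disj: "sphere z r \<inter> F = {}"
  shows "(\<integral>x. log_potential \<mu> (circlepath z r x) \<partial>unit_interval_measure)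
    = (\<integral>t. - ln (max r (cmod (z - t))) \<partial>\<mu>)"
proof -
  interpret prob_space \<mu> by (rule prob)
  interpret I: prob_space unit_interval_measure by (rule prob_space_unit_interval)
  interpret P: pair_sigma_finite unit_interval_measure \<mu> ..
  interpret PP: pair_prob_space unit_interval_measure \<mu> ..
  have [measurable_cong]: "sets \<mu> = sets borel" by (rule sets)
  have [measurable_cong]: "sets unit_interval_measure = sets (restrict_space borel {0..1})"
    unfolding unit_interval_measure_def by (rule sets_restrict_space_cong) simp
  have [measurable]: "circlepath z r \<in> borel_measurable unit_interval_measure"
    unfolding circlepath unit_interval_measure_def
    by (rule measurable_restrict_space1) (simp add: borel_measurable_continuous_onI continuous_intros)
  have [measurable]: "F \<in> sets borel" using F by (simp add: borel_compact)
  obtain C where C: "\<And>w t. w \<in> sphere z r \<Longrightarrow> t \<in> F \<Longrightarrow> \<bar>ln (cmod (w - t))\<bar> \<le> C"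
    using compact_ln_dist_bounded[OF F compact_sphere disj] by blast
  \<comment> \<open>Cutting the kernel off outside \<open>F\<close> makes it bounded at every pair
    of points, so Fubini applies; it changes nothing almost everywhere.\<close>
  define k where "k x t = indicator F t * - ln (cmod (circlepath z r x - t))" for x t
  have kb: "\<bar>k x t\<bar> \<le> \<bar>C\<bar>" for x t
    using C[OF circlepath_in_sphere, of t x] r unfolding k_def by (auto split: split_indicator)
  have int: "integrable (unit_interval_measure \<Otimes>\<^sub>M \<mu>) (\<lambda>(x, t). k x t)"
    by (rule PP.P.integrable_const_bound[where B = "\<bar>C\<bar>"]) (use kb in \<open>auto simp: k_def\<close>)
  have "(\<integral>x. log_potential \<mu> (circlepath z r x) \<partial>unit_interval_measure) = (\<integral>x. (\<integral>t. k x t \<partial>\<mu>) \<partial>unit_interval_measure)"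
    unfolding log_potential_def k_def
    by (intro Bochner_Integration.integral_cong refl integral_cong_AE) (use supp in \<open>auto elim: eventually_mono\<close>)
  also have "\<dots> = (\<integral>t. (\<integral>x. k x t \<partial>unit_interval_measure) \<partial>\<mu>)"
    using P.Fubini_integral[OF int] by simp
  also have "\<dots> = (\<integral>t. - ln (max r (cmod (z - t))) \<partial>\<mu>)"
  proof (rule integral_cong_AE)
    show "AE t in \<mu>. (\<integral>x. k x t \<partial>unit_interval_measure) = - ln (max r (cmod (z - t)))"
      using supp
    proof eventually_elim
      case (elim t)
      then have "cmod (z - t) \<noteq> r" using disj by (auto simp: dist_norm)
      from circle_mean_ln_dist[OF r this] elim show ?case by (simp add: k_def)
    qed
  qed (auto simp: k_def)
  finally show ?thesis .
qed

lemma mean_value_on_log_potential: "mean_value_on (- F) (log_potential \<mu>)"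
  unfolding mean_value_on_def
proof (intro conjI continuous_log_potential allI impI)
  fix z r assume r: "(0::real) < r" and sub: "cball z r \<subseteq> - F"
  have [measurable_cong]: "sets \<mu> = sets borel" by (rule sets)
  have "(\<integral>t. - ln (max r (cmod (z - t))) \<partial>\<mu>) = log_potential \<mu> z"
    unfolding log_potential_def
  proof (rule integral_cong_AE)
    show "AE t in \<mu>. - ln (max r (cmod (z - t))) = - ln (cmod (z - t))"
      using supp
    proof eventually_elim
      case (elim t)
      then have "\<not> cmod (z - t) \<le> r" using sub by (auto simp: dist_norm)
      then show ?case by (simp add: max_def)
    qed
  qed auto
  then show "(\<integral>x. log_potential \<mu> (circlepath z r x) \<partial>unit_interval_measure) = log_potential \<mu> z"
    using circle_mean_log_potential[OF r] sub by (metis Compl_iff disjoint_iff mem_cball mem_sphere order_refl subsetD)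
qed

text \<open>Forces the potential to minus infinity far out, which keeps superlevel sets bounded in
  the maximum principle.\<close>

lemma log_potential_le_far:
  assumes "\<And>t. t \<in> F \<Longrightarrow> cmod t \<le> R" "R < cmod z"
  shows "log_potential \<mu> z \<le> - ln (cmod z - R)"
proof -
  interpret prob_space \<mu> by (rule prob)
  have [measurable_cong]: "sets \<mu> = sets borel" by (rule sets)
  have "z \<notin> F" using assms by force
  then have "log_potential \<mu> z \<le> (\<integral>t. - ln (cmod z - R) \<partial>\<mu>)"
    unfolding log_potential_def
  proof (intro integral_mono_AE integrable_ln_off_support[THEN integrable_minus])
    show "AE t in \<mu>. - ln (cmod (z - t)) \<le> - ln (cmod z - R)"
      using supp
    proof eventually_elim
      case (elim t)
      have "cmod z - R \<le> cmod (z - t)" using norm_triangle_ineq2[of z t] assms(1)[OF elim] by linarith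
      then show ?case using assms(2) by (simp add: ln_mono)
    qed
  qed auto
  then show ?thesis by (simp add: prob_space)
qed

end

section \<open>Strict conditional positive definiteness of the logarithmic kernel\<close>

definition double_integral :: "(complex \<Rightarrow> complex \<Rightarrow> real) \<Rightarrow> complex measure \<Rightarrow> complex measure \<Rightarrow> real" where
  "double_integral k \<mu> \<nu> = (\<integral>p. k (fst p) (snd p) \<partial>(\<mu> \<Otimes>\<^sub>M \<nu>))"

lemma prob_measures_onD:
  assumes "\<mu> \<in> prob_measures_on E" "closed E"
  shows "prob_space \<mu>" "sets \<mu> = sets borel" "AE z in \<mu>. z \<in> E"
proof -
  show "prob_space \<mu>" and s: "sets \<mu> = sets borel" using assms by (auto simp: prob_measures_on_def)
  have sp: "space \<mu> = UNIV" using sets_eq_imp_space_eq[OF s] by simp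
  show "AE z in \<mu>. z \<in> E"
    by (rule AE_I[of _ _ "- E"]) (use assms sp s in \<open>auto simp: prob_measures_on_def\<close>)
qed

lemma prob_measures_onI:
  assumes "prob_space \<mu>" "sets \<mu> = sets borel" "AE z in \<mu>. z \<in> E" "closed E"
  shows "\<mu> \<in> prob_measures_on E"
proof -
  have sp: "space \<mu> = UNIV" using sets_eq_imp_space_eq[OF assms(2)] by simp
  have "{z \<in> space \<mu>. \<not> z \<in> E} = - E" using sp by auto
  then have "emeasure \<mu> (- E) = 0"
    using AE_iff_measurable[of "- E" \<mu> "\<lambda>z. z \<in> E"] assms by auto
  then show ?thesis using assms by (auto simp: prob_measures_on_def)
qed

lemma integrable_continuous_prob_measures:
  assumes \<mu>: "\<mu> \<in> prob_measures_on E" and E: "compact E" and f: "continuous_on UNIV (f :: complex \<Rightarrow> real)"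
  shows "integrable \<mu> f"
proof -
  note m = prob_measures_onD[OF \<mu> compact_imp_closed[OF E]]
  interpret M: prob_space \<mu> by (rule m)
  have [measurable_cong]: "sets \<mu> = sets borel" by (rule m)
  have "compact (f ` E)" by (intro compact_continuous_image E continuous_on_subset[OF f]) auto
  then obtain C where C: "\<And>y. y \<in> f ` E \<Longrightarrow> norm y \<le> C"
    using compact_imp_bounded bounded_iff by metis
  have [measurable]: "f \<in> borel_measurable borel" by (rule borel_measurable_continuous_onI[OF f])
  show ?thesis
    using m(3) C by (intro M.integrable_const_bound[where B = C]) (auto elim!: eventually_mono)
qed

context
  fixes \<mu> \<nu> :: "complex measure" and E :: "complex set"
  assumes \<mu>: "\<mu> \<in> prob_measures_on E" and \<nu>: "\<nu> \<in> prob_measures_on E" and E: "compact E"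
begin

lemma AE_pair_prob_measures: "AE p in \<mu> \<Otimes>\<^sub>M \<nu>. fst p \<in> E \<and> snd p \<in> E"
proof -
  note m = prob_measures_onD[OF \<mu> compact_imp_closed[OF E]]
  note n = prob_measures_onD[OF \<nu> compact_imp_closed[OF E]]
  interpret M: prob_space \<mu> by (rule m)
  interpret N: prob_space \<nu> by (rule n)
  interpret pair_prob_space \<mu> \<nu> ..
  have [measurable_cong]: "sets \<mu> = sets borel" "sets \<nu> = sets borel" by (rule m, rule n)
  have [measurable]: "E \<in> sets borel" using E by (simp add: borel_compact)
  show ?thesis
  proof (rule AE_pair_measure)
    show "{p \<in> space (\<mu> \<Otimes>\<^sub>M \<nu>). fst p \<in> E \<and> snd p \<in> E} \<in> sets (\<mu> \<Otimes>\<^sub>M \<nu>)" by measurable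
    show "AE x in \<mu>. AE y in \<nu>. fst (x, y) \<in> E \<and> snd (x, y) \<in> E"
      using m(3) by eventually_elim (use n(3) in auto)
  qed
qed

lemma integrable_pair_continuous:
  assumes "continuous_on UNIV (\<lambda>p. k (fst p) (snd p) :: real)"
  shows "integrable (\<mu> \<Otimes>\<^sub>M \<nu>) (\<lambda>p. k (fst p) (snd p))"
proof -
  note m = prob_measures_onD[OF \<mu> compact_imp_closed[OF E]]
  note n = prob_measures_onD[OF \<nu> compact_imp_closed[OF E]]
  interpret M: prob_space \<mu> by (rule m)
  interpret N: prob_space \<nu> by (rule n)
  interpret pair_prob_space \<mu> \<nu> ..
  have [measurable_cong]: "sets \<mu> = sets borel" "sets \<nu> = sets borel" by (rule m, rule n)
  have "sets (\<mu> \<Otimes>\<^sub>M \<nu>) = sets (borel \<Otimes>\<^sub>M borel)" by (rule sets_pair_measure_cong) (rule m, rule n)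
  then have "sets (\<mu> \<Otimes>\<^sub>M \<nu>) = sets borel" unfolding borel_prod .
  then have meas: "(\<lambda>p. k (fst p) (snd p)) \<in> borel_measurable (\<mu> \<Otimes>\<^sub>M \<nu>)"
    using borel_measurable_continuous_onI[OF assms] measurable_cong_sets by blast
  have "compact ((\<lambda>p. k (fst p) (snd p)) ` (E \<times> E))"
    by (intro compact_continuous_image compact_Times E continuous_on_subset[OF assms]) auto
  then obtain C where "\<And>y. y \<in> (\<lambda>p. k (fst p) (snd p)) ` (E \<times> E) \<Longrightarrow> norm y \<le> C"
    using compact_imp_bounded bounded_iff by metis
  then have "norm (k (fst p) (snd p)) \<le> C" if "fst p \<in> E \<and> snd p \<in> E" for p
    using that by (cases p) force
  then show ?thesis
    using AE_pair_prob_measures by (intro P.integrable_const_bound[where B = C] meas) (auto elim: eventually_mono)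
qed

lemma double_integral_iterated:
  assumes "continuous_on UNIV (\<lambda>p. k (fst p) (snd p) :: real)"
  shows "double_integral k \<mu> \<nu> = (\<integral>z. (\<integral>w. k z w \<partial>\<nu>) \<partial>\<mu>)"
    and "double_integral k \<mu> \<nu> = (\<integral>w. (\<integral>z. k z w \<partial>\<mu>) \<partial>\<nu>)"
    and "integrable \<mu> (\<lambda>z. \<integral>w. k z w \<partial>\<nu>)" "integrable \<nu> (\<lambda>w. \<integral>z. k z w \<partial>\<mu>)"
proof -
  note m = prob_measures_onD[OF \<mu> compact_imp_closed[OF E]]
  note n = prob_measures_onD[OF \<nu> compact_imp_closed[OF E]]
  interpret M: prob_space \<mu> by (rule m)
  interpret N: prob_space \<nu> by (rule n)
  interpret pair_prob_space \<mu> \<nu> ..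
  have i: "integrable (\<mu> \<Otimes>\<^sub>M \<nu>) (\<lambda>(z, w). k z w)"
    using integrable_pair_continuous[OF assms] by (simp add: case_prod_unfold)
  show "double_integral k \<mu> \<nu> = (\<integral>z. (\<integral>w. k z w \<partial>\<nu>) \<partial>\<mu>)"
    using integral_fst[OF i] by (simp add: double_integral_def case_prod_unfold)
  show "double_integral k \<mu> \<nu> = (\<integral>w. (\<integral>z. k z w \<partial>\<mu>) \<partial>\<nu>)"
    using integral_snd[OF i] by (simp add: double_integral_def case_prod_unfold)
  show "integrable \<mu> (\<lambda>z. \<integral>w. k z w \<partial>\<nu>)" "integrable \<nu> (\<lambda>w. \<integral>z. k z w \<partial>\<mu>)"
    using integrable_fst[OF i] integrable_snd[OF i] by auto
qed

lemma double_integral_param: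
  fixes f :: "'s \<Rightarrow> complex \<Rightarrow> complex \<Rightarrow> real"
  assumes S: "sigma_finite_measure S"
    and meas: "(\<lambda>(p, s). f s (fst p) (snd p)) \<in> borel_measurable ((borel \<Otimes>\<^sub>M borel) \<Otimes>\<^sub>M S)"
    and bound: "\<And>s z w. s \<in> space S \<Longrightarrow> \<bar>f s z w\<bar> \<le> b s" and b: "integrable S b"
  shows "double_integral (\<lambda>z w. \<integral>s. f s z w \<partial>S) \<mu> \<nu> = (\<integral>s. double_integral (f s) \<mu> \<nu> \<partial>S)"
    and "integrable S (\<lambda>s. double_integral (f s) \<mu> \<nu>)"
proof -
  note m = prob_measures_onD[OF \<mu> compact_imp_closed[OF E]]
  note n = prob_measures_onD[OF \<nu> compact_imp_closed[OF E]]
  interpret M: prob_space \<mu> by (rule m)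
  interpret N: prob_space \<nu> by (rule n)
  interpret MN: pair_prob_space \<mu> \<nu> ..
  interpret S: sigma_finite_measure S by (rule S)
  interpret Q: pair_sigma_finite "\<mu> \<Otimes>\<^sub>M \<nu>" S ..
  have "sets (\<mu> \<Otimes>\<^sub>M \<nu>) = sets (borel \<Otimes>\<^sub>M borel)" by (rule sets_pair_measure_cong) (rule m, rule n)
  then have "sets ((\<mu> \<Otimes>\<^sub>M \<nu>) \<Otimes>\<^sub>M S) = sets ((borel \<Otimes>\<^sub>M borel) \<Otimes>\<^sub>M S)"
    by (rule sets_pair_measure_cong) simp
  then have meas': "(\<lambda>(p, s). f s (fst p) (snd p)) \<in> borel_measurable ((\<mu> \<Otimes>\<^sub>M \<nu>) \<Otimes>\<^sub>M S)"
    using meas measurable_cong_sets by blast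
  have [measurable]: "(\<lambda>s. f s (fst p) (snd p)) \<in> borel_measurable S" for p
    using measurable_compose[OF measurable_Pair1' meas, of p] by (simp add: space_pair_measure)
  have inner: "integrable S (\<lambda>s. f s (fst p) (snd p))" for p
    by (rule Bochner_Integration.integrable_bound[OF b]) (use bound in \<open>auto intro!: AE_I2 order_trans[OF _ abs_ge_self]\<close>)
  have meas2: "(\<lambda>p. \<integral>s. norm (f s (fst p) (snd p)) \<partial>S) \<in> borel_measurable (\<mu> \<Otimes>\<^sub>M \<nu>)"
    by (rule S.borel_measurable_lebesgue_integral) (use meas' in measurable)
  have "norm (\<integral>s. norm (f s (fst p) (snd p)) \<partial>S) \<le> (\<integral>s. b s \<partial>S)" for p
  proof -
    have "norm (\<integral>s. norm (f s (fst p) (snd p)) \<partial>S) = (\<integral>s. norm (f s (fst p) (snd p)) \<partial>S)" by simp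
    also have "\<dots> \<le> (\<integral>s. b s \<partial>S)"
      by (intro integral_mono integrable_norm inner b) (use bound in auto)
    finally show ?thesis .
  qed
  then have "integrable (\<mu> \<Otimes>\<^sub>M \<nu>) (\<lambda>p. \<integral>s. norm (f s (fst p) (snd p)) \<partial>S)"
    by (intro MN.P.integrable_const_bound[OF _ meas2] AE_I2)
  then have int: "integrable ((\<mu> \<Otimes>\<^sub>M \<nu>) \<Otimes>\<^sub>M S) (\<lambda>(p, s). f s (fst p) (snd p))"
    by (intro Q.Fubini_integrable meas') (auto intro!: inner)
  show "double_integral (\<lambda>z w. \<integral>s. f s z w \<partial>S) \<mu> \<nu> = (\<integral>s. double_integral (f s) \<mu> \<nu> \<partial>S)"
    unfolding double_integral_def using Q.Fubini_integral[OF int] by simp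
  show "integrable S (\<lambda>s. double_integral (f s) \<mu> \<nu>)"
    unfolding double_integral_def using Q.integrable_snd[OF int] by simp
qed

end

lemma double_integral_commute:
  assumes "\<mu> \<in> prob_measures_on E" "\<nu> \<in> prob_measures_on E" "compact E"
    and "continuous_on UNIV (\<lambda>p. k (fst p) (snd p) :: real)" and "\<And>z w. k z w = k w z"
  shows "double_integral k \<mu> \<nu> = double_integral k \<nu> \<mu>"
  using double_integral_iterated(1)[OF assms(1-4)] double_integral_iterated(2)[OF assms(2,1,3,4)] assms(5)
  by simp

text \<open>The quadratic form of a radial kernel at the signed measure \<open>\<mu> - \<nu>\<close>; the kernel is given as a
  function of the squared distance.\<close>

definition quad_form :: "(real \<Rightarrow> real) \<Rightarrow> complex measure \<Rightarrow> complex measure \<Rightarrow> real" where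
  "quad_form f \<mu> \<nu> = double_integral (\<lambda>z w. f ((cmod (z - w))\<^sup>2)) \<mu> \<mu>
     + double_integral (\<lambda>z w. f ((cmod (z - w))\<^sup>2)) \<nu> \<nu>
     - 2 * double_integral (\<lambda>z w. f ((cmod (z - w))\<^sup>2)) \<mu> \<nu>"

lemma continuous_radial:
  assumes "continuous_on {0..} (f :: real \<Rightarrow> real)"
  shows "continuous_on UNIV (\<lambda>p. f ((cmod (fst p - snd p))\<^sup>2))"
  by (rule continuous_on_compose2[OF assms]) (auto intro!: continuous_intros)

text \<open>Lets positivity pass through mixtures of kernels. It is applied twice: to the Laplace
  integral of Gaussians and to the integral of resolvent kernels.\<close>

lemma quad_form_param:
  fixes f :: "'s \<Rightarrow> real \<Rightarrow> real"
  assumes \<mu>: "\<mu> \<in> prob_measures_on E" and \<nu>: "\<nu> \<in> prob_measures_on E" and E: "compact E"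
    and S: "sigma_finite_measure S"
    and meas: "(\<lambda>(x, s). f s x) \<in> borel_measurable (borel \<Otimes>\<^sub>M S)"
    and bound: "\<And>s x. s \<in> space S \<Longrightarrow> 0 \<le> x \<Longrightarrow> \<bar>f s x\<bar> \<le> b s" and b: "integrable S b"
  shows "quad_form (\<lambda>x. \<integral>s. f s x \<partial>S) \<mu> \<nu> = (\<integral>s. quad_form (f s) \<mu> \<nu> \<partial>S)"
    and "integrable S (\<lambda>s. quad_form (f s) \<mu> \<nu>)"
proof -
  have meas': "(\<lambda>(p, s). f s ((cmod (fst p - snd p))\<^sup>2)) \<in> borel_measurable ((borel \<Otimes>\<^sub>M borel) \<Otimes>\<^sub>M S)"
    using measurable_compose[OF _ meas, of "\<lambda>(p, s). ((cmod (fst p - snd p))\<^sup>2, s)" "(borel \<Otimes>\<^sub>M borel) \<Otimes>\<^sub>M S"]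
    by (simp add: case_prod_beta)
  have bound': "\<bar>f s ((cmod (z - w))\<^sup>2)\<bar> \<le> b s" if "s \<in> space S" for s z w using bound that by simp
  note p = double_integral_param[OF _ _ E S meas' bound' b]
  show "quad_form (\<lambda>x. \<integral>s. f s x \<partial>S) \<mu> \<nu> = (\<integral>s. quad_form (f s) \<mu> \<nu> \<partial>S)"
    unfolding quad_form_def using p[OF \<mu> \<mu>] p[OF \<nu> \<nu>] p[OF \<mu> \<nu>] by simp
  show "integrable S (\<lambda>s. quad_form (f s) \<mu> \<nu>)"
    unfolding quad_form_def using p[OF \<mu> \<mu>] p[OF \<nu> \<nu>] p[OF \<mu> \<nu>] by simp
qed

lemma measure_eqI_continuous:
  fixes \<mu> \<nu> :: "complex measure"
  assumes "prob_space \<mu>" "prob_space \<nu>" "sets \<mu> = sets borel" "sets \<nu> = sets borel"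
    and eq: "\<And>f :: complex \<Rightarrow> real. continuous_on UNIV f \<Longrightarrow> bounded (range f) \<Longrightarrow> (\<integral>z. f z \<partial>\<mu>) = (\<integral>z. f z \<partial>\<nu>)"
  shows "\<mu> = \<nu>"
proof -
  interpret M: prob_space \<mu> by fact
  interpret N: prob_space \<nu> by fact
  note [measurable_cong] = assms(3,4)
  have sp: "space \<mu> = UNIV" "space \<nu> = UNIV"
    using sets_eq_imp_space_eq[OF assms(3)] sets_eq_imp_space_eq[OF assms(4)] by simp_all
  have closed_eq: "emeasure \<mu> C = emeasure \<nu> C" if C: "closed C" for C
  proof (cases "C = {}")
    case False
    \<comment> \<open>Continuous functions decreasing to the indicator of \<open>C\<close>;
      \<open>infdist\<close> to the empty set is 0 by convention, hence the case split.\<close>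
    define f where "f n z = max 0 (1 - real n * infdist z C)" for n z
    have cont: "continuous_on UNIV (f n)" for n unfolding f_def by (intro continuous_intros)
    have bd: "\<bar>f n z\<bar> \<le> 1" for n z using infdist_nonneg[of z C] by (auto simp: f_def)
    have [measurable]: "f n \<in> borel_measurable borel" for n
      by (rule borel_measurable_continuous_onI[OF cont])
    have [measurable]: "C \<in> sets borel" using C by simp
    have lim: "(\<lambda>n. f n z) \<longlonglongrightarrow> indicator C z" for z
    proof (cases "z \<in> C")
      case True
      then show ?thesis by (simp add: f_def)
    next
      case zC: False
      then have pos: "infdist z C > 0"
        using C False in_closed_iff_infdist_zero[OF C False] infdist_nonneg[of z C] by (auto simp: less_le)
      then obtain N :: nat where N: "1 < real N * infdist z C" using reals_Archimedean3 by blast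
      have "\<forall>\<^sub>F n in sequentially. f n z = 0"
        using eventually_ge_at_top[of N]
      proof eventually_elim
        case (elim n)
        then have "real N * infdist z C \<le> real n * infdist z C" using pos by simp
        then show ?case using N by (simp add: f_def)
      qed
      then show ?thesis using zC by (simp add: tendsto_eventually)
    qed
    have bdd: "bounded (range (f n))" for n
      unfolding bounded_iff using bd[of n] by (intro exI[of _ 1]) auto
    have l: "(\<lambda>n. \<integral>z. f n z \<partial>\<mu>) \<longlonglongrightarrow> (\<integral>z. indicator C z \<partial>\<mu>)"
      by (rule integral_dominated_convergence[where w = "\<lambda>_. 1"]) (use lim bd in auto)
    moreover have "(\<lambda>n. \<integral>z. f n z \<partial>\<nu>) \<longlonglongrightarrow> (\<integral>z. indicator C z \<partial>\<nu>)"
      by (rule integral_dominated_convergence[where w = "\<lambda>_. 1"]) (use lim bd in auto)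
    ultimately have "(\<integral>z. indicator C z \<partial>\<mu>) = ((\<integral>z. indicator C z \<partial>\<nu>) :: real)"
      using eq[OF cont bdd] by (simp add: LIMSEQ_unique)
    then have "measure \<mu> C = measure \<nu> C" using sp by simp
    then show ?thesis by (simp add: M.emeasure_eq_measure N.emeasure_eq_measure)
  qed simp
  have bo: "sets borel = sigma_sets UNIV (Collect closed :: complex set set)"
    unfolding borel_eq_closed by simp
  show ?thesis
    by (rule measure_eqI_generator_eq[where E = "Collect closed" and \<Omega> = UNIV and A = "\<lambda>_. UNIV"])
      (use closed_eq assms(3,4) bo in \<open>auto simp: Int_stable_def\<close>)
qed

section \<open>Gaussian kernels as sums over moments\<close>

text \<open>Expanding |z - w|^2 leaves the mixed factor exp (2 s q) with q = Re z Re w + Im z Im w.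
  Its power series, followed by the binomial formula for q^k, separates the variables, so that every
  term integrates to a product of weighted moments.\<close>

lemma sums_double_integral_gauss:
  fixes \<mu> \<nu> :: "complex measure"
  assumes \<mu>: "\<mu> \<in> prob_measures_on E" and \<nu>: "\<nu> \<in> prob_measures_on E" and E: "compact E" and s: "0 \<le> s"
  defines "m \<equiv> \<lambda>\<mu> i j. \<integral>z. exp (- s * (cmod z)\<^sup>2) * (Re z ^ i * Im z ^ j) \<partial>\<mu>"
  shows "(\<lambda>k. (2 * s) ^ k / fact k * (\<Sum>i\<le>k. real (k choose i) * (m \<mu> i (k - i) * m \<nu> i (k - i)))) sums
    double_integral (\<lambda>z w. exp (- s * (cmod (z - w))\<^sup>2)) \<mu> \<nu>"
proof -
  note mD = prob_measures_onD[OF \<mu> compact_imp_closed[OF E]]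
  note nD = prob_measures_onD[OF \<nu> compact_imp_closed[OF E]]
  interpret M: prob_space \<mu> by (rule mD)
  interpret N: prob_space \<nu> by (rule nD)
  interpret MN: pair_prob_space \<mu> \<nu> ..
  obtain R where R: "\<And>z. z \<in> E \<Longrightarrow> cmod z \<le> R" "0 \<le> R"
    using compact_imp_bounded[OF E] unfolding bounded_pos by (metis less_imp_le)
  define e where "e z = exp (- s * (cmod z)\<^sup>2)" for z :: complex
  define q where "q z w = Re z * Re w + Im z * Im w" for z w
  define t where "t k z w = (2 * s) ^ k / fact k * (e z * e w * q z w ^ k)" for k z w
  have e1: "0 \<le> e z" "e z \<le> 1" for z using s by (auto simp: e_def)
  have expand: "exp (- s * (cmod (z - w))\<^sup>2) = e z * e w * exp (2 * s * q z w)" for z w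
    unfolding e_def q_def exp_add[symmetric] cmod_power2
    by (simp add: power2_eq_square algebra_simps)
  have t_sums: "(\<lambda>k. t k z w) sums exp (- s * (cmod (z - w))\<^sup>2)" for z w
  proof -
    have "(\<lambda>k. (2 * s * q z w) ^ k /\<^sub>R fact k) sums exp (2 * s * q z w)" by (rule exp_converges)
    from sums_mult[OF this, of "e z * e w"] show ?thesis
      unfolding expand t_def by (simp add: power_mult_distrib field_simps)
  qed
  have cont: "continuous_on UNIV (\<lambda>p. t k (fst p) (snd p))" for k
    unfolding t_def e_def q_def by (intro continuous_intros) auto
  have int: "integrable (\<mu> \<Otimes>\<^sub>M \<nu>) (\<lambda>p. t k (fst p) (snd p))" for k
    by (rule integrable_pair_continuous[OF \<mu> \<nu> E cont])
  define B where "B k = (2 * s) ^ k / fact k * (2 * R\<^sup>2) ^ k" for k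
  have bound: "\<bar>t k z w\<bar> \<le> B k" if "z \<in> E" "w \<in> E" for k z w
  proof -
    have "\<bar>Re z * Re w\<bar> \<le> R * R" "\<bar>Im z * Im w\<bar> \<le> R * R"
      using R(1)[OF that(1)] R(1)[OF that(2)] abs_Re_le_cmod[of z] abs_Re_le_cmod[of w]
        abs_Im_le_cmod[of z] abs_Im_le_cmod[of w]
      by (auto simp: abs_mult intro!: mult_mono)
    then have "\<bar>q z w\<bar> \<le> 2 * R\<^sup>2" unfolding q_def power2_eq_square by linarith
    then have q: "\<bar>q z w\<bar> ^ k \<le> (2 * R\<^sup>2) ^ k" by (intro power_mono) auto
    have "e z * e w * \<bar>q z w\<bar> ^ k \<le> 1 * 1 * (2 * R\<^sup>2) ^ k"
      by (intro mult_mono q) (use e1 in auto)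
    then have "(2 * s) ^ k / fact k * (e z * e w * \<bar>q z w\<bar> ^ k) \<le> (2 * s) ^ k / fact k * (2 * R\<^sup>2) ^ k"
      using s by (intro mult_left_mono) auto
    then show ?thesis using s e1 unfolding t_def B_def
      by (simp add: abs_mult power_abs)
  qed
  have "B = (\<lambda>k. ((2 * s) * (2 * R\<^sup>2)) ^ k /\<^sub>R fact k)"
    unfolding B_def power_mult_distrib[of "2 * s"] by (simp add: fun_eq_iff divide_inverse)
  then have sB: "summable B" using summable_exp_generic by metis
  have AEb: "AE p in \<mu> \<Otimes>\<^sub>M \<nu>. \<forall>k. norm (t k (fst p) (snd p)) \<le> B k"
    using AE_pair_prob_measures[OF \<mu> \<nu> E] by eventually_elim (use bound in auto)
  have "(\<lambda>k. \<integral>p. t k (fst p) (snd p) \<partial>(\<mu> \<Otimes>\<^sub>M \<nu>)) sums (\<integral>p. (\<Sum>k. t k (fst p) (snd p)) \<partial>(\<mu> \<Otimes>\<^sub>M \<nu>))"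
  proof (rule sums_integral[OF int])
    show "AE p in \<mu> \<Otimes>\<^sub>M \<nu>. summable (\<lambda>k. norm (t k (fst p) (snd p)))"
      using AEb by eventually_elim (auto intro!: summable_comparison_test'[OF sB])
    have "norm (\<integral>p. norm (t k (fst p) (snd p)) \<partial>(\<mu> \<Otimes>\<^sub>M \<nu>)) \<le> B k" for k
    proof -
      have "(\<integral>p. norm (t k (fst p) (snd p)) \<partial>(\<mu> \<Otimes>\<^sub>M \<nu>)) \<le> (\<integral>p. B k \<partial>(\<mu> \<Otimes>\<^sub>M \<nu>))"
        by (intro integral_mono_AE integrable_norm int) (use AEb in \<open>auto elim: eventually_mono\<close>)
      then show ?thesis by (simp add: MN.P.prob_space)
    qed
    then show "summable (\<lambda>k. \<integral>p. norm (t k (fst p) (snd p)) \<partial>(\<mu> \<Otimes>\<^sub>M \<nu>))"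
      by (intro summable_comparison_test'[OF sB])
  qed
  also have "(\<integral>p. (\<Sum>k. t k (fst p) (snd p)) \<partial>(\<mu> \<Otimes>\<^sub>M \<nu>)) = double_integral (\<lambda>z w. exp (- s * (cmod (z - w))\<^sup>2)) \<mu> \<nu>"
    unfolding double_integral_def using sums_unique[OF t_sums] by simp
  also have "(\<lambda>k. \<integral>p. t k (fst p) (snd p) \<partial>(\<mu> \<Otimes>\<^sub>M \<nu>)) =
    (\<lambda>k. (2 * s) ^ k / fact k * (\<Sum>i\<le>k. real (k choose i) * (m \<mu> i (k - i) * m \<nu> i (k - i))))"
  proof
    fix k
    define h where "h i z = e z * (Re z ^ i * Im z ^ (k - i))" for i z
    have ch: "continuous_on UNIV (\<lambda>p. h i (fst p) * h i (snd p))" for i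
      unfolding h_def e_def by (intro continuous_intros)
    have t_eq: "t k z w = (2 * s) ^ k / fact k * (\<Sum>i\<le>k. real (k choose i) * (h i z * h i w))" for z w
      unfolding t_def q_def h_def binomial_ring[of "Re z * Re w"]
      by (simp add: sum_distrib_left power_mult_distrib mult_ac)
    have prod: "(\<integral>p. h i (fst p) * h i (snd p) \<partial>(\<mu> \<Otimes>\<^sub>M \<nu>)) = m \<mu> i (k - i) * m \<nu> i (k - i)" for i
      using double_integral_iterated(1)[OF \<mu> \<nu> E, of "\<lambda>z w. h i z * h i w", OF ch]
      unfolding double_integral_def m_def h_def e_def by simp
    have ih: "integrable (\<mu> \<Otimes>\<^sub>M \<nu>) (\<lambda>p. h i (fst p) * h i (snd p))" for i
      using integrable_pair_continuous[OF \<mu> \<nu> E, of "\<lambda>z w. h i z * h i w", OF ch] .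
    show "(\<integral>p. t k (fst p) (snd p) \<partial>(\<mu> \<Otimes>\<^sub>M \<nu>)) =
       (2 * s) ^ k / fact k * (\<Sum>i\<le>k. real (k choose i) * (m \<mu> i (k - i) * m \<nu> i (k - i)))"
      unfolding t_eq using ih by (simp add: prod)
  qed
  finally show ?thesis .
qed

text \<open>The three double integrals have the same nonnegative coefficients, so their combination
  completes the square in each pair of moments.\<close>

lemma sums_quad_form_gauss:
  fixes \<mu> \<nu> :: "complex measure"
  assumes \<mu>: "\<mu> \<in> prob_measures_on E" and \<nu>: "\<nu> \<in> prob_measures_on E" and E: "compact E" and s: "0 \<le> s"
  defines "m \<equiv> \<lambda>\<mu> i j. \<integral>z. exp (- s * (cmod z)\<^sup>2) * (Re z ^ i * Im z ^ j) \<partial>\<mu>"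
  shows "(\<lambda>k. (2 * s) ^ k / fact k * (\<Sum>i\<le>k. real (k choose i) * (m \<mu> i (k - i) - m \<nu> i (k - i))\<^sup>2)) sums
    quad_form (\<lambda>x. exp (- s * x)) \<mu> \<nu>"
proof -
  have "(\<lambda>k. (2 * s) ^ k / fact k * (\<Sum>i\<le>k. real (k choose i) * (m \<mu> i (k - i) * m \<mu> i (k - i)))
     + (2 * s) ^ k / fact k * (\<Sum>i\<le>k. real (k choose i) * (m \<nu> i (k - i) * m \<nu> i (k - i)))
     - 2 * ((2 * s) ^ k / fact k * (\<Sum>i\<le>k. real (k choose i) * (m \<mu> i (k - i) * m \<nu> i (k - i))))) sums
    quad_form (\<lambda>x. exp (- s * x)) \<mu> \<nu>"
    unfolding quad_form_def m_def
    by (intro sums_diff sums_add sums_mult sums_double_integral_gauss[OF _ _ E s] \<mu> \<nu>)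
  also have "(\<lambda>k. (2 * s) ^ k / fact k * (\<Sum>i\<le>k. real (k choose i) * (m \<mu> i (k - i) * m \<mu> i (k - i)))
     + (2 * s) ^ k / fact k * (\<Sum>i\<le>k. real (k choose i) * (m \<nu> i (k - i) * m \<nu> i (k - i)))
     - 2 * ((2 * s) ^ k / fact k * (\<Sum>i\<le>k. real (k choose i) * (m \<mu> i (k - i) * m \<nu> i (k - i)))))
    = (\<lambda>k. (2 * s) ^ k / fact k * (\<Sum>i\<le>k. real (k choose i) * (m \<mu> i (k - i) - m \<nu> i (k - i))\<^sup>2))" (is "?lhs = ?rhs")
  proof
    fix k
    have "(\<Sum>i\<le>k. real (k choose i) * (m \<mu> i (k - i) - m \<nu> i (k - i))\<^sup>2) =
      (\<Sum>i\<le>k. real (k choose i) * (m \<mu> i (k - i) * m \<mu> i (k - i)))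
      + (\<Sum>i\<le>k. real (k choose i) * (m \<nu> i (k - i) * m \<nu> i (k - i)))
      - 2 * (\<Sum>i\<le>k. real (k choose i) * (m \<mu> i (k - i) * m \<nu> i (k - i)))"
      unfolding sum_distrib_left sum.distrib[symmetric] sum_subtractf[symmetric]
      by (rule sum.cong) (simp_all add: power2_eq_square algebra_simps)
    then show "?lhs k = ?rhs k" by (simp only: distrib_left right_diff_distrib mult_ac)
  qed
  finally show ?thesis .
qed

lemma quad_form_gauss_nonneg:
  assumes "\<mu> \<in> prob_measures_on E" "\<nu> \<in> prob_measures_on E" "compact E" "0 \<le> s"
  shows "0 \<le> quad_form (\<lambda>x. exp (- s * x)) \<mu> \<nu>"
proof -
  have nonneg: "0 \<le> (2 * s) ^ k / fact k * (\<Sum>i\<le>k. real (k choose i) * (x i k)\<^sup>2)" for x k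
    using assms(4) by (intro mult_nonneg_nonneg sum_nonneg) auto
  show ?thesis
    by (rule sums_le[OF _ sums_zero sums_quad_form_gauss[OF assms]]) (rule nonneg)
qed

text \<open>On compact \<open>E\<close> the Gaussian weight is bounded away from 0, so
  Stone--Weierstrass may be applied to a test function divided by the weight.\<close>

lemma prob_measures_eqI_moments:
  fixes \<mu> \<nu> :: "complex measure"
  assumes \<mu>: "\<mu> \<in> prob_measures_on E" and \<nu>: "\<nu> \<in> prob_measures_on E" and E: "compact E" and s: "0 \<le> s"
    and mom: "\<And>i j. (\<integral>z. exp (- s * (cmod z)\<^sup>2) * (Re z ^ i * Im z ^ j) \<partial>\<mu>)
      = (\<integral>z. exp (- s * (cmod z)\<^sup>2) * (Re z ^ i * Im z ^ j) \<partial>\<nu>)"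
  shows "\<mu> = \<nu>"
proof -
  note mD = prob_measures_onD[OF \<mu> compact_imp_closed[OF E]]
  note nD = prob_measures_onD[OF \<nu> compact_imp_closed[OF E]]
  interpret M: prob_space \<mu> by (rule mD)
  interpret N: prob_space \<nu> by (rule nD)
  define e where "e z = exp (- s * (cmod z)\<^sup>2)" for z :: complex
  have ce: "continuous_on UNIV e" unfolding e_def by (intro continuous_intros)
  have e01: "0 < e z" "e z \<le> 1" for z using s by (auto simp: e_def)
  define D where "D f = (\<integral>z. e z * f z \<partial>\<mu>) - (\<integral>z. e z * f z \<partial>\<nu>)" for f
  note iM = integrable_continuous_prob_measures[OF \<mu> E]
  note iN = integrable_continuous_prob_measures[OF \<nu> E]
  have D_add: "D (\<lambda>z. f z + g z) = D f + D g" if "continuous_on UNIV f" "continuous_on UNIV g" for f g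
    unfolding D_def using that ce
    by (simp add: distrib_left iM iN continuous_on_mult)
  have D_cmult: "D (\<lambda>z. c * f z) = c * D f" for f c
  proof -
    have "e z * (c * f z) = c * (e z * f z)" for z by simp
    then show ?thesis unfolding D_def by (simp only: integral_mult_right_zero right_diff_distrib)
  qed
  define Z where "Z f \<longleftrightarrow> continuous_on UNIV f \<and> (\<forall>i j. D (\<lambda>z. f z * (Re z ^ i * Im z ^ j)) = 0)" for f
  text \<open>Polynomials act by multiplication on the functions annihilated together with all their
    monomial multiples; this avoids expanding polynomials into monomials.\<close>
  have step: "\<forall>f. Z f \<longrightarrow> Z (\<lambda>z. f z * p z)" if "real_polynomial_function p" for p
    using that
  proof (induction p rule: real_polynomial_function.induct)
    case (linear h)
    show ?case
    proof (intro allI impI)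
      fix f assume f: "Z f"
      then have cf: "continuous_on UNIV f" by (simp add: Z_def)
      have hz: "h z = Re z * h 1 + Im z * h \<i>" for z
      proof -
        have "h z = h (Re z *\<^sub>R 1 + Im z *\<^sub>R \<i>)"
          by (rule arg_cong[of _ _ h]) (simp add: complex_eq_iff)
        also have "\<dots> = Re z * h 1 + Im z * h \<i>"
          using linear by (simp add: bounded_linear.linear linear_add linear_scale)
        finally show ?thesis .
      qed
      have "D (\<lambda>z. f z * h z * (Re z ^ i * Im z ^ j)) = 0" for i j
      proof -
        have "(\<lambda>z. f z * h z * (Re z ^ i * Im z ^ j)) =
          (\<lambda>z. h 1 * (f z * (Re z ^ Suc i * Im z ^ j)) + h \<i> * (f z * (Re z ^ i * Im z ^ Suc j)))"
          by (rule ext, subst hz) (simp add: algebra_simps)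
        then have "D (\<lambda>z. f z * h z * (Re z ^ i * Im z ^ j)) =
          D (\<lambda>z. h 1 * (f z * (Re z ^ Suc i * Im z ^ j)) + h \<i> * (f z * (Re z ^ i * Im z ^ Suc j)))"
          by (rule arg_cong)
        also have "\<dots> = h 1 * D (\<lambda>z. f z * (Re z ^ Suc i * Im z ^ j)) + h \<i> * D (\<lambda>z. f z * (Re z ^ i * Im z ^ Suc j))"
          unfolding D_cmult[symmetric] by (rule D_add) (intro continuous_intros cf)+
        also have "\<dots> = 0" using f unfolding Z_def by (simp del: power_Suc)
        finally show ?thesis .
      qed
      moreover have "continuous_on UNIV (\<lambda>z. f z * h z)"
        by (intro continuous_on_mult cf linear_continuous_on linear)
      ultimately show "Z (\<lambda>z. f z * h z)" unfolding Z_def by blast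
    qed
  next
    case (const c)
    show ?case
    proof (intro allI impI)
      fix f assume f: "Z f"
      have "D (\<lambda>z. f z * c * (Re z ^ i * Im z ^ j)) = c * D (\<lambda>z. f z * (Re z ^ i * Im z ^ j))" for i j
        unfolding D_cmult[symmetric] by (rule arg_cong[of _ _ D]) (simp add: fun_eq_iff)
      then show "Z (\<lambda>z. f z * c)" using f unfolding Z_def by (auto intro!: continuous_intros)
    qed
  next
    case (add p q)
    show ?case
    proof (intro allI impI)
      fix f assume f: "Z f"
      have p: "Z (\<lambda>z. f z * p z)" and q: "Z (\<lambda>z. f z * q z)" using add f by auto
      have "D (\<lambda>z. f z * p z * (Re z ^ i * Im z ^ j) + f z * q z * (Re z ^ i * Im z ^ j)) = 0" for i j
        using p q unfolding Z_def by (subst D_add) (auto intro!: continuous_intros)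
      then show "Z (\<lambda>z. f z * (p z + q z))"
        using p q unfolding Z_def by (auto simp: distrib_left distrib_right intro!: continuous_intros)
    qed
  next
    case (mult p q)
    show ?case
    proof (intro allI impI)
      fix f assume "Z f"
      then have "Z (\<lambda>z. f z * p z * q z)" using mult.IH by blast
      then show "Z (\<lambda>z. f z * (p z * q z))" by (simp only: mult.assoc)
    qed
  qed
  have Z1: "Z (\<lambda>z. 1)" using mom unfolding Z_def D_def e_def by simp
  have Dp: "D p = 0" if "real_polynomial_function p" for p
  proof -
    have "Z (\<lambda>z. 1 * p z)" using step[OF that] Z1 by blast
    then have "D (\<lambda>z. 1 * p z * (Re z ^ 0 * Im z ^ 0)) = 0" unfolding Z_def by blast
    then show ?thesis by simp
  qed
  show ?thesis
  proof (rule measure_eqI_continuous)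
    fix f :: "complex \<Rightarrow> real" assume f: "continuous_on UNIV f"
    have "\<bar>(\<integral>z. f z \<partial>\<mu>) - (\<integral>z. f z \<partial>\<nu>)\<bar> \<le> \<epsilon>" if "\<epsilon> > 0" for \<epsilon>
    proof -
      \<comment> \<open>The polynomial \<open>p\<close> approximates \<open>f / e\<close>;
        multiplying back by \<open>e \<le> 1\<close> does not enlarge the error, and
        \<open>D p = 0\<close> compares the two measures.\<close>
      have "continuous_on E (\<lambda>z. f z / e z)"
        using f ce e01 by (intro continuous_intros) (auto elim: continuous_on_subset simp: less_imp_neq[symmetric])
      then obtain p where p: "real_polynomial_function p" "\<And>z. z \<in> E \<Longrightarrow> \<bar>f z / e z - p z\<bar> < \<epsilon> / 2"
        using Stone_Weierstrass_real_polynomial_function[OF E, of "\<lambda>z. f z / e z" "\<epsilon> / 2"] \<open>\<epsilon> > 0\<close> by auto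
      have cp: "continuous_on UNIV p"
        using p(1) by (simp add: continuous_on_polymonial_function real_polynomial_function_eq)
      have near: "\<bar>f z - e z * p z\<bar> \<le> \<epsilon> / 2" if "z \<in> E" for z
      proof -
        have "f z - e z * p z = e z * (f z / e z - p z)" using e01(1)[of z] by (simp add: field_simps)
        then have "\<bar>f z - e z * p z\<bar> = e z * \<bar>f z / e z - p z\<bar>" using e01(1)[of z] by (simp add: abs_mult)
        also have "\<dots> \<le> 1 * (\<epsilon> / 2)" using p(2)[OF that] e01[of z] by (intro mult_mono) auto
        finally show ?thesis by simp
      qed
      have cd: "continuous_on UNIV (\<lambda>z. f z - e z * p z)" using f cp ce by (intro continuous_intros)
      have dist: "\<bar>(\<integral>z. f z \<partial>\<kappa>) - (\<integral>z. e z * p z \<partial>\<kappa>)\<bar> \<le> \<epsilon> / 2" if \<kappa>: "\<kappa> \<in> prob_measures_on E" for \<kappa>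
      proof -
        note kD = prob_measures_onD[OF \<kappa> compact_imp_closed[OF E]]
        interpret K: prob_space \<kappa> by (rule kD)
        note iK = integrable_continuous_prob_measures[OF \<kappa> E]
        have "(\<integral>z. f z \<partial>\<kappa>) - (\<integral>z. e z * p z \<partial>\<kappa>) = (\<integral>z. f z - e z * p z \<partial>\<kappa>)"
          using f cp ce by (subst Bochner_Integration.integral_diff) (auto intro!: iK continuous_on_mult)
        also have "\<bar>\<dots>\<bar> \<le> (\<integral>z. \<bar>f z - e z * p z\<bar> \<partial>\<kappa>)" by (rule integral_abs_bound)
        also have "\<dots> \<le> (\<integral>z. \<epsilon> / 2 \<partial>\<kappa>)"
          using kD(3) near by (intro integral_mono_AE integrable_abs iK cd) (auto elim: eventually_mono)
        finally show ?thesis by (simp add: K.prob_space)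
      qed
      show ?thesis using dist[OF \<mu>] dist[OF \<nu>] Dp[OF p(1)] unfolding D_def by linarith
    qed
    then have "\<bar>(\<integral>z. f z \<partial>\<mu>) - (\<integral>z. f z \<partial>\<nu>)\<bar> \<le> 0" by (rule field_le_epsilon) simp
    then show "(\<integral>z. f z \<partial>\<mu>) = (\<integral>z. f z \<partial>\<nu>)" by simp
  qed (use mD nD in auto)
qed

text \<open>Every square in the series vanishes, and the term with index \<open>i + j\<close>
  contains the difference of the moments with exponents \<open>i\<close> and
  \<open>j\<close>.\<close>

lemma quad_form_gauss_eq_0_imp_eq:
  assumes \<mu>: "\<mu> \<in> prob_measures_on E" and \<nu>: "\<nu> \<in> prob_measures_on E" and E: "compact E" and s: "0 < s"
    and zero: "quad_form (\<lambda>x. exp (- s * x)) \<mu> \<nu> = 0"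
  shows "\<mu> = \<nu>"
proof (rule prob_measures_eqI_moments[OF \<mu> \<nu> E less_imp_le[OF s]])
  fix i j
  define m where "m = (\<lambda>\<mu> i j. \<integral>z. exp (- s * (cmod z)\<^sup>2) * (Re z ^ i * Im z ^ j) \<partial>\<mu>)"
  define a where "a k = (2 * s) ^ k / fact k * (\<Sum>i\<le>k. real (k choose i) * (m \<mu> i (k - i) - m \<nu> i (k - i))\<^sup>2)" for k
  have "a sums 0"
    using sums_quad_form_gauss[OF \<mu> \<nu> E less_imp_le[OF s]] zero unfolding a_def m_def by simp
  moreover have "0 \<le> a k" for k
    unfolding a_def using s by (intro mult_nonneg_nonneg sum_nonneg) auto
  ultimately have "a (i + j) = 0"
    using suminf_eq_zero_iff[of a] sums_summable[of a 0] sums_unique[of a 0] by simp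
  then have "(\<Sum>l\<le>i + j. real ((i + j) choose l) * (m \<mu> l (i + j - l) - m \<nu> l (i + j - l))\<^sup>2) = 0"
    using s unfolding a_def by simp
  then have "\<forall>l\<in>{..i + j}. real ((i + j) choose l) * (m \<mu> l (i + j - l) - m \<nu> l (i + j - l))\<^sup>2 = 0"
    by (subst (asm) sum_nonneg_eq_0_iff) auto
  then have "real ((i + j) choose i) * (m \<mu> i (i + j - i) - m \<nu> i (i + j - i))\<^sup>2 = 0"
    by (rule bspec) simp
  then have "m \<mu> i j = m \<nu> i j" by simp
  then show "(\<integral>z. exp (- s * (cmod z)\<^sup>2) * (Re z ^ i * Im z ^ j) \<partial>\<mu>)
      = (\<integral>z. exp (- s * (cmod z)\<^sup>2) * (Re z ^ i * Im z ^ j) \<partial>\<nu>)" by (simp add: m_def)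
qed

lemma quad_form_cong:
  assumes "\<And>x. 0 \<le> x \<Longrightarrow> f x = g x"
  shows "quad_form f \<mu> \<nu> = quad_form g \<mu> \<nu>"
  unfolding quad_form_def using assms by simp

lemma quad_form_cmult: "quad_form (\<lambda>x. c * f x) \<mu> \<nu> = c * quad_form f \<mu> \<nu>"
  unfolding quad_form_def double_integral_def by (simp add: algebra_simps)

lemma quad_form_diff:
  assumes "\<mu> \<in> prob_measures_on E" "\<nu> \<in> prob_measures_on E" "compact E"
    and "continuous_on {0..} f" "continuous_on {0..} g"
  shows "quad_form (\<lambda>x. f x - g x) \<mu> \<nu> = quad_form f \<mu> \<nu> - quad_form g \<mu> \<nu>"
proof -
  have i: "integrable (\<mu>' \<Otimes>\<^sub>M \<nu>') (\<lambda>p. h ((cmod (fst p - snd p))\<^sup>2))"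
    if "\<mu>' \<in> {\<mu>, \<nu>}" "\<nu>' \<in> {\<mu>, \<nu>}" "h \<in> {f, g}" for \<mu>' \<nu>' h
    using that assms
    by (intro integrable_pair_continuous[of \<mu>' E \<nu>' "\<lambda>z w. h ((cmod (z - w))\<^sup>2)"] continuous_radial) auto
  show ?thesis unfolding quad_form_def double_integral_def
    by (simp add: i)
qed

lemma quad_form_const:
  assumes "\<mu> \<in> prob_measures_on E" "\<nu> \<in> prob_measures_on E" "compact E"
  shows "quad_form (\<lambda>x. c) \<mu> \<nu> = 0"
proof -
  interpret M: prob_space \<mu> using assms by (simp add: prob_measures_on_def)
  interpret N: prob_space \<nu> using assms by (simp add: prob_measures_on_def)
  interpret MN: pair_prob_space \<mu> \<nu> ..
  interpret MM: pair_prob_space \<mu> \<mu> ..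
  interpret NN: pair_prob_space \<nu> \<nu> ..
  show ?thesis unfolding quad_form_def double_integral_def
    by (simp add: MN.P.prob_space MM.P.prob_space NN.P.prob_space)
qed

section \<open>From Gaussian to resolvent and logarithmic kernels\<close>

lemma has_bochner_integral_exp_Ici:
  assumes "0 < (c :: real)"
  shows "has_bochner_integral lborel (\<lambda>s. indicator {0..} s * exp (- s * c)) (1 / c)"
proof (rule has_bochner_integral_nn_integral)
  have "(\<integral>\<^sup>+s. ennreal (exp (- s * c)) * indicator {0..} s \<partial>lborel) = ennreal (0 - (- exp (- 0 * c) / c))"
  proof (rule nn_integral_FTC_atLeast)
    show "DERIV (\<lambda>s. - exp (- s * c) / c) s :> exp (- s * c)" for s
      using assms by (auto intro!: derivative_eq_intros)
    have "filterlim (\<lambda>s. s * c) at_top at_top"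
      using assms by (intro filterlim_at_top_mult_tendsto_pos[OF tendsto_const] filterlim_ident) auto
    then have "((\<lambda>s. exp (- (s * c))) \<longlongrightarrow> 0) at_top"
      by (intro filterlim_compose[OF exp_at_bot] filterlim_uminus_at_bot_at_top[THEN filterlim_compose])
    from tendsto_divide[OF tendsto_minus[OF this] tendsto_const, of c]
    show "((\<lambda>s. - exp (- s * c) / c) \<longlongrightarrow> 0) at_top" using assms by simp
  qed auto
  moreover have "ennreal (indicator {0..} s * exp (- s * c)) = ennreal (exp (- s * c)) * indicator {0..} s" for s
    by (simp split: split_indicator)
  ultimately show "(\<integral>\<^sup>+s. ennreal (indicator {0..} s * exp (- s * c)) \<partial>lborel) = ennreal (1 / c)" by simp
qed (use assms in auto)

lemma AE_lborel_obtain: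
  assumes "AE s in lborel. P s" "(a::real) < b"
  obtains s where "s \<in> {a..b}" "P s"
proof (rule ccontr)
  assume "\<not> thesis"
  then have "AE s in lborel. s \<notin> {a..b}" using assms(1) that by (auto elim!: eventually_mono)
  then have "emeasure lborel {a..b} = 0"
    by (subst (asm) AE_iff_measurable[of "{a..b}"]) auto
  then show False using assms(2) by simp
qed

context
  fixes \<mu> \<nu> :: "complex measure" and E :: "complex set"
  assumes \<mu>: "\<mu> \<in> prob_measures_on E" and \<nu>: "\<nu> \<in> prob_measures_on E" and E: "compact E"
begin

text \<open>1 / (x + u) is the integral of exp (- s (x + u)) over s \<ge> 0, a mixture of Gaussians
  with positive weights. If the mixed form vanishes, so does the Gaussian form for some positive
  \<open>s\<close>, and that one already identifies the measures.\<close>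

lemma quad_form_resolvent:
  assumes u: "0 < u"
  shows "0 \<le> quad_form (\<lambda>x. 1 / (x + u)) \<mu> \<nu>"
    and "quad_form (\<lambda>x. 1 / (x + u)) \<mu> \<nu> = 0 \<Longrightarrow> \<mu> = \<nu>"
proof -
  define f where "f s x = indicator {0..} s * exp (- s * u) * exp (- s * x)" for s x :: real
  define q where "q s = indicator {0..} s * exp (- s * u) * quad_form (\<lambda>x. exp (- s * x)) \<mu> \<nu>" for s :: real
  have int_f: "(\<integral>s. f s x \<partial>lborel) = 1 / (x + u)" if "0 \<le> x" for x
  proof -
    have "f s x = indicator {0..} s * exp (- s * (x + u))" for s
      by (simp add: f_def exp_add[symmetric] algebra_simps)
    then show ?thesis
      using has_bochner_integral_integral_eq[OF has_bochner_integral_exp_Ici, of "x + u"] u that by simp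
  qed
  have meas: "(\<lambda>(x, s). f s x) \<in> borel_measurable (borel \<Otimes>\<^sub>M lborel)"
    unfolding f_def by measurable
  have bound: "\<bar>f s x\<bar> \<le> indicator {0..} s * exp (- s * u)" if "0 \<le> x" for s x
    using that by (auto simp: f_def split: split_indicator)
  have b: "integrable lborel (\<lambda>s. indicator {0..} s * exp (- s * u))"
    using has_bochner_integral_exp_Ici[OF u] by (simp add: has_bochner_integral_iff)
  have qf: "quad_form (f s) \<mu> \<nu> = q s" for s
    unfolding f_def q_def by (rule quad_form_cmult)
  note par = quad_form_param[OF \<mu> \<nu> E lborel.sigma_finite_measure_axioms meas bound b, unfolded qf]
  have eq: "quad_form (\<lambda>x. 1 / (x + u)) \<mu> \<nu> = (\<integral>s. q s \<partial>lborel)"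
    using par(1) quad_form_cong[of "\<lambda>x. \<integral>s. f s x \<partial>lborel" "\<lambda>x. 1 / (x + u)"] int_f by simp
  have q0: "0 \<le> q s" for s
    unfolding q_def using quad_form_gauss_nonneg[OF \<mu> \<nu> E] by (auto split: split_indicator)
  show "0 \<le> quad_form (\<lambda>x. 1 / (x + u)) \<mu> \<nu>" unfolding eq using q0 by simp
  assume "quad_form (\<lambda>x. 1 / (x + u)) \<mu> \<nu> = 0"
  then have "AE s in lborel. q s = 0"
    using eq integral_nonneg_eq_0_iff_AE[OF par(2)] q0 by simp
  then obtain s where "s \<in> {1..2}" "q s = 0" by (rule AE_lborel_obtain[of _ 1 2]) auto
  then show "\<mu> = \<nu>"
    using quad_form_gauss_eq_0_imp_eq[OF \<mu> \<nu> E, of s] by (simp add: q_def)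
qed

text \<open>The bound \<open>c\<close> does not depend on \<open>d\<close>, so it remains usable as
  \<open>d\<close> tends to 0, where the form itself could turn into a difference of infinities. It
  comes from ln (x + D) - ln (x + d) being the integral of 1 / (x + u) over [d, D].\<close>

lemma quad_form_log_lower_bound:
  obtains c where "0 \<le> c" "c = 0 \<Longrightarrow> \<mu> = \<nu>"
    "\<And>d. 0 < d \<Longrightarrow> d \<le> 1 \<Longrightarrow> c \<le> quad_form (\<lambda>x. - ln (x + d) / 2) \<mu> \<nu>"
proof -
  define Q where "Q u = quad_form (\<lambda>x. 1 / (x + u)) \<mu> \<nu>" for u
  have Q0: "0 \<le> Q u" if "0 < u" for u unfolding Q_def using quad_form_resolvent(1)[OF that] .
  have main: "quad_form (\<lambda>x. ln (x + D) - ln (x + d)) \<mu> \<nu> = (\<integral>u. indicator {d..D} u * Q u \<partial>lborel)"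
    "integrable lborel (\<lambda>u. indicator {d..D} u * Q u)" if d: "0 < d" "d \<le> D" for d D
  proof -
    define f where "f u x = indicator {d..D} u * (1 / (x + u))" for u x :: real
    have int_f: "(\<integral>u. f u x \<partial>lborel) = ln (x + D) - ln (x + d)" if "0 \<le> x" for x
    proof -
      have "(\<integral>u. (1 / (x + u)) * indicator {d..D} u \<partial>lborel) = ln (x + D) - ln (x + d)"
        using d that by (intro integral_FTC_Icc_real) (auto intro!: derivative_eq_intros continuous_intros)
      then show ?thesis unfolding f_def by (simp add: mult.commute)
    qed
    have meas: "(\<lambda>(x, u). f u x) \<in> borel_measurable (borel \<Otimes>\<^sub>M lborel)"
      unfolding f_def by measurable
    have bound: "\<bar>f u x\<bar> \<le> indicator {d..D} u * (1 / d)" if "0 \<le> x" for u x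
      using that d by (auto simp: f_def frac_le split: split_indicator)
    have b: "integrable lborel (\<lambda>u. indicator {d..D} u * (1 / d))"
      by (intro integrable_mult_left integrable_real_indicator) (use d in auto)
    have qf: "quad_form (f u) \<mu> \<nu> = indicator {d..D} u * Q u" for u
      unfolding f_def Q_def by (rule quad_form_cmult)
    note par = quad_form_param[OF \<mu> \<nu> E lborel.sigma_finite_measure_axioms meas bound b, unfolded qf]
    show "quad_form (\<lambda>x. ln (x + D) - ln (x + d)) \<mu> \<nu> = (\<integral>u. indicator {d..D} u * Q u \<partial>lborel)"
      using par(1) quad_form_cong[of "\<lambda>x. \<integral>u. f u x \<partial>lborel" "\<lambda>x. ln (x + D) - ln (x + d)"] int_f by simp
    show "integrable lborel (\<lambda>u. indicator {d..D} u * Q u)" by (rule par(2))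
  qed
  \<comment> \<open>The interval [1, 2] lies in every [d, D] with \<open>d \<le> 1\<close> and
    \<open>D \<ge> 2\<close>, and the integrand is nonnegative.\<close>
  define c where "c = (\<integral>u. indicator {1..2} u * Q u \<partial>lborel)"
  have int12: "integrable lborel (\<lambda>u. indicator {1..2} u * Q u)" using main(2)[of 1 2] by simp
  have nn12: "0 \<le> indicator {1..2} u * Q u" for u using Q0[of u] by (auto split: split_indicator)
  obtain R where R: "\<And>z. z \<in> E \<Longrightarrow> cmod z \<le> R" "0 < R"
    using compact_imp_bounded[OF E] unfolding bounded_pos by blast
  define X where "X = (2 * R)\<^sup>2"
  have X: "0 < X" unfolding X_def using R by simp
  \<comment> \<open>A constant kernel has quadratic form 0, as both measures have mass 1.
    Subtracting \<open>ln D\<close> leaves ln (1 + x / D), which is at most \<open>X / D\<close> for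
    squared distances x within \<open>E\<close>, so the contribution of \<open>D\<close> dies
    out.\<close>
  have small: "quad_form (\<lambda>x. ln (x + D)) \<mu> \<nu> \<le> 2 * X / D" if D: "0 < D" for D
  proof -
    have cont1: "continuous_on {0..} (\<lambda>x. ln (x + D))" using D by (intro continuous_intros) auto
    have "quad_form (\<lambda>x. ln (x + D)) \<mu> \<nu> = quad_form (\<lambda>x. ln (x + D) - ln D) \<mu> \<nu>"
      using quad_form_diff[OF \<mu> \<nu> E cont1 continuous_on_const, of "ln D"] quad_form_const[OF \<mu> \<nu> E] by simp
    have b: "0 \<le> double_integral (\<lambda>z w. ln ((cmod (z - w))\<^sup>2 + D) - ln D) \<mu>' \<nu>'"
      "double_integral (\<lambda>z w. ln ((cmod (z - w))\<^sup>2 + D) - ln D) \<mu>' \<nu>' \<le> X / D"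
      if \<mu>': "\<mu>' \<in> prob_measures_on E" and \<nu>': "\<nu>' \<in> prob_measures_on E" for \<mu>' \<nu>'
    proof -
      interpret M: prob_space \<mu>' using \<mu>' by (simp add: prob_measures_on_def)
      interpret N: prob_space \<nu>' using \<nu>' by (simp add: prob_measures_on_def)
      interpret MN: pair_prob_space \<mu>' \<nu>' ..
      have "ln D \<le> ln (y + D)" if "0 \<le> y" for y using that D by simp
      then show "0 \<le> double_integral (\<lambda>z w. ln ((cmod (z - w))\<^sup>2 + D) - ln D) \<mu>' \<nu>'"
        unfolding double_integral_def by (intro integral_nonneg_AE) auto
      have int: "integrable (\<mu>' \<Otimes>\<^sub>M \<nu>') (\<lambda>p. ln ((cmod (fst p - snd p))\<^sup>2 + D) - ln D)"
        using D by (intro integrable_pair_continuous[OF \<mu>' \<nu>' E, of "\<lambda>z w. ln ((cmod (z - w))\<^sup>2 + D) - ln D"]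
          continuous_intros) (auto simp: add_nonneg_eq_0_iff)
      have "ln ((cmod (fst p - snd p))\<^sup>2 + D) - ln D \<le> X / D" if p: "fst p \<in> E \<and> snd p \<in> E" for p
      proof -
        have "cmod (fst p - snd p) \<le> 2 * R"
          using norm_triangle_ineq4[of "fst p" "snd p"] R(1)[of "fst p"] R(1)[of "snd p"] p by linarith
        then have "(cmod (fst p - snd p))\<^sup>2 \<le> X" unfolding X_def by (intro power_mono) auto
        moreover have "ln ((cmod (fst p - snd p))\<^sup>2 + D) - ln D = ln (1 + (cmod (fst p - snd p))\<^sup>2 / D)"
        proof -
          have "ln (D * (1 + (cmod (fst p - snd p))\<^sup>2 / D)) = ln D + ln (1 + (cmod (fst p - snd p))\<^sup>2 / D)"
            using D by (intro ln_mult_pos) (auto intro!: add_pos_nonneg)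
          moreover have "D * (1 + (cmod (fst p - snd p))\<^sup>2 / D) = (cmod (fst p - snd p))\<^sup>2 + D"
            using D by (simp add: field_simps)
          ultimately show ?thesis by simp
        qed
        moreover have "\<dots> \<le> (cmod (fst p - snd p))\<^sup>2 / D" using D by (intro ln_add_one_self_le_self) auto
        ultimately show ?thesis using D by (smt (verit) divide_right_mono)
      qed
      then have "double_integral (\<lambda>z w. ln ((cmod (z - w))\<^sup>2 + D) - ln D) \<mu>' \<nu>' \<le> (\<integral>p. X / D \<partial>(\<mu>' \<Otimes>\<^sub>M \<nu>'))"
        unfolding double_integral_def using AE_pair_prob_measures[OF \<mu>' \<nu>' E]
        by (intro integral_mono_AE int) (auto elim: eventually_mono)
      then show "double_integral (\<lambda>z w. ln ((cmod (z - w))\<^sup>2 + D) - ln D) \<mu>' \<nu>' \<le> X / D"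
        by (simp add: MN.P.prob_space)
    qed
    have "quad_form (\<lambda>x. ln (x + D)) \<mu> \<nu> = quad_form (\<lambda>x. ln (x + D) - ln D) \<mu> \<nu>" by fact
    also have "\<dots> \<le> 2 * X / D"
      unfolding quad_form_def using b[OF \<mu> \<mu>] b[OF \<nu> \<nu>] b[OF \<mu> \<nu>] by simp
    finally show ?thesis .
  qed
  have lower: "c / 2 \<le> quad_form (\<lambda>x. - ln (x + d) / 2) \<mu> \<nu>" if d: "0 < d" "d \<le> 1" for d
  proof (rule field_le_epsilon)
    fix e :: real assume e: "0 < e"
    define D where "D = max 2 (X / e)"
    have D: "2 \<le> D" "X / e \<le> D" by (auto simp: D_def)
    have XD: "X / D \<le> e" using D e X by (simp add: field_simps)
    have "c \<le> (\<integral>u. indicator {d..D} u * Q u \<partial>lborel)"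
      unfolding c_def
      by (rule integral_mono[OF int12 main(2)]) (use d D Q0 in \<open>auto split: split_indicator\<close>)
    also have "\<dots> = quad_form (\<lambda>x. ln (x + D) - ln (x + d)) \<mu> \<nu>" using main(1)[of d D] d D by simp
    also have "\<dots> = quad_form (\<lambda>x. ln (x + D)) \<mu> \<nu> - quad_form (\<lambda>x. ln (x + d)) \<mu> \<nu>"
      using d D by (intro quad_form_diff[OF \<mu> \<nu> E]) (auto intro!: continuous_intros)
    also have "\<dots> \<le> 2 * X / D - quad_form (\<lambda>x. ln (x + d)) \<mu> \<nu>" using small[of D] D by simp
    also have "quad_form (\<lambda>x. ln (x + d)) \<mu> \<nu> = - 2 * quad_form (\<lambda>x. - ln (x + d) / 2) \<mu> \<nu>"
      using quad_form_cmult[of "-1/2" "\<lambda>x. ln (x + d)" \<mu> \<nu>] by simp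
    finally show "c / 2 \<le> quad_form (\<lambda>x. - ln (x + d) / 2) \<mu> \<nu> + e" using XD by simp
  qed
  show thesis
  proof (rule that[of "c / 2"])
    show "0 \<le> c / 2" unfolding c_def using nn12 by simp
    assume "c / 2 = 0"
    then have "AE u in lborel. indicator {1..2} u * Q u = 0"
      using integral_nonneg_eq_0_iff_AE[OF int12] nn12 unfolding c_def by simp
    then obtain u where "u \<in> {1..2}" "indicator {1..2} u * Q u = 0" by (rule AE_lborel_obtain[of _ 1 2]) auto
    then show "\<mu> = \<nu>" using quad_form_resolvent(2)[of u] by (simp add: Q_def)
  qed (rule lower)
qed

end

section \<open>Energy and its minimizer\<close>

definition reg_log :: "real \<Rightarrow> complex \<Rightarrow> complex \<Rightarrow> real" where
  "reg_log d z w = - ln ((cmod (z - w))\<^sup>2 + d) / 2"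

abbreviation reg_energy :: "nat \<Rightarrow> complex measure \<Rightarrow> complex measure \<Rightarrow> real" where
  "reg_energy n \<equiv> double_integral (reg_log (inverse (real (Suc n))))"

definition reg_potential :: "nat \<Rightarrow> complex measure \<Rightarrow> complex \<Rightarrow> real" where
  "reg_potential n \<mu> z = (\<integral>w. reg_log (inverse (real (Suc n))) z w \<partial>\<mu>)"

lemma continuous_reg_log:
  assumes "0 < d"
  shows "continuous_on UNIV (\<lambda>p. reg_log d (fst p) (snd p))"
proof -
  have "(cmod (fst p - snd p))\<^sup>2 + d \<noteq> 0" for p :: "complex \<times> complex"
    using assms by (smt (verit) zero_le_power2)
  then show ?thesis unfolding reg_log_def by (intro continuous_intros) auto
qed

lemma reg_log_commute: "reg_log d z w = reg_log d w z"
  by (simp add: reg_log_def norm_minus_commute)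

lemma reg_log_antimono: "0 < d \<Longrightarrow> d \<le> d' \<Longrightarrow> reg_log d' z w \<le> reg_log d z w"
  by (simp add: reg_log_def add_nonneg_pos)

lemma reg_log_inverse_mono: "m \<le> n \<Longrightarrow>
    reg_log (inverse (real (Suc m))) z w \<le> reg_log (inverse (real (Suc n))) z w"
  by (rule reg_log_antimono) (auto simp: field_simps)

lemma reg_log_le:
  assumes "z \<noteq> w" "0 < d"
  shows "reg_log d z w \<le> - ln (cmod (z - w))"
proof -
  have "2 * ln (cmod (z - w)) = ln ((cmod (z - w))\<^sup>2)" using assms by (simp add: ln_realpow)
  also have "\<dots> \<le> ln ((cmod (z - w))\<^sup>2 + d)" using assms by (simp add: add_pos_pos)
  finally show ?thesis by (simp add: reg_log_def)
qed

lemma inverse_Suc_tendsto: "(\<lambda>n. inverse (real (Suc n))) \<longlonglongrightarrow> 0"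
  by (rule LIMSEQ_inverse_real_of_nat)

lemma reg_log_tendsto:
  assumes "z \<noteq> w"
  shows "(\<lambda>n. reg_log (inverse (real (Suc n))) z w) \<longlonglongrightarrow> - ln (cmod (z - w))"
proof -
  have "(\<lambda>n. - ln ((cmod (z - w))\<^sup>2 + inverse (real (Suc n))) / 2) \<longlonglongrightarrow> - ln ((cmod (z - w))\<^sup>2 + 0) / 2"
    by (intro tendsto_intros inverse_Suc_tendsto) (use assms in auto)
  then show ?thesis using assms by (simp add: reg_log_def ln_realpow)
qed

lemma reg_log_lower_bound:
  assumes "compact E"
  obtains C where "0 \<le> C" "\<And>n z w. z \<in> E \<Longrightarrow> w \<in> E \<Longrightarrow> - C \<le> reg_log (inverse (real (Suc n))) z w"
proof -
  \<comment> \<open>\<open>reg_log 1\<close> is the smallest of the kernels with d = 1 / (n + 1), so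
    its lower bound serves all \<open>n\<close>.\<close>
  have "compact ((\<lambda>p. reg_log 1 (fst p) (snd p)) ` (E \<times> E))"
    by (intro compact_continuous_image compact_Times assms continuous_on_subset[OF continuous_reg_log]) auto
  then obtain C where C: "\<And>y. y \<in> (\<lambda>p. reg_log 1 (fst p) (snd p)) ` (E \<times> E) \<Longrightarrow> norm y \<le> C"
    using compact_imp_bounded bounded_iff by metis
  show ?thesis
  proof (rule that[of "\<bar>C\<bar>"])
    fix n z w assume "z \<in> E" "w \<in> E"
    then have "norm (reg_log 1 z w) \<le> C" by (intro C) force
    moreover have "reg_log 1 z w \<le> reg_log (inverse (real (Suc n))) z w"
      using reg_log_inverse_mono[of 0 n] by simp
    ultimately show "- \<bar>C\<bar> \<le> reg_log (inverse (real (Suc n))) z w" by simp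
  qed simp
qed

lemma quad_form_reg_log:
  "quad_form (\<lambda>x. - ln (x + d) / 2) \<mu> \<nu> =
    double_integral (reg_log d) \<mu> \<mu> + double_integral (reg_log d) \<nu> \<nu> - 2 * double_integral (reg_log d) \<mu> \<nu>"
  unfolding quad_form_def reg_log_def[abs_def] ..

text \<open>The bridge from the extended-real definition to real numbers: monotone convergence for
  the positive part, dominated convergence for the negative part, which is bounded on
  \<open>E\<close>.\<close>

lemma log_energy_limit:
  assumes \<mu>: "\<mu> \<in> prob_measures_on E" and E: "compact E"
  shows "(\<lambda>n. ereal (reg_energy n \<mu> \<mu>)) \<longlonglongrightarrow> log_energy \<mu>"
proof -
  note mD = prob_measures_onD[OF \<mu> compact_imp_closed[OF E]]
  interpret M: prob_space \<mu> by (rule mD)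
  interpret MM: pair_prob_space \<mu> \<mu> ..
  have [measurable_cong]: "sets \<mu> = sets borel" by (rule mD)
  define r where "r n p = reg_log (inverse (real (Suc n))) (fst p) (snd p)" for n p
  have [measurable]: "r n \<in> borel_measurable (\<mu> \<Otimes>\<^sub>M \<mu>)" for n
    unfolding r_def reg_log_def by measurable
  have ir: "integrable (\<mu> \<Otimes>\<^sub>M \<mu>) (r n)" for n
    unfolding r_def by (rule integrable_pair_continuous[OF \<mu> \<mu> E continuous_reg_log]) simp
  obtain C where C: "0 \<le> C" "\<And>n z w. z \<in> E \<Longrightarrow> w \<in> E \<Longrightarrow> - C \<le> reg_log (inverse (real (Suc n))) z w"
    using reg_log_lower_bound[OF E] by metis
  have pos: "(\<lambda>n. \<integral>\<^sup>+p. ennreal (max 0 (r n p)) \<partial>(\<mu> \<Otimes>\<^sub>M \<mu>)) \<longlonglongrightarrow>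
      (\<integral>\<^sup>+p. log_kernel_pos (fst p) (snd p) \<partial>(\<mu> \<Otimes>\<^sub>M \<mu>))"
  proof (rule nn_integral_LIMSEQ)
    show "incseq (\<lambda>n p. ennreal (max 0 (r n p)))"
      unfolding incseq_def le_fun_def r_def
      using reg_log_inverse_mono by (auto intro!: ennreal_leI max.mono simp del: of_nat_Suc)
    fix p :: "complex \<times> complex"
    show "(\<lambda>n. ennreal (max 0 (r n p))) \<longlonglongrightarrow> log_kernel_pos (fst p) (snd p)"
    proof (cases "fst p = snd p")
      case False
      then have "(\<lambda>n. ennreal (max 0 (r n p))) \<longlonglongrightarrow> ennreal (max 0 (- ln (cmod (fst p - snd p))))"
        unfolding r_def by (intro tendsto_ennrealI tendsto_max tendsto_const reg_log_tendsto)
      then show ?thesis using False by (simp add: log_kernel_pos_def)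
    next
      case True
      \<comment> \<open>On the diagonal the regularised kernel grows like half of ln (n + 1), in
        accordance with the value \<top> of \<open>log_kernel_pos\<close>.\<close>
      have "r n p = ln (real (Suc n)) * (1 / 2)" for n
        unfolding r_def reg_log_def using True by (simp add: ln_inverse)
      moreover have "filterlim (\<lambda>n. ln (real (Suc n)) * (1 / 2)) at_top sequentially"
        by (intro filterlim_at_top_mult_tendsto_pos[OF tendsto_const] filterlim_compose[OF ln_at_top]
          filterlim_compose[OF filterlim_real_sequentially] filterlim_Suc) auto
      ultimately have "filterlim (\<lambda>n. r n p) at_top sequentially" by (simp only:)
      then show ?thesis using True by (simp add: log_kernel_pos_def ennreal_tendsto_top_eq_at_top)
    qed
  qed auto
  have neg: "(\<lambda>n. \<integral>p. max 0 (- r n p) \<partial>(\<mu> \<Otimes>\<^sub>M \<mu>)) \<longlonglongrightarrow> (\<integral>p. log_kernel_neg (fst p) (snd p) \<partial>(\<mu> \<Otimes>\<^sub>M \<mu>))"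
  proof (rule integral_dominated_convergence[where w = "\<lambda>_. C"])
    show "AE p in \<mu> \<Otimes>\<^sub>M \<mu>. (\<lambda>n. max 0 (- r n p)) \<longlonglongrightarrow> log_kernel_neg (fst p) (snd p)"
    proof (rule AE_I2)
      fix p :: "complex \<times> complex"
      show "(\<lambda>n. max 0 (- r n p)) \<longlonglongrightarrow> log_kernel_neg (fst p) (snd p)"
      proof (cases "fst p = snd p")
        case False
        then have "(\<lambda>n. max 0 (- r n p)) \<longlonglongrightarrow> max 0 (- (- ln (cmod (fst p - snd p))))"
          unfolding r_def by (intro tendsto_max tendsto_const tendsto_minus reg_log_tendsto)
        then show ?thesis using False by (simp add: log_kernel_neg_def)
      next
        case True
        have r0: "0 \<le> r n p" for n
          unfolding r_def reg_log_def using True by (simp add: ln_inverse)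
        have "max 0 (- r n p) = 0" for n using r0[of n] by simp
        then show ?thesis using True by (simp add: log_kernel_neg_def)
      qed
    qed
    show "AE p in \<mu> \<Otimes>\<^sub>M \<mu>. norm (max 0 (- r n p)) \<le> C" for n
      using AE_pair_prob_measures[OF \<mu> \<mu> E]
    proof eventually_elim
      case (elim p)
      then show ?case using C(2)[of "fst p" "snd p" n] C(1) by (auto simp: r_def)
    qed
    show "(\<lambda>p. log_kernel_neg (fst p) (snd p)) \<in> borel_measurable (\<mu> \<Otimes>\<^sub>M \<mu>)"
      unfolding log_kernel_neg_def by measurable
  qed auto
  have eq: "ereal (reg_energy n \<mu> \<mu>) =
    enn2ereal (\<integral>\<^sup>+p. ennreal (max 0 (r n p)) \<partial>(\<mu> \<Otimes>\<^sub>M \<mu>)) - ereal (\<integral>p. max 0 (- r n p) \<partial>(\<mu> \<Otimes>\<^sub>M \<mu>))" for n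
  proof -
    have i1: "integrable (\<mu> \<Otimes>\<^sub>M \<mu>) (\<lambda>p. max 0 (r n p))" and i2: "integrable (\<mu> \<Otimes>\<^sub>M \<mu>) (\<lambda>p. max 0 (- r n p))"
      using ir[of n] by (auto intro!: integrable_max)
    have "reg_energy n \<mu> \<mu> = (\<integral>p. max 0 (r n p) - max 0 (- r n p) \<partial>(\<mu> \<Otimes>\<^sub>M \<mu>))"
      unfolding double_integral_def r_def by (intro Bochner_Integration.integral_cong) auto
    also have "\<dots> = (\<integral>p. max 0 (r n p) \<partial>(\<mu> \<Otimes>\<^sub>M \<mu>)) - (\<integral>p. max 0 (- r n p) \<partial>(\<mu> \<Otimes>\<^sub>M \<mu>))"
      using i1 i2 by simp
    finally show ?thesis
      using nn_integral_eq_integral[OF i1] by (simp add: integral_nonneg_AE)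
  qed
  show ?thesis unfolding eq log_energy_def
    by (intro tendsto_diff_ereal_general) (use pos neg in auto)
qed

lemma reg_energy_mono:
  assumes \<mu>: "\<mu> \<in> prob_measures_on E" and \<nu>: "\<nu> \<in> prob_measures_on E" and E: "compact E" and "m \<le> n"
  shows "reg_energy m \<mu> \<nu> \<le> reg_energy n \<mu> \<nu>"
  unfolding double_integral_def
  by (intro integral_mono integrable_pair_continuous[OF \<mu> \<nu> E] continuous_reg_log reg_log_inverse_mono assms) auto

text \<open>Energies are used from here on through these real inequalities; monotonicity in
  \<open>n\<close> makes the limit a supremum.\<close>

lemma log_energy_le_iff:
  assumes \<mu>: "\<mu> \<in> prob_measures_on E" and E: "compact E"
  shows "log_energy \<mu> \<le> ereal c \<longleftrightarrow> (\<forall>n. reg_energy n \<mu> \<mu> \<le> c)"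
proof
  assume le: "log_energy \<mu> \<le> ereal c"
  have "incseq (\<lambda>n. ereal (reg_energy n \<mu> \<mu>))"
    unfolding incseq_def using reg_energy_mono[OF \<mu> \<mu> E] by simp
  from incseq_le[OF this log_energy_limit[OF \<mu> E]]
  have "ereal (reg_energy n \<mu> \<mu>) \<le> ereal c" for n using le order_trans by blast
  then show "\<forall>n. reg_energy n \<mu> \<mu> \<le> c" by simp
next
  assume "\<forall>n. reg_energy n \<mu> \<mu> \<le> c"
  then show "log_energy \<mu> \<le> ereal c"
    by (intro LIMSEQ_le_const2[OF log_energy_limit[OF \<mu> E]]) auto
qed

lemma min_energy_real:
  assumes E: "compact E" and cap: "log_capacity E > 0"
  obtains V where "min_energy E = ereal V" "log_capacity E = exp (- V)"
proof -
  have ninf: "min_energy E \<noteq> \<infinity>" using cap by (auto simp: log_capacity_def)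
  obtain C where C: "0 \<le> C" "\<And>n z w. z \<in> E \<Longrightarrow> w \<in> E \<Longrightarrow> - C \<le> reg_log (inverse (real (Suc n))) z w"
    using reg_log_lower_bound[OF E] by metis
  \<comment> \<open>Positive capacity alone does not rule out minus infinity, which
    \<open>real_of_ereal\<close> sends to 0; the lower bound of the kernel on compact
    \<open>E\<close> does.\<close>
  have "ereal (- C) \<le> min_energy E"
    unfolding min_energy_def
  proof (rule INF_greatest)
    fix \<mu> assume \<mu>: "\<mu> \<in> prob_measures_on E"
    interpret M: prob_space \<mu> using \<mu> by (simp add: prob_measures_on_def)
    interpret MM: pair_prob_space \<mu> \<mu> ..
    have "AE p in \<mu> \<Otimes>\<^sub>M \<mu>. - C \<le> reg_log (inverse (real (Suc n))) (fst p) (snd p)" for n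
      using AE_pair_prob_measures[OF \<mu> \<mu> E] by eventually_elim (use C(2) in blast)
    then have "(\<integral>p. - C \<partial>(\<mu> \<Otimes>\<^sub>M \<mu>)) \<le> reg_energy n \<mu> \<mu>" for n
      unfolding double_integral_def
      by (intro integral_mono_AE integrable_pair_continuous[OF \<mu> \<mu> E] continuous_reg_log) auto
    then show "ereal (- C) \<le> log_energy \<mu>"
      by (intro LIMSEQ_le_const[OF log_energy_limit[OF \<mu> E]]) (auto simp: MM.P.prob_space)
  qed
  then obtain V where "min_energy E = ereal V" using ninf by (cases "min_energy E") auto
  then show thesis using that by (simp add: log_capacity_def)
qed

text \<open>On \<open>\<Omega> \<Otimes>\<^sub>M \<Omega>\<close> the pairs of coupled variables
  converge pointwise, so dominated convergence takes the place of weak convergence of product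
  measures.\<close>

lemma double_integral_distr_tendsto:
  assumes \<Omega>: "prob_space \<Omega>" and E: "compact E"
    and Zs[measurable]: "\<And>n. Zs n \<in> borel_measurable \<Omega>" and Z[measurable]: "Z \<in> borel_measurable \<Omega>"
    and ZE: "\<And>n. AE x in \<Omega>. Zs n x \<in> E"
    and lim: "\<And>x. x \<in> space \<Omega> \<Longrightarrow> (\<lambda>n. Zs n x) \<longlonglongrightarrow> Z x"
    and k: "continuous_on UNIV (\<lambda>p. k (fst p) (snd p) :: real)"
  shows "(\<lambda>n. double_integral k (distr \<Omega> borel (Zs n)) (distr \<Omega> borel (Zs n))) \<longlonglongrightarrow>
    double_integral k (distr \<Omega> borel Z) (distr \<Omega> borel Z)"
proof -
  interpret O: prob_space \<Omega> by (rule \<Omega>)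
  interpret OO: pair_prob_space \<Omega> \<Omega> ..
  have km[measurable]: "(\<lambda>p. k (fst p) (snd p)) \<in> borel_measurable (borel \<Otimes>\<^sub>M borel)"
    using borel_measurable_continuous_onI[OF k] by (simp only: borel_prod)
  have eq: "double_integral k (distr \<Omega> borel X) (distr \<Omega> borel X) = (\<integral>p. k (X (fst p)) (X (snd p)) \<partial>(\<Omega> \<Otimes>\<^sub>M \<Omega>))"
    if [measurable]: "X \<in> borel_measurable \<Omega>" for X
  proof -
    interpret D: prob_space "distr \<Omega> borel X" by (rule O.prob_space_distr) measurable
    have "distr \<Omega> borel X \<Otimes>\<^sub>M distr \<Omega> borel X = distr (\<Omega> \<Otimes>\<^sub>M \<Omega>) (borel \<Otimes>\<^sub>M borel) (\<lambda>(x, y). (X x, X y))"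
      by (rule pair_measure_distr) (auto intro: D.sigma_finite_measure)
    then have "double_integral k (distr \<Omega> borel X) (distr \<Omega> borel X) =
        (\<integral>p. k (fst p) (snd p) \<partial>(distr (\<Omega> \<Otimes>\<^sub>M \<Omega>) (borel \<Otimes>\<^sub>M borel) (\<lambda>(x, y). (X x, X y))))"
      by (simp add: double_integral_def)
    also have "\<dots> = (\<integral>p. k (X (fst p)) (X (snd p)) \<partial>(\<Omega> \<Otimes>\<^sub>M \<Omega>))"
      by (subst integral_distr) (auto simp: case_prod_beta)
    finally show ?thesis .
  qed
  have "compact ((\<lambda>p. k (fst p) (snd p)) ` (E \<times> E))"
    by (intro compact_continuous_image compact_Times E continuous_on_subset[OF k]) auto
  then obtain C where C: "\<And>y. y \<in> (\<lambda>p. k (fst p) (snd p)) ` (E \<times> E) \<Longrightarrow> norm y \<le> C"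
    using compact_imp_bounded bounded_iff by metis
  have [measurable]: "(\<lambda>p. k (X (fst p)) (X (snd p))) \<in> borel_measurable (\<Omega> \<Otimes>\<^sub>M \<Omega>)"
    if [measurable]: "X \<in> borel_measurable \<Omega>" for X
    using measurable_compose[OF _ km, of "\<lambda>p. (X (fst p), X (snd p))"] by simp
  have "(\<lambda>n. \<integral>p. k (Zs n (fst p)) (Zs n (snd p)) \<partial>(\<Omega> \<Otimes>\<^sub>M \<Omega>)) \<longlonglongrightarrow> (\<integral>p. k (Z (fst p)) (Z (snd p)) \<partial>(\<Omega> \<Otimes>\<^sub>M \<Omega>))"
  proof (rule integral_dominated_convergence[where w = "\<lambda>_. C"])
    show "AE p in \<Omega> \<Otimes>\<^sub>M \<Omega>. (\<lambda>n. k (Zs n (fst p)) (Zs n (snd p))) \<longlonglongrightarrow> k (Z (fst p)) (Z (snd p))"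
    proof (rule AE_I2)
      fix p assume "p \<in> space (\<Omega> \<Otimes>\<^sub>M \<Omega>)"
      then have "(\<lambda>n. (Zs n (fst p), Zs n (snd p))) \<longlonglongrightarrow> (Z (fst p), Z (snd p))"
        by (intro tendsto_Pair lim) (auto simp: space_pair_measure)
      from continuous_on_tendsto_compose[OF k this]
      show "(\<lambda>n. k (Zs n (fst p)) (Zs n (snd p))) \<longlonglongrightarrow> k (Z (fst p)) (Z (snd p))" by simp
    qed
    fix n
    have "AE x in \<Omega>. AE y in \<Omega>. Zs n x \<in> E \<and> Zs n y \<in> E"
      using ZE[of n] by eventually_elim (use ZE[of n] in auto)
    moreover have [measurable]: "E \<in> sets borel" using E by (simp add: borel_compact)
    ultimately have "AE p in \<Omega> \<Otimes>\<^sub>M \<Omega>. Zs n (fst p) \<in> E \<and> Zs n (snd p) \<in> E"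
      by (intro OO.AE_pair_measure) auto
    then show "AE p in \<Omega> \<Otimes>\<^sub>M \<Omega>. norm (k (Zs n (fst p)) (Zs n (snd p))) \<le> C"
      by eventually_elim (rule C, force)
  qed auto
  then show ?thesis by (simp add: eq)
qed

text \<open>The direct method: lower semicontinuity of the energy appears as continuity of each
  regularised energy along the coupled sequence.\<close>

lemma energy_minimizer_exists:
  assumes E: "compact E" and V: "min_energy E = ereal V"
  obtains \<mu> where "\<mu> \<in> prob_measures_on E" "log_energy \<mu> = min_energy E"
proof -
  have "\<exists>\<mu>\<in>prob_measures_on E. log_energy \<mu> < ereal (V + inverse (real (Suc n)))" for n
    using V unfolding min_energy_def by (intro INF_less_iff[THEN iffD1]) simp
  then obtain \<mu>s where \<mu>s: "\<And>n. \<mu>s n \<in> prob_measures_on E"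
    and lt: "\<And>n. log_energy (\<mu>s n) < ereal (V + inverse (real (Suc n)))" by metis
  note mD = prob_measures_onD[OF \<mu>s compact_imp_closed[OF E]]
  obtain R where R: "\<And>z. z \<in> E \<Longrightarrow> cmod z \<le> R" using compact_imp_bounded[OF E] by (auto simp: bounded_iff)
  have AER: "AE z in \<mu>s n. cmod z \<le> R" for n using mD(3)[of n] by eventually_elim (rule R)
  obtain r and \<Omega> :: "real measure" and Zs Z where r: "strict_mono (r :: nat \<Rightarrow> nat)" and \<Omega>: "prob_space \<Omega>"
    and Zs[measurable]: "\<And>n. Zs n \<in> borel_measurable \<Omega>" and Z[measurable]: "Z \<in> borel_measurable \<Omega>"
    and d: "\<And>n. distr \<Omega> borel (Zs n) = \<mu>s (r n)"
    and lim: "\<And>x. x \<in> space \<Omega> \<Longrightarrow> (\<lambda>n. Zs n x) \<longlonglongrightarrow> Z x"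
    using Skorohod_complex[of \<mu>s R, OF mD(1) mD(2) AER] by blast
  have [measurable]: "E \<in> sets borel" using E by (simp add: borel_compact)
  have ZE: "AE x in \<Omega>. Zs n x \<in> E" for n
    using mD(3)[of "r n"] by (subst (asm) d[symmetric], subst (asm) AE_distr_iff) auto
  have "AE x in \<Omega>. \<forall>n. Zs n x \<in> E" using ZE by (simp add: AE_all_countable)
  then have "AE x in \<Omega>. Z x \<in> E"
    using AE_space
  proof eventually_elim
    case (elim x)
    then show ?case using closed_sequentially[OF compact_imp_closed[OF E], of "\<lambda>n. Zs n x"] lim[of x] by blast
  qed
  then have AEZ: "AE z in distr \<Omega> borel Z. z \<in> E" by (subst AE_distr_iff) auto
  define \<mu> where "\<mu> = distr \<Omega> borel Z"
  have \<mu>: "\<mu> \<in> prob_measures_on E"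
    using AEZ unfolding \<mu>_def
    by (intro prob_measures_onI compact_imp_closed[OF E] prob_space.prob_space_distr[OF \<Omega>]) auto
  \<comment> \<open>The regularisation \<open>m\<close> stays fixed while the minimizing sequence
    converges.\<close>
  have "reg_energy m \<mu> \<mu> \<le> V" for m
  proof (rule LIMSEQ_le)
    show "(\<lambda>n. reg_energy m (\<mu>s (r n)) (\<mu>s (r n))) \<longlonglongrightarrow> reg_energy m \<mu> \<mu>"
      unfolding \<mu>_def d[symmetric]
      by (rule double_integral_distr_tendsto[OF \<Omega> E Zs Z ZE lim continuous_reg_log]) auto
    have "(\<lambda>n. V + inverse (real (Suc (r n)))) \<longlonglongrightarrow> V + 0"
      using LIMSEQ_subseq_LIMSEQ[OF inverse_Suc_tendsto r] by (intro tendsto_intros) (simp add: o_def)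
    then show "(\<lambda>n. V + inverse (real (Suc (r n)))) \<longlonglongrightarrow> V" by simp
    have "reg_energy m (\<mu>s (r n)) (\<mu>s (r n)) \<le> V + inverse (real (Suc (r n)))" for n
      using log_energy_le_iff[OF \<mu>s E] lt less_imp_le by blast
    then show "\<exists>N. \<forall>n\<ge>N. reg_energy m (\<mu>s (r n)) (\<mu>s (r n)) \<le> V + inverse (real (Suc (r n)))" by blast
  qed
  then have "log_energy \<mu> \<le> min_energy E" using log_energy_le_iff[OF \<mu> E] V by simp
  moreover have "min_energy E \<le> log_energy \<mu>" unfolding min_energy_def by (rule INF_lower[OF \<mu>])
  ultimately show thesis using that \<mu> by (metis order.antisym)
qed

lemma continuous_on_section:
  assumes k: "continuous_on UNIV (\<lambda>p. k (fst p) (snd p) :: real)"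
  shows "continuous_on UNIV (k z)"
proof -
  have c: "continuous_on UNIV (\<lambda>w. (z, w))" by (intro continuous_intros)
  from continuous_on_compose2[OF k c] show ?thesis by simp
qed

lemma continuous_integral_kernel:
  fixes k :: "complex \<Rightarrow> complex \<Rightarrow> real"
  assumes \<mu>: "\<mu> \<in> prob_measures_on E" and E: "compact E"
    and k: "continuous_on UNIV (\<lambda>p. k (fst p) (snd p) :: real)"
  shows "continuous_on UNIV (\<lambda>z. \<integral>w. k z w \<partial>\<mu>)"
proof -
  note mD = prob_measures_onD[OF \<mu> compact_imp_closed[OF E]]
  interpret prob_space \<mu> by (rule mD)
  have [measurable_cong]: "sets \<mu> = sets borel" by (rule mD)
  have kz: "continuous_on UNIV (k z)" for z
    by (rule continuous_on_section[OF k])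
  have [measurable]: "k z \<in> borel_measurable borel" for z
    by (rule borel_measurable_continuous_onI[OF kz])
  have "isCont (\<lambda>z. \<integral>w. k z w \<partial>\<mu>) z" for z
  proof (rule continuous_at_sequentiallyI)
    fix u assume u: "u \<longlonglongrightarrow> z"
    have "compact ((\<lambda>p. k (fst p) (snd p)) ` (cball z 1 \<times> E))"
      by (intro compact_continuous_image compact_Times E compact_cball continuous_on_subset[OF k]) auto
    then obtain C where C: "\<And>y. y \<in> (\<lambda>p. k (fst p) (snd p)) ` (cball z 1 \<times> E) \<Longrightarrow> norm y \<le> C"
      using compact_imp_bounded bounded_iff by metis
    have "\<forall>\<^sub>F n in sequentially. u n \<in> ball z 1" by (rule topological_tendstoD[OF u]) auto
    then obtain N where N: "\<And>n. n \<ge> N \<Longrightarrow> u n \<in> ball z 1" unfolding eventually_sequentially by blast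
    have "(\<lambda>n. \<integral>w. k (u (n + N)) w \<partial>\<mu>) \<longlonglongrightarrow> (\<integral>w. k z w \<partial>\<mu>)"
    proof (rule integral_dominated_convergence[where w = "\<lambda>_. C"])
      show "AE w in \<mu>. (\<lambda>n. k (u (n + N)) w) \<longlonglongrightarrow> k z w"
      proof (rule AE_I2)
        fix w :: complex
        have "(\<lambda>n. (u (n + N), w)) \<longlonglongrightarrow> (z, w)"
          by (intro tendsto_Pair tendsto_const LIMSEQ_ignore_initial_segment[OF u])
        from continuous_on_tendsto_compose[OF k this] show "(\<lambda>n. k (u (n + N)) w) \<longlonglongrightarrow> k z w" by simp
      qed
      show "AE w in \<mu>. norm (k (u (n + N)) w) \<le> C" for n
        using mD(3)
      proof eventually_elim
        case (elim w)
        then have "(u (n + N), w) \<in> cball z 1 \<times> E" using N[of "n + N"] by auto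
        then show ?case by (intro C) force
      qed
    qed auto
    then show "(\<lambda>n. \<integral>w. k (u n) w \<partial>\<mu>) \<longlonglongrightarrow> (\<integral>w. k z w \<partial>\<mu>)" by (rule LIMSEQ_offset)
  qed
  then show ?thesis by (intro continuous_at_imp_continuous_on) auto
qed

lemma continuous_reg_potential:
  assumes "\<mu> \<in> prob_measures_on E" "compact E"
  shows "continuous_on UNIV (reg_potential n \<mu>)"
  unfolding reg_potential_def[abs_def] by (rule continuous_integral_kernel[OF assms continuous_reg_log]) simp

text \<open>The convex combination is built as a two-stage experiment: a coin with success
  probability \<open>t\<close> selects one of the two measures.\<close>

lemma mixture_exists:
  assumes \<mu>: "\<mu> \<in> prob_measures_on E" and \<nu>: "\<nu> \<in> prob_measures_on E" and E: "compact E"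
    and t: "0 \<le> t" "t \<le> 1"
  obtains \<kappa> where "\<kappa> \<in> prob_measures_on E"
    "\<And>f :: complex \<Rightarrow> real. continuous_on UNIV f \<Longrightarrow> (\<integral>z. f z \<partial>\<kappa>) = (1 - t) * (\<integral>z. f z \<partial>\<mu>) + t * (\<integral>z. f z \<partial>\<nu>)"
proof -
  note mD = prob_measures_onD[OF \<mu> compact_imp_closed[OF E]]
  note nD = prob_measures_onD[OF \<nu> compact_imp_closed[OF E]]
  interpret M: prob_space \<mu> by (rule mD)
  interpret N: prob_space \<nu> by (rule nD)
  define N where "N b = (if b then \<nu> else \<mu>)" for b
  define \<kappa> where "\<kappa> = measure_pmf (bernoulli_pmf t) \<bind> N"
  have [measurable]: "E \<in> sets borel" using E by (simp add: borel_compact)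
  have N_meas: "N \<in> measurable (measure_pmf (bernoulli_pmf t)) (subprob_algebra borel)"
    using mD nD M.subprob_space_axioms N.subprob_space_axioms by (auto simp: N_def space_subprob_algebra)
  have N_prob: "prob_space (N b)" "sets (N b) = sets borel" "N b \<in> prob_measures_on E" for b
    using mD nD \<mu> \<nu> by (auto simp: N_def)
  have em: "emeasure \<kappa> X = (\<integral>\<^sup>+b. emeasure (N b) X \<partial>measure_pmf (bernoulli_pmf t))" if "X \<in> sets borel" for X
    unfolding \<kappa>_def by (rule emeasure_bind[OF _ N_meas that]) simp
  have sets\<kappa>: "sets \<kappa> = sets borel" unfolding \<kappa>_def by (rule sets_bind) (use N_prob in auto)
  have spN: "space (N b) = UNIV" for b using sets_eq_imp_space_eq[OF N_prob(2)[of b]] by simp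
  have sp\<kappa>: "space \<kappa> = UNIV" using sets_eq_imp_space_eq[OF sets\<kappa>] by simp
  have prob\<kappa>: "prob_space \<kappa>"
  proof
    have "emeasure (N b) UNIV = 1" for b using prob_space.emeasure_space_1[OF N_prob(1)[of b]] spN by simp
    then show "emeasure \<kappa> (space \<kappa>) = 1" by (simp add: sp\<kappa> em measure_pmf.emeasure_space_1[simplified])
  qed
  have "emeasure \<kappa> (- E) = 0"
    using N_prob(3) by (subst em) (auto simp: prob_measures_on_def)
  then have \<kappa>: "\<kappa> \<in> prob_measures_on E" using prob\<kappa> sets\<kappa> by (simp add: prob_measures_on_def)
  show thesis
  proof (rule that[OF \<kappa>])
    fix f :: "complex \<Rightarrow> real" assume f: "continuous_on UNIV f"
    have [measurable]: "f \<in> borel_measurable borel" by (rule borel_measurable_continuous_onI[OF f])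
    have "compact (f ` E)" by (intro compact_continuous_image E continuous_on_subset[OF f]) auto
    then obtain C where C: "\<And>y. y \<in> f ` E \<Longrightarrow> norm y \<le> C" using compact_imp_bounded bounded_iff by metis
    \<comment> \<open>The integral formula for \<open>bind\<close> asks for a function bounded
      everywhere, while \<open>f\<close> is known to be bounded on \<open>E\<close> only.\<close>
    define f' where "f' z = indicator E z * f z" for z
    have [measurable]: "f' \<in> borel_measurable borel" unfolding f'_def by measurable
    have eq: "(\<integral>z. f z \<partial>\<rho>) = (\<integral>z. f' z \<partial>\<rho>)" if \<rho>: "\<rho> \<in> prob_measures_on E" for \<rho>
    proof -
      note rD = prob_measures_onD[OF \<rho> compact_imp_closed[OF E]]
      have [measurable_cong]: "sets \<rho> = sets borel" by (rule rD)
      show ?thesis by (rule integral_cong_AE) (use rD(3) in \<open>auto simp: f'_def elim: eventually_mono\<close>)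
    qed
    have "(\<integral>z. f' z \<partial>\<kappa>) = (\<integral>b. (\<integral>z. f' z \<partial>N b) \<partial>measure_pmf (bernoulli_pmf t))"
      unfolding \<kappa>_def
    proof (rule integral_bind[OF _ _ N_meas, where B = "\<bar>C\<bar>" and B' = 1])
      show "\<bar>f' x\<bar> \<le> \<bar>C\<bar>" for x using C[of "f x"] by (auto simp: f'_def split: split_indicator)
      show "finite_measure (measure_pmf (bernoulli_pmf t))" by unfold_locales simp
      show "AE b in measure_pmf (bernoulli_pmf t). emeasure (N b) (space (N b)) \<le> ennreal 1"
        using prob_space.emeasure_space_1[OF N_prob(1)] by simp
    qed auto
    also have "\<dots> = (1 - t) * (\<integral>z. f' z \<partial>\<mu>) + t * (\<integral>z. f' z \<partial>\<nu>)"
      using t by (subst integral_measure_pmf[of UNIV]) (auto simp: UNIV_bool N_def)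
    finally show "(\<integral>z. f z \<partial>\<kappa>) = (1 - t) * (\<integral>z. f z \<partial>\<mu>) + t * (\<integral>z. f z \<partial>\<nu>)"
      using eq[OF \<kappa>] eq[OF \<mu>] eq[OF \<nu>] by simp
  qed
qed

lemma double_integral_mixture:
  assumes \<mu>: "\<mu> \<in> prob_measures_on E" and \<nu>: "\<nu> \<in> prob_measures_on E" and \<kappa>: "\<kappa> \<in> prob_measures_on E"
    and E: "compact E"
    and mix: "\<And>f :: complex \<Rightarrow> real. continuous_on UNIV f \<Longrightarrow> (\<integral>z. f z \<partial>\<kappa>) = (1 - t) * (\<integral>z. f z \<partial>\<mu>) + t * (\<integral>z. f z \<partial>\<nu>)"
    and k: "continuous_on UNIV (\<lambda>p. k (fst p) (snd p) :: real)" and sym: "\<And>z w. k z w = k w z"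
  shows "double_integral k \<kappa> \<kappa> = (1 - t)\<^sup>2 * double_integral k \<mu> \<mu>
    + 2 * t * (1 - t) * double_integral k \<mu> \<nu> + t\<^sup>2 * double_integral k \<nu> \<nu>"
proof -
  have kz: "continuous_on UNIV (k z)" for z
    by (rule continuous_on_section[OF k])
  define a where "a z = (\<integral>w. k z w \<partial>\<mu>)" for z
  define b where "b z = (\<integral>w. k z w \<partial>\<nu>)" for z
  have ca: "continuous_on UNIV a" and cb: "continuous_on UNIV b"
    unfolding a_def b_def by (intro continuous_integral_kernel[OF _ E k] \<mu> \<nu>)+
  note it = double_integral_iterated(1)[OF _ _ E k]
  note i = integrable_continuous_prob_measures[OF _ E]
  have "double_integral k \<kappa> \<kappa> = (\<integral>z. (1 - t) * a z + t * b z \<partial>\<kappa>)"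
    unfolding it[OF \<kappa> \<kappa>] mix[OF kz] a_def b_def ..
  also have "\<dots> = (1 - t) * (\<integral>z. (1 - t) * a z + t * b z \<partial>\<mu>) + t * (\<integral>z. (1 - t) * a z + t * b z \<partial>\<nu>)"
    by (rule mix) (intro continuous_intros ca cb)
  also have "(\<integral>z. (1 - t) * a z + t * b z \<partial>\<mu>) = (1 - t) * double_integral k \<mu> \<mu> + t * double_integral k \<mu> \<nu>"
    unfolding it[OF \<mu> \<mu>] it[OF \<mu> \<nu>] a_def[symmetric] b_def[symmetric]
    using i[OF \<mu> ca] i[OF \<mu> cb] by simp
  also have "(\<integral>z. (1 - t) * a z + t * b z \<partial>\<nu>) = (1 - t) * double_integral k \<nu> \<mu> + t * double_integral k \<nu> \<nu>"
    unfolding it[OF \<nu> \<mu>] it[OF \<nu> \<nu>] a_def[symmetric] b_def[symmetric]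
    using i[OF \<nu> ca] i[OF \<nu> cb] by simp
  also have "double_integral k \<nu> \<mu> = double_integral k \<mu> \<nu>"
    by (rule double_integral_commute[OF \<nu> \<mu> E k sym])
  finally show ?thesis by (simp add: power2_eq_square algebra_simps)
qed

text \<open>The competitor for the minimizer: mass off \<open>T\<close> is withdrawn and the rest
  rescaled.\<close>

lemma conditioned_measure:
  fixes \<mu> :: "complex measure"
  assumes \<mu>: "\<mu> \<in> prob_measures_on E" and E: "compact E" and T: "T \<in> sets borel" and pos: "0 < measure \<mu> T"
  defines "\<nu> \<equiv> density \<mu> (\<lambda>x. ennreal (indicator T x / measure \<mu> T))"
  shows "\<nu> \<in> prob_measures_on E"
    and "\<And>f :: complex \<Rightarrow> real. f \<in> borel_measurable borel \<Longrightarrow>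
      (\<integral>z. f z \<partial>\<nu>) = (\<integral>z. indicator T z * f z \<partial>\<mu>) / measure \<mu> T"
proof -
  note mD = prob_measures_onD[OF \<mu> compact_imp_closed[OF E]]
  interpret M: prob_space \<mu> by (rule mD)
  note [measurable] = T
  have [measurable_cong]: "sets \<mu> = sets borel" by (rule mD)
  have sp: "space \<mu> = UNIV" using sets_eq_imp_space_eq[OF mD(2)] by simp
  have "emeasure \<nu> (space \<nu>) = (\<integral>\<^sup>+x. ennreal (indicator T x / measure \<mu> T) \<partial>\<mu>)"
    unfolding \<nu>_def by (subst emeasure_density) (auto simp: sp)
  also have "\<dots> = (\<integral>\<^sup>+x. ennreal (1 / measure \<mu> T) * indicator T x \<partial>\<mu>)"
    by (intro nn_integral_cong) (auto split: split_indicator)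
  also have "\<dots> = ennreal (1 / measure \<mu> T) * emeasure \<mu> T"
    by (rule nn_integral_cmult_indicator) (simp add: mD)
  also have "\<dots> = 1"
    using pos by (simp add: M.emeasure_eq_measure flip: ennreal_mult)
  finally have p: "prob_space \<nu>" by (rule prob_spaceI)
  have "AE z in \<nu>. z \<in> E"
    unfolding \<nu>_def by (subst AE_density) (use mD(3) in \<open>auto elim: eventually_mono\<close>)
  then show "\<nu> \<in> prob_measures_on E"
    by (intro prob_measures_onI p compact_imp_closed[OF E]) (auto simp: \<nu>_def mD)
  fix f :: "complex \<Rightarrow> real" assume [measurable]: "f \<in> borel_measurable borel"
  show "(\<integral>z. f z \<partial>\<nu>) = (\<integral>z. indicator T z * f z \<partial>\<mu>) / measure \<mu> T"
    unfolding \<nu>_def by (subst integral_real_density) auto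
qed

section \<open>Variational inequalities at the minimizer\<close>

locale energy_minimizer =
  fixes E :: "complex set" and V :: real and \<mu> :: "complex measure"
  assumes compact_E: "compact E" and min_energy: "min_energy E = ereal V"
    and in_E: "\<mu> \<in> prob_measures_on E" and energy_le: "log_energy \<mu> \<le> ereal V"
begin

lemma closed_E: "closed E" by (rule compact_imp_closed[OF compact_E])

sublocale prob_space \<mu> by (rule prob_measures_onD(1)[OF in_E closed_E])

lemma sets_\<mu>: "sets \<mu> = sets borel" by (rule prob_measures_onD(2)[OF in_E closed_E])

declare sets_\<mu> [measurable_cong]

lemma space_\<mu>: "space \<mu> = UNIV" using sets_eq_imp_space_eq[OF sets_\<mu>] by simp

lemma AE_E: "AE z in \<mu>. z \<in> E" by (rule prob_measures_onD(3)[OF in_E closed_E])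

lemma reg_energy_le: "reg_energy n \<mu> \<mu> \<le> V"
  using log_energy_le_iff[OF in_E compact_E] energy_le by simp

lemma min_energy_le_bound:
  assumes "\<kappa> \<in> prob_measures_on E" "\<And>n. reg_energy n \<kappa> \<kappa> \<le> c"
  shows "V \<le> c"
proof -
  have "ereal V \<le> log_energy \<kappa>" unfolding min_energy[symmetric] min_energy_def by (rule INF_lower[OF assms(1)])
  also have "\<dots> \<le> ereal c" using log_energy_le_iff[OF assms(1) compact_E] assms(2) by simp
  finally show ?thesis by simp
qed

text \<open>First variation: the energy of (1 - t) \<mu> + t \<nu> is at least \<open>V\<close> for
  every small t, and the coefficient of t is governed by the mutual energy. The finite bound
  \<open>W\<close> makes the quadratic term negligible.\<close>

lemma mutual_energy_ge:
  assumes \<nu>: "\<nu> \<in> prob_measures_on E" and W: "\<And>n. reg_energy n \<nu> \<nu> \<le> W" and X: "\<And>n. reg_energy n \<mu> \<nu> \<le> X"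
  shows "V \<le> X"
proof -
  have ineq: "(2 - t) * V \<le> 2 * (1 - t) * X + t * W" if t: "0 < t" "t < 1" for t
  proof -
    obtain \<kappa> where \<kappa>: "\<kappa> \<in> prob_measures_on E" and
      mix: "\<And>f :: complex \<Rightarrow> real. continuous_on UNIV f \<Longrightarrow> (\<integral>z. f z \<partial>\<kappa>) = (1 - t) * (\<integral>z. f z \<partial>\<mu>) + t * (\<integral>z. f z \<partial>\<nu>)"
      using mixture_exists[OF in_E \<nu> compact_E, of t] t by (metis less_imp_le)
    have "reg_energy n \<kappa> \<kappa> \<le> (1 - t)\<^sup>2 * V + 2 * t * (1 - t) * X + t\<^sup>2 * W" for n
    proof -
      have "reg_energy n \<kappa> \<kappa> = (1 - t)\<^sup>2 * reg_energy n \<mu> \<mu> + 2 * t * (1 - t) * reg_energy n \<mu> \<nu> + t\<^sup>2 * reg_energy n \<nu> \<nu>"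
        by (rule double_integral_mixture[OF in_E \<nu> \<kappa> compact_E mix continuous_reg_log reg_log_commute]) simp_all
      also have "\<dots> \<le> (1 - t)\<^sup>2 * V + 2 * t * (1 - t) * X + t\<^sup>2 * W"
        using t by (intro add_mono mult_left_mono reg_energy_le W X) auto
      finally show ?thesis .
    qed
    then have "V \<le> (1 - t)\<^sup>2 * V + 2 * t * (1 - t) * X + t\<^sup>2 * W" by (rule min_energy_le_bound[OF \<kappa>])
    \<comment> \<open>Uses 1 - (1 - t)^2 = t (2 - t); a factor t can then be cancelled before t
      tends to 0.\<close>
    then have "t * ((2 - t) * V) \<le> t * (2 * (1 - t) * X + t * W)"
      by (simp add: power2_eq_square algebra_simps)
    then show ?thesis using t by simp
  qed
  have "((\<lambda>t. (2 - t) * V) \<longlongrightarrow> (2 - 0) * V) (at_right 0)"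
    by (intro tendsto_intros)
  moreover have "((\<lambda>t. 2 * (1 - t) * X + t * W) \<longlongrightarrow> 2 * (1 - 0) * X + 0 * W) (at_right 0)"
    by (intro tendsto_intros)
  moreover have "\<forall>\<^sub>F t in at_right 0. (2 - t) * V \<le> 2 * (1 - t) * X + t * W"
    using ineq by (auto simp: eventually_at_right_field intro!: exI[of _ 1])
  ultimately have "(2 - 0) * V \<le> 2 * (1 - 0) * X + 0 * W"
    by (intro tendsto_le[of "at_right 0"]) auto
  then show ?thesis by simp
qed

text \<open>A positive \<open>c\<close> would push the mutual energy of two minimizers below
  \<open>V\<close> by \<open>c / 2\<close>, uniformly in the regularisation, against the first
  variation.\<close>

lemma energy_minimizer_unique:
  assumes \<nu>: "\<nu> \<in> prob_measures_on E" and le: "log_energy \<nu> \<le> ereal V"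
  shows "\<nu> = \<mu>"
proof -
  obtain c where c: "0 \<le> c" "c = 0 \<Longrightarrow> \<mu> = \<nu>"
    "\<And>d. 0 < d \<Longrightarrow> d \<le> 1 \<Longrightarrow> c \<le> quad_form (\<lambda>x. - ln (x + d) / 2) \<mu> \<nu>"
    using quad_form_log_lower_bound[OF in_E \<nu> compact_E] by metis
  have W: "reg_energy n \<nu> \<nu> \<le> V" for n using log_energy_le_iff[OF \<nu> compact_E] le by simp
  have "reg_energy n \<mu> \<nu> \<le> V - c / 2" for n
    using c(3)[of "inverse (real (Suc n))"] reg_energy_le[of n] W[of n]
    unfolding quad_form_reg_log by (simp add: field_simps)
  then have "V \<le> V - c / 2" by (rule mutual_energy_ge[OF \<nu> W])
  then show ?thesis using c by simp
qed

text \<open>If the potential exceeded \<open>V + e\<close> on a set of positive mass, its average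
  over the remaining set \<open>T\<close> would be below \<open>V\<close>, since the overall average
  is at most \<open>V\<close>. Conditioning \<mu> on \<open>T\<close> would then contradict the
  first variation.\<close>

lemma reg_potential_AE_le: "AE z in \<mu>. \<forall>n. reg_potential n \<mu> z \<le> V"
proof -
  obtain C where C: "0 \<le> C" "\<And>n z w. z \<in> E \<Longrightarrow> w \<in> E \<Longrightarrow> - C \<le> reg_log (inverse (real (Suc n))) z w"
    using reg_log_lower_bound[OF compact_E] by metis
  have contP: "continuous_on UNIV (reg_potential n \<mu>)" for n
    by (rule continuous_reg_potential[OF in_E compact_E])
  have [measurable]: "reg_potential n \<mu> \<in> borel_measurable borel" for n
    by (rule borel_measurable_continuous_onI[OF contP])
  have intP: "integrable \<mu> (reg_potential n \<mu>)" for n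
    by (rule integrable_continuous_prob_measures[OF in_E compact_E contP])
  have energy: "reg_energy n \<mu> \<mu> = (\<integral>z. reg_potential n \<mu> z \<partial>\<mu>)" for n
    unfolding reg_potential_def
    by (rule double_integral_iterated(1)[OF in_E in_E compact_E continuous_reg_log]) simp
  have "AE z in \<mu>. reg_potential n \<mu> z \<le> V + e" if e: "0 < e" for n e
  proof (rule ccontr)
    assume not: "\<not> (AE z in \<mu>. reg_potential n \<mu> z \<le> V + e)"
    define T where "T = {z. reg_potential n \<mu> z \<le> V + e}"
    define p where "p = prob T"
    have T[measurable]: "T \<in> sets borel" unfolding T_def by measurable
    have "prob T \<noteq> 1"
      using not prob_eq_1[of T] by (auto simp: T_def sets_\<mu>[symmetric] simp flip: sets_\<mu>)
    then have p1: "p < 1" unfolding p_def using prob_le_1[of T] by linarith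
    have split: "(\<integral>z. indicator T z * reg_potential m \<mu> z \<partial>\<mu>) \<le> V - (1 - p) * (V + e)" if "n \<le> m" for m
    proof -
      have ge: "V + e \<le> reg_potential m \<mu> z" if "z \<notin> T" for z
      proof -
        have "reg_potential n \<mu> z \<le> reg_potential m \<mu> z"
          unfolding reg_potential_def
          by (intro integral_mono reg_log_inverse_mono \<open>n \<le> m\<close>
            integrable_continuous_prob_measures[OF in_E compact_E] continuous_on_section[OF continuous_reg_log]) auto
        then show ?thesis using that unfolding T_def by auto
      qed
      have i1: "integrable \<mu> (\<lambda>z. indicator T z * reg_potential m \<mu> z)"
        using integrable_mult_indicator[OF _ intP, of T m] T by (simp add: sets_\<mu>)
      have i2: "integrable \<mu> (\<lambda>z. indicator (- T) z * (V + e))"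
        using T by (intro integrable_mult_left integrable_real_indicator) (auto simp: sets_\<mu> emeasure_eq_measure)
      have "(\<integral>z. indicator T z * reg_potential m \<mu> z \<partial>\<mu>) + (1 - p) * (V + e)
        = (\<integral>z. indicator T z * reg_potential m \<mu> z \<partial>\<mu>) + (\<integral>z. indicator (- T) z * (V + e) \<partial>\<mu>)"
      proof -
        have "prob (- T) = 1 - p" using prob_compl[of T] T by (simp add: p_def space_\<mu> sets_\<mu> Compl_eq_Diff_UNIV)
        then show ?thesis using T by (simp add: space_\<mu>)
      qed
      also have "\<dots> = (\<integral>z. indicator T z * reg_potential m \<mu> z + indicator (- T) z * (V + e) \<partial>\<mu>)"
        using i1 i2 by simp
      also have "\<dots> \<le> (\<integral>z. reg_potential m \<mu> z \<partial>\<mu>)"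
        by (intro integral_mono Bochner_Integration.integrable_add i1 i2 intP)
           (use ge in \<open>auto split: split_indicator\<close>)
      also have "\<dots> \<le> V" using reg_energy_le[of m] unfolding energy .
      finally show ?thesis by simp
    qed
    \<comment> \<open>For p = 0 the potential would exceed \<open>V + e\<close> almost everywhere
      and the energy would exceed \<open>V\<close>.\<close>
    have p0: "0 < p"
    proof (rule ccontr)
      assume "\<not> 0 < p"
      then have "prob T = 0" unfolding p_def using measure_nonneg[of \<mu> T] by linarith
      then have "AE z in \<mu>. z \<notin> T"
        using T by (subst (asm) prob_eq_0) (auto simp: sets_\<mu>)
      then have "(\<integral>z. indicator T z * reg_potential n \<mu> z \<partial>\<mu>) = 0"
        by (intro integral_eq_zero_AE) (auto elim: eventually_mono)
      moreover have "p = 0" using \<open>prob T = 0\<close> by (simp add: p_def)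
      ultimately show False using split[of n] e by simp
    qed
    define \<nu> where "\<nu> = density \<mu> (\<lambda>x. ennreal (indicator T x / measure \<mu> T))"
    note cm = conditioned_measure[OF in_E compact_E T, folded p_def, OF p0, unfolded p_def, folded \<nu>_def]
    have \<nu>: "\<nu> \<in> prob_measures_on E" by (rule cm(1))
    have int\<nu>: "(\<integral>z. f z \<partial>\<nu>) = (\<integral>z. indicator T z * f z \<partial>\<mu>) / p" if "f \<in> borel_measurable borel" for f :: "complex \<Rightarrow> real"
      unfolding p_def by (rule cm(2)[OF that])
    have int\<nu>_le: "(\<integral>z. f z \<partial>\<nu>) \<le> (\<integral>z. f z \<partial>\<mu>) / p"
      if f: "continuous_on UNIV f" and nonneg: "\<And>z. z \<in> E \<Longrightarrow> 0 \<le> f z" for f :: "complex \<Rightarrow> real"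
    proof -
      have i: "integrable \<mu> f" by (rule integrable_continuous_prob_measures[OF in_E compact_E f])
      have "(\<integral>z. indicator T z * f z \<partial>\<mu>) \<le> (\<integral>z. f z \<partial>\<mu>)"
      proof (rule integral_mono_AE[OF _ i])
        show "integrable \<mu> (\<lambda>z. indicator T z * f z)"
          using integrable_mult_indicator[OF _ i, of T] T by (simp add: sets_\<mu>)
        show "AE z in \<mu>. indicator T z * f z \<le> f z"
          using AE_E by eventually_elim (use nonneg in \<open>auto split: split_indicator\<close>)
      qed
      then show ?thesis unfolding int\<nu>[OF borel_measurable_continuous_onI[OF f]]
        using p0 by (simp add: divide_right_mono)
    qed
    interpret N: prob_space \<nu> using \<nu> by (simp add: prob_measures_on_def)
    \<comment> \<open>Adding \<open>C\<close> makes the kernel nonnegative on \<open>E\<close>, so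
      that restricting each of the two variables to \<open>T\<close> costs only a factor 1 /
      p.\<close>
    have W: "reg_energy m \<nu> \<nu> \<le> (V + C) / p / p" for m
    proof -
      define k where "k z w = reg_log (inverse (real (Suc m))) z w + C" for z w
      have ck: "continuous_on UNIV (\<lambda>p. k (fst p) (snd p))"
        unfolding k_def by (intro continuous_intros continuous_reg_log) simp
      have k0: "0 \<le> k z w" if "z \<in> E" "w \<in> E" for z w using C(2)[OF that, of m] by (simp add: k_def)
      have nn: "0 \<le> (\<integral>w. k z w \<partial>\<rho>)" if "z \<in> E" "\<rho> \<in> prob_measures_on E" for z \<rho>
        using prob_measures_onD(3)[OF that(2) closed_E] k0[OF that(1)]
        by (intro integral_nonneg_AE) (auto elim: eventually_mono)
      have shift: "double_integral k \<rho> \<rho>' = reg_energy m \<rho> \<rho>' + C"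
        if \<rho>: "\<rho> \<in> prob_measures_on E" and \<rho>': "\<rho>' \<in> prob_measures_on E" for \<rho> \<rho>'
      proof -
        interpret R: prob_space \<rho> using \<rho> by (simp add: prob_measures_on_def)
        interpret R': prob_space \<rho>' using \<rho>' by (simp add: prob_measures_on_def)
        interpret RR: pair_prob_space \<rho> \<rho>' ..
        have "integrable (\<rho> \<Otimes>\<^sub>M \<rho>') (\<lambda>p. reg_log (inverse (real (Suc m))) (fst p) (snd p))"
          by (rule integrable_pair_continuous[OF \<rho> \<rho>' compact_E continuous_reg_log]) simp
        then show ?thesis unfolding double_integral_def k_def by (simp add: RR.P.prob_space)
      qed
      have "double_integral k \<nu> \<nu> = (\<integral>z. (\<integral>w. k z w \<partial>\<nu>) \<partial>\<nu>)"
        by (rule double_integral_iterated(1)[OF \<nu> \<nu> compact_E ck])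
      also have "\<dots> \<le> (\<integral>z. (\<integral>w. k z w \<partial>\<nu>) \<partial>\<mu>) / p"
        by (intro int\<nu>_le continuous_integral_kernel[OF \<nu> compact_E ck] nn \<nu>)
      also have "(\<integral>z. (\<integral>w. k z w \<partial>\<nu>) \<partial>\<mu>) = double_integral k \<mu> \<nu>"
        by (rule double_integral_iterated(1)[OF in_E \<nu> compact_E ck, symmetric])
      also have "\<dots> = double_integral k \<nu> \<mu>"
        by (rule double_integral_commute[OF in_E \<nu> compact_E ck]) (simp add: k_def reg_log_commute)
      also have "\<dots> = (\<integral>z. (\<integral>w. k z w \<partial>\<mu>) \<partial>\<nu>)"
        by (rule double_integral_iterated(1)[OF \<nu> in_E compact_E ck])
      also have "\<dots> / p \<le> (\<integral>z. (\<integral>w. k z w \<partial>\<mu>) \<partial>\<mu>) / p / p"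
        using p0 by (intro divide_right_mono int\<nu>_le continuous_integral_kernel[OF in_E compact_E ck] nn in_E) auto
      also have "(\<integral>z. (\<integral>w. k z w \<partial>\<mu>) \<partial>\<mu>) = double_integral k \<mu> \<mu>"
        by (rule double_integral_iterated(1)[OF in_E in_E compact_E ck, symmetric])
      also have "\<dots> \<le> V + C" using shift[OF in_E in_E] reg_energy_le[of m] by simp
      finally have "double_integral k \<nu> \<nu> \<le> (V + C) / p / p" using p0 by (simp add: divide_right_mono)
      then show ?thesis using shift[OF \<nu> \<nu>] C(1) by simp
    qed
    have X: "reg_energy m \<mu> \<nu> \<le> (V - (1 - p) * (V + e)) / p" for m
    proof -
      \<comment> \<open>Raising the index to at least \<open>n\<close> makes the bound
        \<open>split\<close> available; the energy only grows.\<close>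
      have "reg_energy m \<mu> \<nu> \<le> reg_energy (max n m) \<mu> \<nu>"
        by (rule reg_energy_mono[OF in_E \<nu> compact_E]) simp
      also have "\<dots> = (\<integral>w. (\<integral>z. reg_log (inverse (real (Suc (max n m)))) z w \<partial>\<mu>) \<partial>\<nu>)"
        by (rule double_integral_iterated(2)[OF in_E \<nu> compact_E continuous_reg_log]) simp
      also have "\<dots> = (\<integral>w. reg_potential (max n m) \<mu> w \<partial>\<nu>)"
        unfolding reg_potential_def by (subst reg_log_commute) (rule refl)
      also have "\<dots> = (\<integral>z. indicator T z * reg_potential (max n m) \<mu> z \<partial>\<mu>) / p"
        by (rule int\<nu>) measurable
      also have "\<dots> \<le> (V - (1 - p) * (V + e)) / p"
        using p0 split[of "max n m"] by (intro divide_right_mono) auto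
      finally show ?thesis .
    qed
    have "V \<le> (V - (1 - p) * (V + e)) / p" by (rule mutual_energy_ge[OF \<nu> W X])
    then have "(1 - p) * e \<le> 0" using p0 by (simp add: field_simps)
    then show False using p1 e by (simp add: mult_le_0_iff)
  qed
  then have "AE z in \<mu>. \<forall>n j. reg_potential n \<mu> z \<le> V + inverse (real (Suc j))"
    by (simp add: AE_all_countable del: of_nat_Suc)
  then show ?thesis
  proof eventually_elim
    case (elim z)
    have "(\<lambda>j. V + inverse (real (Suc j))) \<longlonglongrightarrow> V + 0" by (intro tendsto_intros inverse_Suc_tendsto)
    then have "reg_potential n \<mu> z \<le> V + 0" for n
      by (rule LIMSEQ_le_const) (use elim in auto)
    then show ?case by simp
  qed
qed

end

section \<open>Frostman's theorem\<close>

context energy_minimizer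
begin

text \<open>A compact set of full measure on which the bound holds at every point, not just almost
  everywhere; it plays the role of the support in the maximum principle.\<close>

definition carrier_set :: "complex set" where
  "carrier_set = E \<inter> (\<Inter>n. {z. reg_potential n \<mu> z \<le> V})"

lemma compact_carrier: "compact carrier_set"
proof -
  have "closed {z. reg_potential n \<mu> z \<le> V}" for n
    by (rule closed_Collect_le[OF continuous_reg_potential[OF in_E compact_E] continuous_on_const])
  then show ?thesis unfolding carrier_set_def by (intro compact_Int_closed compact_E closed_INT) auto
qed

lemma AE_carrier: "AE z in \<mu>. z \<in> carrier_set"
  using AE_E reg_potential_AE_le by eventually_elim (auto simp: carrier_set_def)

lemma carrier_nonempty: "carrier_set \<noteq> {}"
proof
  assume "carrier_set = {}"
  then have "AE z in \<mu>. False" using AE_carrier by simp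
  then show False by simp
qed

lemma carrier_subset: "carrier_set \<subseteq> E" by (auto simp: carrier_set_def)

lemma reg_potential_carrier_le: "z \<in> carrier_set \<Longrightarrow> reg_potential n \<mu> z \<le> V"
  by (auto simp: carrier_set_def)

lemma integrable_reg_log: "integrable \<mu> (reg_log (inverse (real (Suc n))) z)"
  by (rule integrable_continuous_prob_measures[OF in_E compact_E
    continuous_on_section[OF continuous_reg_log]]) simp

text \<open>An atom of mass m at \<open>z\<close> contributes m ln (n + 1) / 2 to the regularised
  potential at \<open>z\<close>, while the rest is bounded below; on the carrier this contradicts
  the bound \<open>V\<close>.\<close>

lemma no_atoms: "AE t in \<mu>. t \<noteq> z"
proof (cases "z \<in> carrier_set")
  case False
  then show ?thesis using AE_carrier by (auto elim: eventually_mono)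
next
  case True
  then have zE: "z \<in> E" using carrier_subset by auto
  obtain C where C: "0 \<le> C" "\<And>n z w. z \<in> E \<Longrightarrow> w \<in> E \<Longrightarrow> - C \<le> reg_log (inverse (real (Suc n))) z w"
    using reg_log_lower_bound[OF compact_E] by metis
  have bound: "prob {z} * (ln (real (Suc n)) / 2 + C) - C \<le> V" for n
  proof -
    have i: "integrable \<mu> (\<lambda>t. indicator {z} t * (ln (real (Suc n)) / 2 + C) - C)"
      by (intro Bochner_Integration.integrable_diff integrable_mult_left integrable_real_indicator integrable_const)
        (auto simp: sets_\<mu> emeasure_eq_measure)
    have "prob {z} * (ln (real (Suc n)) / 2 + C) - C = (\<integral>t. indicator {z} t * (ln (real (Suc n)) / 2 + C) - C \<partial>\<mu>)"
    proof -
      have "integrable \<mu> (\<lambda>t. indicator {z} t * (ln (real (Suc n)) / 2 + C))"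
        by (intro integrable_mult_left integrable_real_indicator) (auto simp: sets_\<mu> emeasure_eq_measure)
      then show ?thesis by (simp add: prob_space space_\<mu> prob_space[unfolded space_\<mu>])
    qed
    also have "\<dots> \<le> reg_potential n \<mu> z"
      unfolding reg_potential_def
    proof (rule integral_mono_AE[OF i integrable_reg_log])
      show "AE t in \<mu>. indicator {z} t * (ln (real (Suc n)) / 2 + C) - C \<le> reg_log (inverse (real (Suc n))) z t"
        using AE_E
      proof eventually_elim
        case (elim t)
        show ?case
        proof (cases "t = z")
          case True
          then show ?thesis by (simp add: reg_log_def ln_inverse del: of_nat_Suc)
        next
          case False
          then show ?thesis using C(2)[OF zE elim, of n] by simp
        qed
      qed
    qed
    also have "\<dots> \<le> V" by (rule reg_potential_carrier_le[OF True])
    finally show ?thesis .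
  qed
  have "prob {z} = 0"
  proof (rule ccontr)
    assume "prob {z} \<noteq> 0"
    then have pos: "0 < prob {z}" by (simp add: zero_less_measure_iff)
    obtain n :: nat where n: "exp (2 * ((\<bar>V\<bar> + C + 1) / prob {z})) < real n" using reals_Archimedean2 by blast
    have "exp (2 * ((\<bar>V\<bar> + C + 1) / prob {z})) < real (Suc n)" using n by simp
    then have "ln (exp (2 * ((\<bar>V\<bar> + C + 1) / prob {z}))) < ln (real (Suc n))"
      by (subst ln_less_cancel_iff) auto
    then have "2 * ((\<bar>V\<bar> + C + 1) / prob {z}) < ln (real (Suc n))" by (simp only: ln_exp)
    then have "(\<bar>V\<bar> + C + 1) / prob {z} < ln (real (Suc n)) / 2 + C" using C by linarith
    then have "\<bar>V\<bar> + C + 1 < prob {z} * (ln (real (Suc n)) / 2 + C)" using pos by (simp add: field_simps)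
    then show False using bound[of n] by linarith
  qed
  then show ?thesis by (subst (asm) prob_eq_0) (auto simp: sets_\<mu>)
qed

text \<open>Maria's maximum principle. Near a boundary point the potential is compared with its value at the
  nearest point of the carrier: distances to the carrier at most double, so the excess is bounded,
  and it vanishes in the limit off a single point, which carries no mass.\<close>

lemma log_potential_le_off_carrier:
  assumes "w \<notin> carrier_set"
  shows "log_potential \<mu> w \<le> V"
proof (rule field_le_epsilon)
  fix e :: real assume e: "0 < e"
  let ?F = carrier_set
  have closed_F: "closed ?F" using compact_carrier compact_imp_closed by blast
  note pot = prob_space_axioms sets_\<mu> compact_carrier AE_carrier
  define s where "s = V + e"
  \<comment> \<open>\<open>K\<close> is the superlevel set whose compactness the maximum principle
    demands; \<open>s\<close> lies strictly above \<open>V\<close> so that \<open>K\<close> cannot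
    accumulate at the carrier.\<close>
  define K where "K = {z \<in> - ?F. s \<le> log_potential \<mu> z}"
  obtain R where R: "\<And>z. z \<in> ?F \<Longrightarrow> cmod z \<le> R"
    using compact_imp_bounded[OF compact_carrier] by (auto simp: bounded_iff)
  have "bounded K"
    unfolding bounded_iff
  proof (intro exI ballI)
    fix z assume z: "z \<in> K"
    show "cmod z \<le> \<bar>R\<bar> + exp (- s)"
    proof (rule ccontr)
      assume "\<not> ?thesis"
      then have gt: "\<bar>R\<bar> + exp (- s) < cmod z" by simp
      then have Rz: "R < cmod z" by (smt (verit) exp_gt_zero)
      have "s \<le> - ln (cmod z - R)" using z log_potential_le_far[OF pot R Rz] unfolding K_def by auto
      then have "exp (ln (cmod z - R)) \<le> exp (- s)" by simp
      then have "cmod z - R \<le> exp (- s)" using Rz by simp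
      then show False using gt by linarith
    qed
  qed
  moreover have "closed K"
    unfolding closed_sequential_limits
  proof (intro allI impI, elim conjE)
    fix z z0 assume zK: "\<forall>k. z k \<in> K" and lim: "z \<longlonglongrightarrow> z0"
    show "z0 \<in> K"
    proof (cases "z0 \<in> ?F")
      case False
      then have "isCont (log_potential \<mu>) z0"
        using continuous_log_potential[OF pot] closed_F continuous_on_eq_continuous_at[of "- ?F"] by auto
      then have "(\<lambda>k. log_potential \<mu> (z k)) \<longlonglongrightarrow> log_potential \<mu> z0" using lim isCont_tendsto_compose by blast
      then have "s \<le> log_potential \<mu> z0" by (rule LIMSEQ_le_const) (use zK in \<open>auto simp: K_def\<close>)
      then show ?thesis using False by (simp add: K_def)
    next
      case True
      define z' where "z' k = closest_point ?F (z k)" for k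
      define D where "D k = cmod (z k - z' k)" for k
      have z'F: "z' k \<in> ?F" for k unfolding z'_def by (rule closest_point_in_set[OF closed_F carrier_nonempty])
      have zF: "z k \<notin> ?F" for k using zK by (auto simp: K_def)
      have D_le: "D k \<le> cmod (z k - t)" if "t \<in> ?F" for k t
        unfolding D_def z'_def using closest_point_le[OF closed_F that, of "z k"] by (simp add: dist_norm)
      have D_pos: "0 < D k" for k unfolding D_def using z'F zF by (metis eq_iff_diff_eq_0 zero_less_norm_iff)
      have "(\<lambda>k. cmod (z k - z0)) \<longlonglongrightarrow> 0" using lim by (simp add: LIM_zero tendsto_norm_zero)
      then have "D \<longlonglongrightarrow> 0"
        by (rule tendsto_sandwich[OF _ _ tendsto_const, rotated 2]) (use D_le[OF True] D_pos in \<open>auto simp: less_imp_le\<close>)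
      then have "(\<lambda>k. z k - z' k) \<longlonglongrightarrow> 0" unfolding D_def by (rule tendsto_norm_zero_cancel)
      then have "(\<lambda>k. z k - (z k - z' k)) \<longlonglongrightarrow> z0 - 0" by (intro tendsto_diff lim)
      then have lim': "z' \<longlonglongrightarrow> z0" by simp
      \<comment> \<open>The regularisation at \<open>z' k\<close> is chosen finer than the squared
        distance \<open>D k\<close> to the carrier, so it neither spoils the ratio of squared
        distances nor survives in the limit.\<close>
      have "\<exists>n. inverse (real (Suc n)) < (D k)\<^sup>2 * inverse (real (Suc k))" for k
        using D_pos[of k] by (intro reals_Archimedean) simp
      then obtain n where n: "\<And>k. inverse (real (Suc (n k))) < (D k)\<^sup>2 * inverse (real (Suc k))" by metis
      define d where "d k = inverse (real (Suc (n k)))" for k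
      have d_pos: "0 < d k" for k by (simp add: d_def)
      have d_le: "d k \<le> (D k)\<^sup>2" for k
      proof -
        have "(D k)\<^sup>2 * inverse (real (Suc k)) \<le> (D k)\<^sup>2 * 1"
          by (intro mult_left_mono) (auto simp: inverse_le_1_iff)
        then show ?thesis using n[of k] unfolding d_def by linarith
      qed
      have d_lim: "d \<longlonglongrightarrow> 0"
      proof (rule tendsto_sandwich[OF _ _ tendsto_const])
        show "(\<lambda>k. (D k)\<^sup>2) \<longlonglongrightarrow> 0" using tendsto_power[OF \<open>D \<longlonglongrightarrow> 0\<close>, of 2] by simp
      qed (use d_pos d_le in \<open>auto simp: less_imp_le\<close>)
      \<comment> \<open>\<open>f k\<close> bounds the excess of the kernel at \<open>z k\<close>
        over the regularised kernel at \<open>z' k\<close>. Doubled distance and regularisation give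
        a ratio of at most 2^2 + 1 = 5.\<close>
      define f where "f k t = max 0 (ln (((cmod (z' k - t))\<^sup>2 + d k) / (cmod (z k - t))\<^sup>2) / 2)" for k t
      have [measurable]: "f k \<in> borel_measurable borel" for k unfolding f_def by measurable
      have f_bound: "f k t \<le> ln 5" if t: "t \<in> ?F" for k t
      proof -
        have pos: "0 < cmod (z k - t)" using D_le[OF t, of k] D_pos[of k] by linarith
        have "cmod (z' k - t) \<le> cmod (z k - t) + D k"
          unfolding D_def using norm_triangle_ineq4[of "z k - t" "z k - z' k"] by simp
        then have "cmod (z' k - t) \<le> 2 * cmod (z k - t)" using D_le[OF t, of k] by linarith
        then have "(cmod (z' k - t))\<^sup>2 \<le> (2 * cmod (z k - t))\<^sup>2" by (intro power_mono) auto
        moreover have "d k \<le> (cmod (z k - t))\<^sup>2"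
          using d_le[of k] power_mono[OF D_le[OF t, of k], of 2] D_pos[of k] by linarith
        ultimately have "((cmod (z' k - t))\<^sup>2 + d k) / (cmod (z k - t))\<^sup>2 \<le> 5"
          using pos by (simp add: field_simps)
        moreover have "0 < ((cmod (z' k - t))\<^sup>2 + d k) / (cmod (z k - t))\<^sup>2"
          using pos d_pos[of k] by (intro divide_pos_pos add_nonneg_pos) auto
        ultimately have "ln (((cmod (z' k - t))\<^sup>2 + d k) / (cmod (z k - t))\<^sup>2) \<le> ln 5" by (intro ln_mono) auto
        moreover have "0 \<le> ln (5::real)" by simp
        ultimately show ?thesis unfolding f_def by (intro max.boundedI) linarith+
      qed
      have "(\<lambda>k. \<integral>t. f k t \<partial>\<mu>) \<longlonglongrightarrow> (\<integral>t. 0 \<partial>\<mu>)"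
      proof (rule integral_dominated_convergence[where w = "\<lambda>_. ln 5"])
        show "AE t in \<mu>. (\<lambda>k. f k t) \<longlonglongrightarrow> 0"
          using no_atoms[of z0]
        proof eventually_elim
          case (elim t)
          then have "cmod (z0 - t) \<noteq> 0" by simp
          then have "(\<lambda>k. f k t) \<longlonglongrightarrow> max 0 (ln (((cmod (z0 - t))\<^sup>2 + 0) / (cmod (z0 - t))\<^sup>2) / 2)"
            unfolding f_def by (intro tendsto_intros lim lim' d_lim) auto
          then show ?case using \<open>cmod (z0 - t) \<noteq> 0\<close> by simp
        qed
        show "AE t in \<mu>. norm (f k t) \<le> ln 5" for k
          using AE_carrier by eventually_elim (use f_bound in \<open>auto simp: f_def\<close>)
      qed auto
      then have lim_f: "(\<lambda>k. V + (\<integral>t. f k t \<partial>\<mu>)) \<longlonglongrightarrow> V + 0" by (intro tendsto_add tendsto_const) simp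
      have "s \<le> V + (\<integral>t. f k t \<partial>\<mu>)" for k
      proof -
        have if': "integrable \<mu> (f k)"
          by (rule integrable_const_bound[where B = "ln 5"])
            (use AE_carrier f_bound in \<open>auto simp: f_def elim!: eventually_mono\<close>)
        have "s \<le> log_potential \<mu> (z k)" using zK by (auto simp: K_def)
        also have "\<dots> \<le> (\<integral>t. reg_log (d k) (z' k) t + f k t \<partial>\<mu>)"
          unfolding log_potential_def
        proof (rule integral_mono_AE)
          show "integrable \<mu> (\<lambda>t. - ln (cmod (z k - t)))"
            using integrable_ln_off_support[OF pot zF] by simp
          show "integrable \<mu> (\<lambda>t. reg_log (d k) (z' k) t + f k t)"
            unfolding d_def by (intro Bochner_Integration.integrable_add integrable_reg_log if')
          show "AE t in \<mu>. - ln (cmod (z k - t)) \<le> reg_log (d k) (z' k) t + f k t"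
            using AE_carrier
          proof eventually_elim
            case (elim t)
            have pos: "0 < cmod (z k - t)" using D_le[OF elim, of k] D_pos[of k] by linarith
            have pos': "0 < (cmod (z' k - t))\<^sup>2 + d k" using d_pos[of k] by (intro add_nonneg_pos) auto
            have "ln (((cmod (z' k - t))\<^sup>2 + d k) / (cmod (z k - t))\<^sup>2) = ln ((cmod (z' k - t))\<^sup>2 + d k) - 2 * ln (cmod (z k - t))"
              using pos pos' by (simp add: ln_div ln_realpow)
            then have "- ln (cmod (z k - t)) = reg_log (d k) (z' k) t
                + ln (((cmod (z' k - t))\<^sup>2 + d k) / (cmod (z k - t))\<^sup>2) / 2"
              unfolding reg_log_def by (simp add: field_simps)
            then show ?case unfolding f_def by linarith
          qed
        qed
        also have "\<dots> = reg_potential (n k) \<mu> (z' k) + (\<integral>t. f k t \<partial>\<mu>)"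
          unfolding reg_potential_def d_def using integrable_reg_log if' by simp
        also have "\<dots> \<le> V + (\<integral>t. f k t \<partial>\<mu>)" using reg_potential_carrier_le[OF z'F] by simp
        finally show ?thesis .
      qed
      then have "s \<le> V + 0" by (intro LIMSEQ_le_const[OF lim_f]) auto
      then show ?thesis using e by (simp add: s_def)
    qed
  qed
  ultimately have "compact K" by (simp add: compact_eq_bounded_closed)
  then have "log_potential \<mu> w < s"
    using mean_value_on_max_principle[OF _ mean_value_on_log_potential[OF pot], of s w] closed_F assms
    by (simp add: K_def open_Compl)
  then show "log_potential \<mu> w \<le> V + e" by (simp add: s_def)
qed

lemma reg_potential_le: "reg_potential n \<mu> z \<le> V"
proof (cases "z \<in> carrier_set")
  case False
  note pot = prob_space_axioms sets_\<mu> compact_carrier AE_carrier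
  have "reg_potential n \<mu> z \<le> log_potential \<mu> z"
    unfolding reg_potential_def log_potential_def
  proof (rule integral_mono_AE[OF integrable_reg_log])
    show "integrable \<mu> (\<lambda>t. - ln (cmod (z - t)))" using integrable_ln_off_support[OF pot False] by simp
    show "AE t in \<mu>. reg_log (inverse (real (Suc n))) z t \<le> - ln (cmod (z - t))"
      using no_atoms[of z] by eventually_elim (rule reg_log_le, auto)
  qed
  then show ?thesis using log_potential_le_off_carrier[OF False] by linarith
qed (rule reg_potential_carrier_le)

text \<open>Regularised potentials increase with \<open>n\<close> and stay below \<open>V\<close>,
  so monotone convergence yields integrability at every \<open>z\<close>, also on \<open>E\<close>;
  the diagonal is null because there are no atoms.\<close>

lemma
  shows integrable_ln_dist: "integrable \<mu> (\<lambda>t. ln (cmod (z - t)))"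
    and log_potential_le: "log_potential \<mu> z \<le> V"
proof -
  have mono: "incseq (\<lambda>n. reg_potential n \<mu> z)"
    unfolding incseq_def reg_potential_def by (auto intro!: integral_mono integrable_reg_log reg_log_inverse_mono simp del: of_nat_Suc)
  obtain x where x: "(\<lambda>n. reg_potential n \<mu> z) \<longlonglongrightarrow> x"
    by (rule incseq_convergent[OF mono, of V]) (use reg_potential_le in auto)
  have AEmono: "AE t in \<mu>. mono (\<lambda>n. reg_log (inverse (real (Suc n))) z t)"
    by (intro AE_I2 monoI reg_log_inverse_mono)
  have AElim: "AE t in \<mu>. (\<lambda>n. reg_log (inverse (real (Suc n))) z t) \<longlonglongrightarrow> - ln (cmod (z - t))"
    using no_atoms[of z] by eventually_elim (rule reg_log_tendsto, auto)
  note mc = integrable_reg_log AEmono AElim x[unfolded reg_potential_def]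
  have "integrable \<mu> (\<lambda>t. - ln (cmod (z - t)))"
    by (rule integrable_monotone_convergence[OF mc]) measurable
  then show "integrable \<mu> (\<lambda>t. ln (cmod (z - t)))" by simp
  have "log_potential \<mu> z = x"
    unfolding log_potential_def by (rule integral_monotone_convergence[OF mc]) measurable
  moreover have "x \<le> V" by (rule LIMSEQ_le_const2[OF x]) (use reg_potential_le in auto)
  ultimately show "log_potential \<mu> z \<le> V" by simp
qed

end

section \<open>Zeros of extremal polynomials\<close>

definition root_avg :: "complex poly \<Rightarrow> (complex \<Rightarrow> real) \<Rightarrow> real" where
  "root_avg p f = (\<Sum>t | poly p t = 0. real (order t p) * f t) / real (degree p)"

lemma sum_order_eq_degree:
  fixes p :: "complex poly"
  assumes "p \<noteq> 0"
  shows "(\<Sum>t | poly p t = 0. order t p) = degree p"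
  using size_proots_complex[of p] assms by (simp add: size_multiset_overloaded_eq)

lemma root_avg_mono:
  assumes "p \<noteq> 0" "\<And>t. poly p t = 0 \<Longrightarrow> f t \<le> g t"
  shows "root_avg p f \<le> root_avg p g"
  unfolding root_avg_def using assms by (intro divide_right_mono sum_mono mult_left_mono) auto

lemma root_avg_const:
  assumes "p \<noteq> 0" "degree p > 0"
  shows "root_avg p (\<lambda>t. c) = c"
proof -
  have "(\<Sum>t | poly p t = 0. real (order t p) * c) = real (\<Sum>t | poly p t = 0. order t p) * c"
    by (simp add: sum_distrib_right)
  then show ?thesis using assms sum_order_eq_degree[OF assms(1)] by (simp add: root_avg_def)
qed

lemma root_avg_diff: "root_avg p (\<lambda>t. f t - g t) = root_avg p f - root_avg p g"
  by (simp add: root_avg_def sum_subtractf algebra_simps diff_divide_distrib)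

lemma root_avg_add: "root_avg p (\<lambda>t. f t + g t) = root_avg p f + root_avg p g"
  by (simp add: root_avg_def sum.distrib algebra_simps add_divide_distrib)

lemma root_avg_cmult: "root_avg p (\<lambda>t. c * f t) = c * root_avg p f"
  by (simp add: root_avg_def sum_distrib_left algebra_simps)

text \<open>\<open>measure_of\<close> is informative only for a countably additive set function.
  Since \<open>distr\<close> is itself a \<open>measure_of\<close>, agreement of set functions with
  the uniform law on the multiset of roots settles this.\<close>

lemma zero_counting_measure_eq_distr:
  assumes p: "p \<noteq> 0" "degree p > 0"
  shows "zero_counting_measure p = distr (measure_pmf (pmf_of_multiset (proots p))) borel (\<lambda>x. x)"
proof -
  have ne: "proots p \<noteq> {#}" using size_proots_complex[of p] p by auto
  have "emeasure (measure_pmf (pmf_of_multiset (proots p))) A =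
      ennreal ((\<Sum>z\<in>{z \<in> A. poly p z = 0}. real (order z p)) / real (degree p))" for A
  proof -
    have fin: "finite {z. poly p z = 0}" using p poly_roots_finite by blast
    have "measure (measure_pmf (pmf_of_multiset (proots p))) A
      = measure (measure_pmf (pmf_of_multiset (proots p))) (A \<inter> {z. poly p z = 0})"
      using p ne by (subst measure_Int_set_pmf[symmetric]) simp
    also have "\<dots> = (\<Sum>z\<in>A \<inter> {z. poly p z = 0}. pmf (pmf_of_multiset (proots p)) z)"
      by (rule measure_measure_pmf_finite) (use fin in auto)
    also have "\<dots> = (\<Sum>z\<in>{z \<in> A. poly p z = 0}. real (order z p)) / real (degree p)"
      using p ne by (simp add: size_proots_complex sum_divide_distrib Int_def)
    finally show ?thesis by (simp add: measure_pmf.emeasure_eq_measure)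
  qed
  then show ?thesis unfolding zero_counting_measure_def distr_def by simp
qed

lemma
  assumes p: "p \<noteq> 0" "degree p > 0"
  shows prob_space_zero_counting: "prob_space (zero_counting_measure p)"
    and sets_zero_counting: "sets (zero_counting_measure p) = sets borel"
    and integral_zero_counting: "\<And>f :: complex \<Rightarrow> real. f \<in> borel_measurable borel \<Longrightarrow>
      (\<integral>z. f z \<partial>zero_counting_measure p) = root_avg p f"
proof -
  note eq = zero_counting_measure_eq_distr[OF p]
  show "prob_space (zero_counting_measure p)" "sets (zero_counting_measure p) = sets borel"
    unfolding eq by (auto intro!: measure_pmf.prob_space_distr)
  have ne: "proots p \<noteq> {#}" using size_proots_complex[of p] p by auto
  have fin: "finite {z. poly p z = 0}" using p poly_roots_finite by blast
  fix f :: "complex \<Rightarrow> real" assume f: "f \<in> borel_measurable borel"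
  have "(\<integral>z. f z \<partial>zero_counting_measure p) = (\<integral>z. f z \<partial>measure_pmf (pmf_of_multiset (proots p)))"
    unfolding eq by (rule integral_distr) (use f in auto)
  also have "\<dots> = (\<Sum>z | poly p z = 0. pmf (pmf_of_multiset (proots p)) z *\<^sub>R f z)"
    by (rule integral_measure_pmf[OF fin]) (use p ne in auto)
  also have "\<dots> = root_avg p f"
    using p ne by (simp add: root_avg_def size_proots_complex sum_divide_distrib)
  finally show "(\<integral>z. f z \<partial>zero_counting_measure p) = root_avg p f" .
qed

lemma ln_cmod_poly:
  fixes p :: "complex poly"
  assumes "p \<noteq> 0" "degree p > 0" "poly p z \<noteq> 0"
  shows "(ln (cmod (poly p z)) - ln (cmod (lead_coeff p))) / real (degree p) = root_avg p (\<lambda>t. ln (cmod (z - t)))"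
proof -
  have "poly p z = lead_coeff p * (\<Prod>t | poly p t = 0. (z - t) ^ order t p)"
    by (subst complex_poly_decompose[of p, symmetric]) (simp add: poly_prod)
  then have "cmod (poly p z) = cmod (lead_coeff p) * (\<Prod>t | poly p t = 0. cmod (z - t) ^ order t p)"
    by (simp add: norm_mult norm_power flip: prod_norm)
  moreover have pos: "0 < cmod (z - t) ^ order t p" if "poly p t = 0" for t
  proof -
    have "z \<noteq> t" using that assms by auto
    then show ?thesis by simp
  qed
  then have "0 < (\<Prod>t | poly p t = 0. cmod (z - t) ^ order t p)" by (intro prod_pos) auto
  ultimately have "ln (cmod (poly p z)) = ln (cmod (lead_coeff p)) + ln (\<Prod>t | poly p t = 0. cmod (z - t) ^ order t p)"
    using assms by (simp add: ln_mult_pos)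
  also have "ln (\<Prod>t | poly p t = 0. cmod (z - t) ^ order t p) = (\<Sum>t | poly p t = 0. ln (cmod (z - t) ^ order t p))"
    by (rule ln_prod[OF poly_roots_finite[OF assms(1)]]) (metis pos mem_Collect_eq less_irrefl)
  also have "\<dots> = (\<Sum>t | poly p t = 0. real (order t p) * ln (cmod (z - t)))"
  proof (rule sum.cong[OF refl])
    fix t assume "t \<in> {t. poly p t = 0}"
    then have "cmod (z - t) > 0" using assms by auto
    then show "ln (cmod (z - t) ^ order t p) = real (order t p) * ln (cmod (z - t))" by (simp add: ln_realpow)
  qed
  finally show ?thesis by (simp add: root_avg_def)
qed

lemma mean_value_on_ln_dist: "mean_value_on (- {t}) (\<lambda>z. ln (cmod (z - t)))"
  unfolding mean_value_on_def
proof (intro conjI allI impI)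
  show "continuous_on (- {t}) (\<lambda>z. ln (cmod (z - t)))" by (intro continuous_intros) auto
  fix z r assume r: "(0::real) < r" "cball z r \<subseteq> - {t}"
  then have "r < cmod (z - t)" by (auto simp: dist_norm)
  then show "(\<integral>x. ln (cmod (circlepath z r x - t)) \<partial>unit_interval_measure) = ln (cmod (z - t))"
    using circle_mean_ln_dist[OF r(1), of z t] by simp
qed

lemma mean_value_on_root_avg:
  assumes "p \<noteq> 0"
  shows "mean_value_on (- {t. poly p t = 0}) (\<lambda>z. root_avg p (\<lambda>t. ln (cmod (z - t))))"
proof -
  have "mean_value_on (- {t. poly p t = 0}) (\<lambda>z. inverse (real (degree p)) * (\<Sum>t | poly p t = 0. real (order t p) * ln (cmod (z - t))))"
    by (intro mean_value_on_cmult mean_value_on_sum mean_value_on_subset[OF mean_value_on_ln_dist]) auto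
  then show ?thesis unfolding root_avg_def by (simp add: field_simps)
qed

section \<open>Potential of the minimizer against zeros of polynomials\<close>

context energy_minimizer
begin

lemmas pot_E = prob_space_axioms sets_\<mu> compact_E AE_E

lemma mean_value_log_potential: "mean_value_on (- E) (log_potential \<mu>)"
  by (rule mean_value_on_log_potential[OF pot_E])

lemma bounded_E: obtains R where "0 < R" "\<And>z. z \<in> E \<Longrightarrow> cmod z < R"
proof -
  obtain R where "0 < R" "\<And>z. z \<in> E \<Longrightarrow> cmod z \<le> R"
    using compact_imp_bounded[OF compact_E] unfolding bounded_pos by blast
  then show thesis by (intro that[of "R + 1"]) (auto intro: add_pos_pos add_strict_increasing2 simp: less_add_one le_less_trans[OF _ less_add_one])
qed

text \<open>After integration of ln |z - t| against \<mu> each zero t contributes minus the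
  potential at t, also for t in \<open>E\<close>. Points z where \<open>p\<close> vanishes are
  finitely many, hence null.\<close>

lemma root_avg_potential_ge:
  assumes p: "p \<noteq> 0" "degree p > 0"
    and bound: "\<And>z. z \<in> E \<Longrightarrow> cmod (poly p z) \<le> cmod (lead_coeff p) * exp (real (degree p) * (e - V))"
  shows "V - e \<le> root_avg p (log_potential \<mu>)"
proof -
  have fin: "finite {t. poly p t = 0}" using p poly_roots_finite by blast
  have int: "integrable \<mu> (\<lambda>z. real (order t p) * ln (cmod (z - t)))" for t
    using integrable_ln_dist[of t] by (intro integrable_mult_right) (simp add: norm_minus_commute)
  have i: "integrable \<mu> (\<lambda>z. root_avg p (\<lambda>t. ln (cmod (z - t))))"
    unfolding root_avg_def by (intro integrable_divide Bochner_Integration.integrable_sum int)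
  have "AE z in \<mu>. \<forall>t\<in>{t. poly p t = 0}. z \<noteq> t"
    by (rule AE_finite_allI[OF fin]) (rule no_atoms)
  then have "AE z in \<mu>. root_avg p (\<lambda>t. ln (cmod (z - t))) \<le> e - V"
    using AE_E
  proof eventually_elim
    case (elim z)
    then have nz: "poly p z \<noteq> 0" by auto
    have "ln (cmod (poly p z)) \<le> ln (cmod (lead_coeff p) * exp (real (degree p) * (e - V)))"
      using bound[of z] elim nz by (intro ln_mono) auto
    also have "\<dots> = ln (cmod (lead_coeff p)) + real (degree p) * (e - V)"
      using p by (simp add: ln_mult_pos)
    finally show ?case using p unfolding ln_cmod_poly[OF p nz, symmetric] by (simp add: field_simps)
  qed
  then have "(\<integral>z. root_avg p (\<lambda>t. ln (cmod (z - t))) \<partial>\<mu>) \<le> (\<integral>z. e - V \<partial>\<mu>)"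
    by (intro integral_mono_AE i) auto
  also have "\<dots> = e - V" using prob_space by simp
  also have "(\<integral>z. root_avg p (\<lambda>t. ln (cmod (z - t))) \<partial>\<mu>) = - root_avg p (log_potential \<mu>)"
  proof -
    have "(\<integral>z. ln (cmod (z - t)) \<partial>\<mu>) = - log_potential \<mu> t" for t
      unfolding log_potential_def by (simp add: norm_minus_commute)
    then show ?thesis unfolding root_avg_def
      by (simp add: Bochner_Integration.integral_sum[OF int] sum_negf)
  qed
  finally show ?thesis by simp
qed

lemma log_potential_less:
  assumes conn: "connected (- E)" and z: "z \<in> - E"
  shows "log_potential \<mu> z < V"
proof (rule ccontr)
  assume "\<not> ?thesis"
  then have eq: "V - log_potential \<mu> z = 0" using log_potential_le[of z] by simp
  obtain R where R: "0 < R" "\<And>z. z \<in> E \<Longrightarrow> cmod z < R" using bounded_E by blast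
  \<comment> \<open>At distance \<open>exp (1 - V)\<close> beyond the disc of radius
    \<open>R\<close> the far bound already puts the potential at or below
    \<open>V - 1\<close>.\<close>
  define w where "w = complex_of_real (R + exp (1 - V))"
  have cw: "cmod w = R + exp (1 - V)" unfolding w_def norm_of_real using R by (simp add: add_pos_pos)
  then have wE: "w \<in> - E" using R by (smt (verit) ComplI exp_gt_zero)
  have "V - log_potential \<mu> w = 0"
    by (rule mean_value_on_strong_min_principle[OF _ conn mean_value_on_diff[OF mean_value_on_const mean_value_log_potential] _ z eq wE])
      (use closed_E log_potential_le in \<open>auto simp: open_Compl\<close>)
  moreover have "log_potential \<mu> w \<le> - ln (cmod w - R)"
    using R cw by (intro log_potential_le_far[OF pot_E]) (auto intro: less_imp_le)
  ultimately show False using cw by simp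
qed

text \<open>\<open>V - log_potential \<mu>\<close> is the Green function of the complement with pole
  at infinity: large far out, and positive on the compact rest of \<open>F\<close>.\<close>

lemma green_lower_bound:
  assumes conn: "connected (- E)" and F: "closed F" "F \<subseteq> - E"
  obtains c where "0 < c" "\<And>z. z \<in> F \<Longrightarrow> c \<le> V - log_potential \<mu> z"
proof -
  obtain R where R: "0 < R" "\<And>z. z \<in> E \<Longrightarrow> cmod z < R" using bounded_E by blast
  define T where "T = R + exp (1 - V)"
  have far: "1 \<le> V - log_potential \<mu> z" if "T \<le> cmod z" for z
  proof -
    have pos: "exp (1 - V) \<le> cmod z - R" using that by (simp add: T_def)
    have "R < cmod z" using that unfolding T_def by (smt (verit) exp_gt_zero)
    then have "log_potential \<mu> z \<le> - ln (cmod z - R)"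
      using R by (intro log_potential_le_far[OF pot_E]) (auto intro: less_imp_le)
    moreover have "ln (exp (1 - V)) \<le> ln (cmod z - R)" using pos by (intro ln_mono) auto
    ultimately show ?thesis by simp
  qed
  show thesis
  proof (cases "F \<inter> cball 0 T = {}")
    case True
    then show thesis using far by (intro that[of 1]) (auto simp: disjoint_iff)
  next
    case False
    have "compact (F \<inter> cball 0 T)" using F by (simp add: closed_Int_compact)
    moreover have "continuous_on (F \<inter> cball 0 T) (\<lambda>z. V - log_potential \<mu> z)"
      using F by (intro continuous_intros continuous_on_subset[OF continuous_log_potential[OF pot_E]]) auto
    ultimately obtain z0 where z0: "z0 \<in> F \<inter> cball 0 T" "\<And>z. z \<in> F \<inter> cball 0 T \<Longrightarrow> V - log_potential \<mu> z0 \<le> V - log_potential \<mu> z"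
      using continuous_attains_inf[OF _ False] by metis
    show thesis
    proof (rule that[of "min 1 (V - log_potential \<mu> z0)"])
      show "0 < min 1 (V - log_potential \<mu> z0)" using log_potential_less[OF conn, of z0] z0 F by auto
      fix z assume "z \<in> F"
      then show "min 1 (V - log_potential \<mu> z0) \<le> V - log_potential \<mu> z"
        using z0(2)[of z] far[of z] by (cases "cmod z \<le> T") auto
    qed
  qed
qed

text \<open>The maximum principle for the sum of the root average and the potential: logarithmic
  growth cancels at infinity, and near \<open>E\<close> the sup norm bound meets the Frostman
  bound.\<close>

lemma bernstein_walsh:
  assumes p: "p \<noteq> 0" "degree p > 0" and e: "0 < e"
    and bound: "\<And>z. z \<in> E \<Longrightarrow> cmod (poly p z) \<le> cmod (lead_coeff p) * exp (real (degree p) * (e - V))"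
    and w: "w \<in> - E" "poly p w \<noteq> 0"
  shows "root_avg p (\<lambda>t. ln (cmod (w - t))) \<le> e - log_potential \<mu> w"
proof (rule field_le_epsilon)
  fix e' :: real assume e': "0 < e'"
  define n where "n = real (degree p)"
  have n: "0 < n" using p by (simp add: n_def)
  define s where "s = e + e'"
  define S where "S = - E - {t. poly p t = 0}"
  define u where "u z = root_avg p (\<lambda>t. ln (cmod (z - t))) + log_potential \<mu> z" for z
  define K where "K = {z \<in> S. s \<le> u z}"
  define l where "l = cmod (lead_coeff p)"
  have l: "0 < l" using p by (simp add: l_def)
  have fin: "finite {t. poly p t = 0}" using p poly_roots_finite by blast
  have openS: "open S" unfolding S_def using closed_E fin by (intro open_Diff finite_imp_closed) auto
  have mv: "mean_value_on S u"
    unfolding u_def S_def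
    by (intro mean_value_on_add mean_value_on_subset[OF mean_value_on_root_avg[OF p(1)]]
      mean_value_on_subset[OF mean_value_log_potential]) auto
  \<comment> \<open>The exponentiated condition fails at the zeros and survives limits there, so
    \<open>K\<close> is closed although \<open>S\<close> omits the zeros.\<close>
  have K_iff: "z \<in> K \<longleftrightarrow> z \<in> - E \<and> l * exp (n * (s - log_potential \<mu> z)) \<le> cmod (poly p z)" for z
  proof (cases "poly p z = 0")
    case True
    then have "\<not> l * exp (n * (s - log_potential \<mu> z)) \<le> cmod (poly p z)" using l by (simp add: mult_le_0_iff not_le)
    then show ?thesis using True by (simp add: K_def S_def)
  next
    case False
    have "s \<le> u z \<longleftrightarrow> s - log_potential \<mu> z \<le> (ln (cmod (poly p z)) - ln l) / n"
      unfolding u_def l_def n_def ln_cmod_poly[OF p False] by linarith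
    also have "\<dots> \<longleftrightarrow> ln l + n * (s - log_potential \<mu> z) \<le> ln (cmod (poly p z))"
      using n by (simp add: field_simps)
    also have "ln l + n * (s - log_potential \<mu> z) = ln (l * exp (n * (s - log_potential \<mu> z)))"
      using l by (simp add: ln_mult_pos)
    also have "\<dots> \<le> ln (cmod (poly p z)) \<longleftrightarrow> l * exp (n * (s - log_potential \<mu> z)) \<le> cmod (poly p z)"
      using l False by (intro ln_le_cancel_iff) auto
    finally show ?thesis using False by (simp add: K_def S_def)
  qed
  have "closed K"
    unfolding closed_sequential_limits
  proof (intro allI impI, elim conjE)
    fix z z0 assume zK: "\<forall>k. z k \<in> K" and lim: "z \<longlonglongrightarrow> z0"
    have limp: "(\<lambda>k. cmod (poly p (z k))) \<longlonglongrightarrow> cmod (poly p z0)"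
      by (intro tendsto_intros lim)
    show "z0 \<in> K"
    proof (cases "z0 \<in> E")
      case False
      then have "isCont (log_potential \<mu>) z0"
        using continuous_log_potential[OF pot_E] closed_E continuous_on_eq_continuous_at[of "- E"] by auto
      then have "(\<lambda>k. log_potential \<mu> (z k)) \<longlonglongrightarrow> log_potential \<mu> z0" using lim isCont_tendsto_compose by blast
      then have "(\<lambda>k. l * exp (n * (s - log_potential \<mu> (z k)))) \<longlonglongrightarrow> l * exp (n * (s - log_potential \<mu> z0))"
        by (intro tendsto_intros)
      then have "l * exp (n * (s - log_potential \<mu> z0)) \<le> cmod (poly p z0)"
        by (rule LIMSEQ_le[OF _ limp]) (use zK in \<open>auto simp: K_iff\<close>)
      then show ?thesis using False by (simp add: K_iff)
    next
      case True
      \<comment> \<open>A limit point in \<open>E\<close> is impossible: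
        \<open>log_potential \<mu> \<le> V\<close> makes the lower bound on |p| uniform along the
        sequence, and \<open>s > e\<close> then violates the sup norm bound.\<close>
      have "l * exp (n * (s - V)) \<le> cmod (poly p (z k))" for k
      proof -
        have "l * exp (n * (s - V)) \<le> l * exp (n * (s - log_potential \<mu> (z k)))"
          using l n log_potential_le[of "z k"] by (intro mult_left_mono) auto
        then show ?thesis using zK by (auto simp: K_iff intro: order_trans)
      qed
      then have "l * exp (n * (s - V)) \<le> cmod (poly p z0)" by (intro LIMSEQ_le_const[OF limp]) auto
      also have "\<dots> \<le> l * exp (n * (e - V))" using bound[OF True] by (simp add: l_def n_def)
      finally show ?thesis using l n e' by (simp add: s_def)
    qed
  qed
  moreover have "bounded K"
  proof -
    obtain R where R: "0 < R" "\<And>z. z \<in> E \<Longrightarrow> cmod z < R" using bounded_E by blast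
    obtain T where T: "0 < T" "\<And>t. poly p t = 0 \<Longrightarrow> cmod t \<le> T"
      using finite_imp_bounded[OF fin] unfolding bounded_pos by auto
    show ?thesis
      unfolding bounded_iff
    proof (intro exI ballI)
      fix z assume z: "z \<in> K"
      \<comment> \<open>Beyond this radius \<open>cmod z + T < exp e * (cmod z - R)\<close>, which
        forces \<open>u z < e\<close>.\<close>
      show "cmod z \<le> max R ((T + R * exp e) / (exp e - 1))"
      proof (rule ccontr)
        assume "\<not> ?thesis"
        then have gt: "R < cmod z" "(T + R * exp e) / (exp e - 1) < cmod z" by auto
        have "root_avg p (\<lambda>t. ln (cmod (z - t))) \<le> root_avg p (\<lambda>t. ln (cmod z + T))"
        proof (rule root_avg_mono[OF p(1)])
          fix t assume t: "poly p t = 0"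
          have "z \<noteq> t" using z t by (auto simp: K_def S_def)
          then show "ln (cmod (z - t)) \<le> ln (cmod z + T)"
            using norm_triangle_ineq4[of z t] T(2)[OF t] by (intro ln_mono) auto
        qed
        then have "root_avg p (\<lambda>t. ln (cmod (z - t))) \<le> ln (cmod z + T)" using root_avg_const[OF p] by simp
        moreover have "log_potential \<mu> z \<le> - ln (cmod z - R)"
          using R gt by (intro log_potential_le_far[OF pot_E]) (auto intro: less_imp_le)
        ultimately have "s \<le> ln (cmod z + T) - ln (cmod z - R)" using z by (simp add: K_def u_def)
        moreover have "cmod z + T < exp e * (cmod z - R)"
          using gt e by (simp add: field_simps)
        then have "ln (cmod z + T) < ln (exp e * (cmod z - R))"
          using gt R T by (subst ln_less_cancel_iff) (auto intro!: add_nonneg_pos)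
        then have "ln (cmod z + T) < e + ln (cmod z - R)" using gt by (simp add: ln_mult_pos)
        ultimately show False using e' by (simp add: s_def)
      qed
    qed
  qed
  ultimately have "compact K" by (simp add: compact_eq_bounded_closed)
  then have "u w < s"
    using mean_value_on_max_principle[OF openS mv, of s w] w by (simp add: K_def S_def)
  then show "root_avg p (\<lambda>t. ln (cmod (w - t))) \<le> e - log_potential \<mu> w + e'" by (simp add: u_def s_def)
qed

end

lemma reg_potential_le_log_potential:
  fixes \<tau> :: "complex measure"
  assumes "\<tau> \<in> prob_measures_on E" "compact E" "z \<in> - E"
  shows "reg_potential m \<tau> z \<le> log_potential \<tau> z"
proof -
  note tD = prob_measures_onD[OF assms(1) compact_imp_closed[OF assms(2)]]
  show ?thesis
    unfolding reg_potential_def log_potential_def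
  proof (rule integral_mono_AE)
    show "integrable \<tau> (reg_log (inverse (real (Suc m))) z)"
      by (rule integrable_continuous_prob_measures[OF assms(1,2) continuous_on_section[OF continuous_reg_log]]) simp
    show "integrable \<tau> (\<lambda>t. - ln (cmod (z - t)))"
      using integrable_ln_off_support[OF tD(1,2) assms(2) tD(3)] assms(3) by simp
    show "AE t in \<tau>. reg_log (inverse (real (Suc m))) z t \<le> - ln (cmod (z - t))"
      using tD(3) by eventually_elim (rule reg_log_le, use assms(3) in auto)
  qed
qed

section \<open>Weak limits of the zero counting measures\<close>

locale extremal_sequence = energy_minimizer +
  fixes p :: "nat \<Rightarrow> complex poly"
  assumes interior_E: "interior E = {}" and connected_compl: "connected (- E)"
    and extremal: "\<And>e. 0 < e \<Longrightarrow> \<forall>\<^sub>F n in sequentially. degree (p n) = n \<and> p n \<noteq> 0 \<and>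
      (\<forall>z\<in>E. cmod (poly (p n) z) \<le> cmod (lead_coeff (p n)) * exp (real n * (e - V)))"
begin

lemma eventually_extremal:
  assumes "0 < e"
  shows "\<forall>\<^sub>F n in sequentially. p n \<noteq> 0 \<and> degree (p n) > 0 \<and>
      (\<forall>z\<in>E. cmod (poly (p n) z) \<le> cmod (lead_coeff (p n)) * exp (real (degree (p n)) * (e - V)))"
  using extremal[OF assms] eventually_gt_at_top[of 0] by eventually_elim auto

text \<open>Markov's inequality for the nonnegative function \<open>V - log_potential \<mu>\<close>,
  which is at least \<open>c > 0\<close> on \<open>F\<close> and has small average over the
  zeros.\<close>

lemma root_avg_indicator_tendsto:
  assumes F: "closed F" "F \<subseteq> - E" and e: "0 < e"
  shows "\<forall>\<^sub>F n in sequentially. root_avg (p n) (indicator F) \<le> e"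
proof -
  obtain c where c: "0 < c" "\<And>z. z \<in> F \<Longrightarrow> c \<le> V - log_potential \<mu> z"
    using green_lower_bound[OF connected_compl F] by metis
  have "0 < c * e" using c e by simp
  from eventually_extremal[OF this] show ?thesis
  proof eventually_elim
    case (elim n)
    then have p: "p n \<noteq> 0" "degree (p n) > 0" by auto
    have "V - c * e \<le> root_avg (p n) (log_potential \<mu>)"
      by (rule root_avg_potential_ge[OF p]) (use elim in auto)
    then have "root_avg (p n) (\<lambda>z. V - log_potential \<mu> z) \<le> c * e"
      unfolding root_avg_diff root_avg_const[OF p] by simp
    moreover have "root_avg (p n) (\<lambda>z. c * indicator F z) \<le> root_avg (p n) (\<lambda>z. V - log_potential \<mu> z)"
      by (rule root_avg_mono[OF p(1)]) (use c log_potential_le in \<open>auto split: split_indicator\<close>)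
    ultimately have "c * root_avg (p n) (indicator F) \<le> c * e"
      unfolding root_avg_cmult by linarith
    then show ?case using c by simp
  qed
qed

lemma subsequential_limit_exists:
  assumes s: "strict_mono (s :: nat \<Rightarrow> nat)"
  obtains r and \<tau> :: "complex measure" where "strict_mono (r :: nat \<Rightarrow> nat)" "\<tau> \<in> prob_measures_on E"
    "\<And>f :: complex \<Rightarrow> real. continuous_on UNIV f \<Longrightarrow> bounded (range f) \<Longrightarrow>
      (\<lambda>k. root_avg (p (s (r k))) f) \<longlonglongrightarrow> (\<integral>z. f z \<partial>\<tau>)"
proof -
  obtain R where R: "0 < R" "\<And>z. z \<in> E \<Longrightarrow> cmod z < R" using bounded_E by blast
  obtain N where N: "\<And>n. n \<ge> N \<Longrightarrow> p n \<noteq> 0 \<and> degree (p n) > 0"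
    using eventually_extremal[of 1] unfolding eventually_sequentially by auto
  \<comment> \<open>For small \<open>n\<close> the polynomial may be constant; the shift by
    \<open>N\<close> avoids this because a strictly increasing \<open>s\<close> satisfies
    \<open>n \<le> s n\<close>.\<close>
  define q where "q n = p (s (n + N))" for n
  have q: "q n \<noteq> 0" "degree (q n) > 0" for n
    using N[of "s (n + N)"] seq_suble[OF s, of "n + N"] unfolding q_def by auto
  \<comment> \<open>Individual polynomials may have zeros far away. Projecting to a disc around
    \<open>E\<close> gives measures with common bounded support and moves only the zeros outside
    that disc.\<close>
  define \<rho> where "\<rho> = closest_point (cball (0::complex) R)"
  have \<rho>_in: "cmod (\<rho> z) \<le> R" for z
    using closest_point_in_set[of "cball (0::complex) R" z] R by (auto simp: \<rho>_def)
  have \<rho>_id: "\<rho> z = z" if "cmod z \<le> R" for z unfolding \<rho>_def by (rule closest_point_self) (use that in simp)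
  have \<rho>_cont: "continuous_on UNIV \<rho>"
    unfolding \<rho>_def by (rule continuous_on_closest_point) (use R in auto)
  have [measurable]: "\<rho> \<in> borel_measurable borel" by (rule borel_measurable_continuous_onI[OF \<rho>_cont])
  define \<nu> where "\<nu> n = distr (zero_counting_measure (q n)) borel \<rho>" for n
  note zc = prob_space_zero_counting[OF q] sets_zero_counting[OF q] integral_zero_counting[OF q]
  have [measurable_cong]: "sets (zero_counting_measure (q n)) = sets borel" for n by (rule zc(2))
  have \<nu>: "prob_space (\<nu> n)" "sets (\<nu> n) = sets borel" "AE z in \<nu> n. cmod z \<le> R" for n
  proof -
    show "prob_space (\<nu> n)" unfolding \<nu>_def by (rule prob_space.prob_space_distr[OF zc(1)]) measurable
    show "sets (\<nu> n) = sets borel" by (simp add: \<nu>_def)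
    show "AE z in \<nu> n. cmod z \<le> R" unfolding \<nu>_def by (subst AE_distr_iff) (auto simp: \<rho>_in)
  qed
  obtain r and \<Omega> :: "real measure" and Zs Z where r: "strict_mono (r :: nat \<Rightarrow> nat)" and \<Omega>: "prob_space \<Omega>"
    and Zs[measurable]: "\<And>n. Zs n \<in> borel_measurable \<Omega>" and Z[measurable]: "Z \<in> borel_measurable \<Omega>"
    and d: "\<And>n. distr \<Omega> borel (Zs n) = \<nu> (r n)"
    and lim: "\<And>x. x \<in> space \<Omega> \<Longrightarrow> (\<lambda>n. Zs n x) \<longlonglongrightarrow> Z x"
    using Skorohod_complex[of \<nu> R, OF \<nu>] by blast
  interpret O: prob_space \<Omega> by (rule \<Omega>)
  define \<tau> where "\<tau> = distr \<Omega> borel Z"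
  define r' where "r' k = r k + N" for k
  have r': "strict_mono r'" using r by (auto simp: r'_def strict_mono_def)
  have sr': "strict_mono (\<lambda>k. s (r' k))" using strict_mono_o[OF s r'] by (simp add: o_def)
  have conv: "(\<lambda>k. root_avg (p (s (r' k))) f) \<longlonglongrightarrow> (\<integral>z. f z \<partial>\<tau>)"
    if f: "continuous_on UNIV f" and bdd: "bounded (range f)" for f :: "complex \<Rightarrow> real"
  proof -
    obtain C where C: "0 < C" "\<And>z. \<bar>f z\<bar> \<le> C" using bdd unfolding bounded_pos by auto
    have [measurable]: "f \<in> borel_measurable borel" by (rule borel_measurable_continuous_onI[OF f])
    have "(\<lambda>k. \<integral>x. f (Zs k x) \<partial>\<Omega>) \<longlonglongrightarrow> (\<integral>x. f (Z x) \<partial>\<Omega>)"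
    proof (rule integral_dominated_convergence[where w = "\<lambda>_. C"])
      show "AE x in \<Omega>. (\<lambda>k. f (Zs k x)) \<longlonglongrightarrow> f (Z x)"
        by (rule AE_I2) (use continuous_on_tendsto_compose[OF f lim] in auto)
    qed (use C in auto)
    moreover have "(\<integral>x. f (Zs k x) \<partial>\<Omega>) = root_avg (p (s (r' k))) (\<lambda>z. f (\<rho> z))" for k
    proof -
      have "(\<integral>x. f (Zs k x) \<partial>\<Omega>) = (\<integral>z. f z \<partial>distr \<Omega> borel (Zs k))" by (subst integral_distr) auto
      also have "\<dots> = (\<integral>z. f (\<rho> z) \<partial>zero_counting_measure (q (r k)))"
        unfolding d \<nu>_def by (subst integral_distr) auto
      also have "\<dots> = root_avg (q (r k)) (\<lambda>z. f (\<rho> z))" by (rule zc(3)) measurable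
      finally show ?thesis by (simp add: q_def r'_def)
    qed
    moreover have "(\<integral>x. f (Z x) \<partial>\<Omega>) = (\<integral>z. f z \<partial>\<tau>)" unfolding \<tau>_def by (subst integral_distr) auto
    ultimately have 1: "(\<lambda>k. root_avg (p (s (r' k))) (\<lambda>z. f (\<rho> z))) \<longlonglongrightarrow> (\<integral>z. f z \<partial>\<tau>)" by simp
    \<comment> \<open>Projection changes \<open>f\<close> by at most \<open>2 * C\<close>, and only
      on \<open>F\<close>, where the proportion of zeros tends to 0; a proportion of
      \<open>e / (4 * C)\<close> gives an error of e / 2.\<close>
    define F where "F = - ball (0::complex) R"
    have F: "closed F" "F \<subseteq> - E" using R(2) by (auto simp: F_def)
    have 2: "(\<lambda>k. root_avg (p (s (r' k))) (\<lambda>z. f z - f (\<rho> z))) \<longlonglongrightarrow> 0"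
    proof (rule LIMSEQ_I)
      fix e :: real assume e: "0 < e"
      have "\<forall>\<^sub>F n in sequentially. root_avg (p n) (indicator F) \<le> e / (4 * C)"
        by (rule root_avg_indicator_tendsto[OF F]) (use e C in simp)
      then have "\<forall>\<^sub>F k in sequentially. root_avg (p (s (r' k))) (indicator F) \<le> e / (4 * C)"
        using eventually_subseq[OF sr'] by blast
      then obtain K where K: "\<And>k. k \<ge> K \<Longrightarrow> root_avg (p (s (r' k))) (indicator F) \<le> e / (4 * C)"
        unfolding eventually_sequentially by blast
      show "\<exists>K. \<forall>k\<ge>K. norm (root_avg (p (s (r' k))) (\<lambda>z. f z - f (\<rho> z)) - 0) < e"
      proof (intro exI allI impI)
        fix k assume k: "K \<le> k"
        have pk: "p (s (r' k)) \<noteq> 0" using q(1)[of "r k"] by (simp add: q_def r'_def)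
        have diff: "\<bar>f z - f (\<rho> z)\<bar> \<le> 2 * C * indicator F z" for z
          using C(2)[of z] C(2)[of "\<rho> z"] \<rho>_id[of z] by (auto simp: F_def split: split_indicator)
        have "root_avg (p (s (r' k))) (\<lambda>z. f z - f (\<rho> z)) \<le> root_avg (p (s (r' k))) (\<lambda>z. 2 * C * indicator F z)"
          by (rule root_avg_mono[OF pk]) (use diff in \<open>auto intro: order_trans[OF abs_ge_self]\<close>)
        moreover have "root_avg (p (s (r' k))) (\<lambda>z. - (2 * C) * indicator F z) \<le> root_avg (p (s (r' k))) (\<lambda>z. f z - f (\<rho> z))"
        proof (rule root_avg_mono[OF pk])
          fix t show "- (2 * C) * indicator F t \<le> f t - f (\<rho> t)" using diff[of t] by linarith
        qed
        ultimately have "\<bar>root_avg (p (s (r' k))) (\<lambda>z. f z - f (\<rho> z))\<bar> \<le> 2 * C * root_avg (p (s (r' k))) (indicator F)"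
          unfolding root_avg_cmult by linarith
        also have "\<dots> \<le> 2 * C * (e / (4 * C))" using K[OF k] C by (intro mult_left_mono) auto
        also have "\<dots> < e" using C e by (simp add: field_simps)
        finally show "norm (root_avg (p (s (r' k))) (\<lambda>z. f z - f (\<rho> z)) - 0) < e" by simp
      qed
    qed
    from tendsto_add[OF 1 2] show ?thesis by (simp add: root_avg_diff)
  qed
  have \<tau>_prob: "prob_space \<tau>" unfolding \<tau>_def by (rule O.prob_space_distr) measurable
  interpret T: prob_space \<tau> by (rule \<tau>_prob)
  have sets\<tau>[measurable_cong]: "sets \<tau> = sets borel" by (simp add: \<tau>_def)
  \<comment> \<open>A bounded continuous function that vanishes exactly on \<open>E\<close>; a zero
    integral therefore places \<open>\<tau>\<close> on \<open>E\<close>.\<close>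
  define h where "h z = min 1 (infdist z E)" for z
  have h0: "0 \<le> h z" for z by (simp add: h_def infdist_nonneg)
  have ch: "continuous_on UNIV h" unfolding h_def by (intro continuous_intros)
  have [measurable]: "h \<in> borel_measurable borel" by (rule borel_measurable_continuous_onI[OF ch])
  have bh: "bounded (range h)" unfolding bounded_iff using h0 by (intro exI[of _ 1]) (auto simp: h_def)
  have E_ne: "E \<noteq> {}"
    using carrier_nonempty carrier_subset by auto
  have "(\<integral>z. h z \<partial>\<tau>) \<le> 0"
  proof (rule field_le_epsilon)
    fix e :: real assume e: "0 < e"
    define F where "F = {z. e / 2 \<le> infdist z E}"
    have F: "closed F" "F \<subseteq> - E"
      unfolding F_def using e by (auto intro!: closed_Collect_le continuous_intros)
    have "\<forall>\<^sub>F n in sequentially. root_avg (p n) (indicator F) \<le> e / 2"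
      by (rule root_avg_indicator_tendsto[OF F]) (use e in simp)
    then have ev: "\<forall>\<^sub>F k in sequentially. root_avg (p (s (r' k))) (indicator F) \<le> e / 2"
      using eventually_subseq[OF sr'] by blast
    have "\<forall>\<^sub>F k in sequentially. root_avg (p (s (r' k))) h \<le> e"
      using ev
    proof eventually_elim
      case (elim k)
      have pk: "p (s (r' k)) \<noteq> 0" "degree (p (s (r' k))) > 0" using q[of "r k"] by (auto simp: q_def r'_def)
      have "root_avg (p (s (r' k))) h \<le> root_avg (p (s (r' k))) (\<lambda>z. e / 2 + indicator F z)"
        by (rule root_avg_mono[OF pk(1)]) (use e in \<open>auto simp: h_def F_def split: split_indicator\<close>)
      then show ?case unfolding root_avg_add root_avg_const[OF pk] using elim by simp
    qed
    then have "(\<integral>z. h z \<partial>\<tau>) \<le> e"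
      by (intro tendsto_upperbound[OF conv[OF ch bh]]) auto
    then show "(\<integral>z. h z \<partial>\<tau>) \<le> 0 + e" by simp
  qed
  then have "(\<integral>z. h z \<partial>\<tau>) = 0" using h0 by (simp add: order.antisym integral_nonneg_AE)
  moreover have "integrable \<tau> h"
    by (rule T.integrable_const_bound[where B = 1]) (auto simp: h_def infdist_nonneg)
  ultimately have "AE z in \<tau>. h z = 0" using integral_nonneg_eq_0_iff_AE[of \<tau> h] h0 by simp
  then have "AE z in \<tau>. z \<in> E"
  proof eventually_elim
    case (elim z)
    then have "infdist z E = 0" by (simp add: h_def min_def split: if_splits)
    then show ?case using in_closed_iff_infdist_zero[OF closed_E E_ne] by simp
  qed
  then have "\<tau> \<in> prob_measures_on E" by (intro prob_measures_onI \<tau>_prob sets\<tau> closed_E)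
  then show thesis by (rule that[OF r' _ conv])
qed

text \<open>Bernstein--Walsh at the point \<open>z\<close> does not pass to the limit, since zeros
  may approach \<open>z\<close>. Its mean over a small circle does: by Jensen the kernel becomes ln
  (max r |z - t|), continuous in t, while the mean of the potential of \<mu> is its value at
  \<open>z\<close>.\<close>

lemma subsequential_limit_potential_ge:
  assumes s: "strict_mono (s :: nat \<Rightarrow> nat)" and \<tau>: "\<tau> \<in> prob_measures_on E"
    and conv: "\<And>f :: complex \<Rightarrow> real. continuous_on UNIV f \<Longrightarrow> bounded (range f) \<Longrightarrow>
      (\<lambda>k. root_avg (p (s k)) f) \<longlonglongrightarrow> (\<integral>z. f z \<partial>\<tau>)"
    and z: "z \<in> - E"
  shows "log_potential \<mu> z \<le> log_potential \<tau> z"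
proof -
  note tD = prob_measures_onD[OF \<tau> closed_E]
  have [measurable_cong]: "sets \<tau> = sets borel" by (rule tD)
  obtain r0 where r0: "0 < r0" "cball z r0 \<subseteq> - E"
    using z closed_E open_contains_cball[of "- E"] by auto
  \<comment> \<open>A circle through no zero of any \<open>p n\<close>, so that its mean of \<open>ln\<close> is given by Jensen's formula.\<close>
  define bad where "bad = (\<Union>n\<in>{n. p n \<noteq> 0}. (\<lambda>t. cmod (z - t)) ` {t. poly (p n) t = 0})"
  have "countable bad"
    unfolding bad_def
  proof (rule countable_UN)
    fix n assume "n \<in> {n. p n \<noteq> 0}"
    then show "countable ((\<lambda>t. cmod (z - t)) ` {t. poly (p n) t = 0})"
      using poly_roots_finite by (intro countable_image countable_finite) auto
  qed (rule countableI_type)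
  moreover have "uncountable {0<..<r0}" using r0 by (simp add: uncountable_open_interval)
  ultimately obtain r where r: "r \<in> {0<..<r0}" "r \<notin> bad"
    by (metis countable_subset subsetI)
  have rpos: "0 < r" and rsub: "cball z r \<subseteq> - E" using r r0 by (auto simp: subset_iff)
  obtain R where R: "0 < R" "\<And>w. w \<in> E \<Longrightarrow> cmod w < R" using bounded_E by blast
  \<comment> \<open>Truncation at \<open>R'\<close> makes the test function bounded; for t in
    \<open>E\<close> neither \<open>r\<close> nor \<open>R'\<close> is active, so its integral
    against \<open>\<tau>\<close> is the potential.\<close>
  define R' where "R' = max r (cmod z + R)"
  define f where "f t = - ln (max r (min R' (cmod (z - t))))" for t
  have cf: "continuous_on UNIV f" unfolding f_def using rpos by (intro continuous_intros) auto
  have bf: "bounded (range f)"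
  proof -
    have "\<bar>ln (max r (min R' x))\<bar> \<le> \<bar>ln r\<bar> + \<bar>ln R'\<bar>" for x
      by (rule abs_ln_le) (use rpos in \<open>auto simp: R'_def\<close>)
    then show ?thesis unfolding bounded_iff f_def by (intro exI[of _ "\<bar>ln r\<bar> + \<bar>ln R'\<bar>"]) auto
  qed
  have f_eq: "(\<integral>t. f t \<partial>\<tau>) = log_potential \<tau> z"
    unfolding log_potential_def f_def
  proof (rule integral_cong_AE)
    show "AE t in \<tau>. - ln (max r (min R' (cmod (z - t)))) = - ln (cmod (z - t))"
      using tD(3)
    proof eventually_elim
      case (elim t)
      have "r \<le> cmod (z - t)" using rsub elim by (force simp: dist_norm)
      moreover have "cmod (z - t) \<le> R'" using norm_triangle_ineq4[of z t] R(2)[OF elim] by (simp add: R'_def)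
      ultimately show ?case by simp
    qed
  qed auto
  have "log_potential \<mu> z \<le> (\<integral>t. f t \<partial>\<tau>) + e" if e: "0 < e" for e
  proof -
    have "\<forall>\<^sub>F n in sequentially. log_potential \<mu> z - e \<le> root_avg (p n) f"
      using eventually_extremal[OF e]
    proof eventually_elim
      case (elim n)
      then have p: "p n \<noteq> 0" "degree (p n) > 0" by auto
      have fin: "finite {t. poly (p n) t = 0}" using p poly_roots_finite by blast
      have off: "cmod (z - t) \<noteq> r" if "poly (p n) t = 0" for t
        using r(2) that p unfolding bad_def by blast
      have on_circle: "poly (p n) w \<noteq> 0" "w \<in> - E" if "w \<in> sphere z r" for w
        using off[of w] that rsub by (auto simp: dist_norm subset_iff)
      define I where "I = unit_interval_measure"
      have circ: "circlepath z r x \<in> sphere z r" for x by (rule circlepath_in_sphere) (use rpos in simp)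
      have contln: "continuous_on (sphere z r) (\<lambda>w. ln (cmod (w - t)))" if "poly (p n) t = 0" for t
        using on_circle(1) that by (intro continuous_intros) auto
      have int1: "integrable I (\<lambda>x. real (order t (p n)) * ln (cmod (circlepath z r x - t)))"
        if "t \<in> {t. poly (p n) t = 0}" for t
        using that rpos unfolding I_def
        by (intro integrable_mult_right integrable_unit_interval continuous_on_circlepath_comp[OF contln]) auto
      have "root_avg (p n) (\<lambda>t. ln (max r (cmod (z - t)))) = (\<integral>x. root_avg (p n) (\<lambda>t. ln (cmod (circlepath z r x - t))) \<partial>I)"
      proof -
        have "(\<integral>x. (\<Sum>t | poly (p n) t = 0. real (order t (p n)) * ln (cmod (circlepath z r x - t))) \<partial>I)
          = (\<Sum>t | poly (p n) t = 0. (\<integral>x. real (order t (p n)) * ln (cmod (circlepath z r x - t)) \<partial>I))"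
          by (rule Bochner_Integration.integral_sum[OF int1])
        also have "\<dots> = (\<Sum>t | poly (p n) t = 0. real (order t (p n)) * ln (max r (cmod (z - t))))"
          unfolding I_def using off by (intro sum.cong refl) (simp add: circle_mean_ln_dist[OF rpos])
        finally show ?thesis unfolding root_avg_def by simp
      qed
      also have "\<dots> \<le> (\<integral>x. e - log_potential \<mu> (circlepath z r x) \<partial>I)"
      proof (rule integral_mono)
        show "integrable I (\<lambda>x. root_avg (p n) (\<lambda>t. ln (cmod (circlepath z r x - t))))"
          unfolding root_avg_def by (intro integrable_divide Bochner_Integration.integrable_sum int1)
        show "integrable I (\<lambda>x. e - log_potential \<mu> (circlepath z r x))"
          unfolding I_def
          by (rule mean_value_on_integrable[OF mean_value_on_diff[OF mean_value_on_const mean_value_log_potential] rsub rpos])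
        fix x show "root_avg (p n) (\<lambda>t. ln (cmod (circlepath z r x - t))) \<le> e - log_potential \<mu> (circlepath z r x)"
          by (rule bernstein_walsh[OF p e]) (use elim on_circle[OF circ] in auto)
      qed
      also have "\<dots> = e - log_potential \<mu> z"
        using mean_value_on_diff[OF mean_value_on_const mean_value_log_potential, of e] rsub rpos
        unfolding I_def mean_value_on_def by blast
      finally have "log_potential \<mu> z - e \<le> - root_avg (p n) (\<lambda>t. ln (max r (cmod (z - t))))" by simp
      also have "\<dots> = root_avg (p n) (\<lambda>t. - ln (max r (cmod (z - t))))"
        using root_avg_cmult[of "p n" "-1"] by simp
      \<comment> \<open>Truncation from above can only increase \<open>f\<close>, which is the
        direction wanted.\<close>
      also have "\<dots> \<le> root_avg (p n) f"
        by (rule root_avg_mono[OF p(1)]) (use rpos in \<open>auto simp: f_def intro!: ln_mono\<close>)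
      finally show ?case .
    qed
    then have "\<forall>\<^sub>F k in sequentially. log_potential \<mu> z - e \<le> root_avg (p (s k)) f"
      using eventually_subseq[OF s] by blast
    then have "log_potential \<mu> z - e \<le> (\<integral>t. f t \<partial>\<tau>)"
      by (intro tendsto_lowerbound[OF conv[OF cf bf]]) auto
    then show ?thesis by simp
  qed
  then show ?thesis unfolding f_eq by (rule field_le_epsilon)
qed

lemma subsequential_limit_eq:
  assumes s: "strict_mono (s :: nat \<Rightarrow> nat)" and \<tau>: "\<tau> \<in> prob_measures_on E"
    and conv: "\<And>f :: complex \<Rightarrow> real. continuous_on UNIV f \<Longrightarrow> bounded (range f) \<Longrightarrow>
      (\<lambda>k. root_avg (p (s k)) f) \<longlonglongrightarrow> (\<integral>z. f z \<partial>\<tau>)"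
  shows "\<tau> = \<mu>"
proof -
  note tD = prob_measures_onD[OF \<tau> closed_E]
  note pot_\<tau> = tD(1,2) compact_E tD(3)
  interpret T: prob_space \<tau> by (rule tD)
  define h where "h z = log_potential \<tau> z - log_potential \<mu> z" for z
  have mv: "mean_value_on (- E) h"
    unfolding h_def by (intro mean_value_on_diff mean_value_log_potential mean_value_on_log_potential[OF pot_\<tau>])
  have h0: "0 \<le> h z" if "z \<in> - E" for z
    using subsequential_limit_potential_ge[OF s \<tau> conv that] by (simp add: h_def)
  obtain R where R: "0 < R" "\<And>z. z \<in> E \<Longrightarrow> cmod z < R" using bounded_E by blast
  have disj: "sphere 0 R \<inter> E = {}" using R by force
  \<comment> \<open>By Jensen the mean over a circle enclosing \<open>E\<close> is the same for all
    probability measures on \<open>E\<close>.\<close>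
  have mean: "(\<integral>x. log_potential \<kappa> (circlepath 0 R x) \<partial>unit_interval_measure) = - ln R"
    if \<kappa>: "\<kappa> \<in> prob_measures_on E" for \<kappa>
  proof -
    note kD = prob_measures_onD[OF \<kappa> closed_E]
    interpret K: prob_space \<kappa> by (rule kD)
    have [measurable_cong]: "sets \<kappa> = sets borel" by (rule kD)
    have "(\<integral>t. - ln (max R (cmod (0 - t))) \<partial>\<kappa>) = (\<integral>t. - ln R \<partial>\<kappa>)"
    proof (rule integral_cong_AE)
      show "AE t in \<kappa>. - ln (max R (cmod (0 - t))) = - ln R"
        using kD(3)
      proof eventually_elim
        case (elim t)
        then show ?case using R(2)[of t] by (simp add: max_def)
      qed
    qed auto
    then show ?thesis
      using circle_mean_log_potential[OF kD(1,2) compact_E kD(3) R(1) disj] by (simp add: K.prob_space)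
  qed
  have contS: "continuous_on (sphere 0 R) (log_potential \<kappa>)" if "\<kappa> \<in> prob_measures_on E" for \<kappa>
    using prob_measures_onD[OF that closed_E] disj
    by (intro continuous_on_subset[OF continuous_log_potential[OF _ _ compact_E]]) auto
  \<comment> \<open>A nonnegative function with mean 0 vanishes on the circle; one such point starts
    the strong minimum principle.\<close>
  have "h (of_real R) = 0"
  proof (rule zero_mean_imp_zero_on_sphere[OF _ R(1)])
    show "continuous_on (sphere 0 R) h" unfolding h_def by (intro continuous_intros contS \<tau> in_E)
    show "(\<integral>x. h (circlepath 0 R x) \<partial>unit_interval_measure) = 0"
      unfolding h_def using R
      by (subst Bochner_Integration.integral_diff)
        (auto intro!: integrable_unit_interval continuous_on_circlepath_comp contS \<tau> in_E simp: mean[OF \<tau>] mean[OF in_E])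
    show "0 \<le> h w" if "w \<in> sphere 0 R" for w using that disj by (intro h0) auto
    show "complex_of_real R \<in> sphere 0 R" using R by simp
  qed
  moreover have "complex_of_real R \<in> - E" using R by force
  ultimately have eq: "log_potential \<tau> z = log_potential \<mu> z" if "z \<in> - E" for z
    using mean_value_on_strong_min_principle[OF _ connected_compl mv h0 _ _ that, of "of_real R"] closed_E
    by (simp add: h_def open_Compl)
  have off: "reg_potential m \<tau> z \<le> V" if "z \<in> - E" for m z
    using reg_potential_le_log_potential[OF \<tau> compact_E that, of m] eq[OF that] log_potential_le[of z] by simp
  \<comment> \<open>Lower semicontinuity in regularised form: for fixed \<open>m\<close> the
    potential is continuous and the complement of \<open>E\<close> is dense.\<close>
  have on: "reg_potential m \<tau> z \<le> V" for m z
  proof -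
    have "closure (- E) = UNIV" using interior_E by (simp add: closure_interior)
    then have "z \<in> closure (- E)" by simp
    then obtain u where u: "\<And>k. u k \<in> - E" "u \<longlonglongrightarrow> z" unfolding closure_sequential by blast
    have "(\<lambda>k. reg_potential m \<tau> (u k)) \<longlonglongrightarrow> reg_potential m \<tau> z"
      by (rule continuous_on_tendsto_compose[OF continuous_reg_potential[OF \<tau> compact_E] u(2)]) auto
    then show ?thesis by (rule LIMSEQ_le_const2) (use off u(1) in auto)
  qed
  have "reg_energy m \<tau> \<tau> \<le> V" for m
  proof -
    have "reg_energy m \<tau> \<tau> = (\<integral>z. reg_potential m \<tau> z \<partial>\<tau>)"
      unfolding reg_potential_def by (rule double_integral_iterated(1)[OF \<tau> \<tau> compact_E continuous_reg_log]) simp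
    also have "\<dots> \<le> (\<integral>z. V \<partial>\<tau>)"
      by (intro integral_mono integrable_continuous_prob_measures[OF \<tau> compact_E continuous_reg_potential[OF \<tau> compact_E]] on) auto
    finally show ?thesis by (simp add: T.prob_space)
  qed
  then have "log_energy \<tau> \<le> ereal V" using log_energy_le_iff[OF \<tau> compact_E] by simp
  then show ?thesis by (rule energy_minimizer_unique[OF \<tau>])
qed

lemma zero_counting_weak_conv: "weak_conv_cmplx (\<lambda>n. zero_counting_measure (p n)) \<mu>"
  unfolding weak_conv_cmplx_def
proof (intro allI impI, elim conjE)
  fix f :: "complex \<Rightarrow> real" assume f: "continuous_on UNIV f" "bounded (range f)"
  have "(\<lambda>n. root_avg (p n) f) \<longlonglongrightarrow> (\<integral>z. f z \<partial>\<mu>)"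
  proof (rule ccontr)
    assume "\<not> ?thesis"
    then obtain e where e: "0 < e" "\<exists>\<^sub>F n in sequentially. \<not> dist (root_avg (p n) f) (\<integral>z. f z \<partial>\<mu>) < e"
      unfolding tendsto_iff not_eventually by (auto simp: not_eventually)
    then have "infinite {n. \<not> dist (root_avg (p n) f) (\<integral>z. f z \<partial>\<mu>) < e}"
      by (simp add: frequently_cofinite cofinite_eq_sequentially[symmetric])
    then obtain s where s: "strict_mono (s :: nat \<Rightarrow> nat)" "\<And>n. s n \<in> {n. \<not> dist (root_avg (p n) f) (\<integral>z. f z \<partial>\<mu>) < e}"
      using infinite_enumerate by blast
    obtain r \<tau> where r: "strict_mono (r :: nat \<Rightarrow> nat)" and \<tau>: "\<tau> \<in> prob_measures_on E"
      and conv: "\<And>f :: complex \<Rightarrow> real. continuous_on UNIV f \<Longrightarrow> bounded (range f) \<Longrightarrow>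
        (\<lambda>k. root_avg (p (s (r k))) f) \<longlonglongrightarrow> (\<integral>z. f z \<partial>\<tau>)"
      using subsequential_limit_exists[OF s(1)] by metis
    have sr: "strict_mono (\<lambda>k. s (r k))" using strict_mono_o[OF s(1) r] by (simp add: o_def)
    have "\<tau> = \<mu>" by (rule subsequential_limit_eq[OF sr \<tau> conv])
    then have "(\<lambda>k. root_avg (p (s (r k))) f) \<longlonglongrightarrow> (\<integral>z. f z \<partial>\<mu>)" using conv[OF f] by simp
    then have "\<forall>\<^sub>F k in sequentially. dist (root_avg (p (s (r k))) f) (\<integral>z. f z \<partial>\<mu>) < e" using e(1) by (rule tendstoD)
    then show False using s(2) by (auto simp: eventually_sequentially)
  qed
  \<comment> \<open>Eventually only, as small \<open>n\<close> may give constant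
    polynomials.\<close>
  moreover have "\<forall>\<^sub>F n in sequentially. root_avg (p n) f = (\<integral>z. f z \<partial>zero_counting_measure (p n))"
    using eventually_extremal[OF zero_less_one]
    by eventually_elim (use integral_zero_counting borel_measurable_continuous_onI[OF f(1)] in auto)
  ultimately show "(\<lambda>n. \<integral>z. f z \<partial>zero_counting_measure (p n)) \<longlonglongrightarrow> (\<integral>z. f z \<partial>\<mu>)"
    by (rule Lim_transform_eventually)
qed

end

section \<open>Random polynomials\<close>

theorem theorem2p2:
  fixes M :: "'a measure" and A :: "nat \<Rightarrow> 'a \<Rightarrow> complex"
    and B :: "nat \<Rightarrow> complex poly" and E :: "complex set"
  assumes "prob_space M"
    and "compact E" and "log_capacity E > 0" and "interior E = {}" and "connected (- E)"
    and "\<forall>k. degree (B k) \<le> k \<and> coeff (B k) k \<noteq> 0"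
    and "limsup (\<lambda>k. ereal (sup_norm_on E (B k) powr (1 / real k))) \<le> 1"
    and "(\<lambda>k. cmod (coeff (B k) k) powr (1 / real k)) \<longlonglongrightarrow> 1 / log_capacity E"
    and "\<forall>k. A k \<in> borel_measurable M"
    and "\<exists>a>1. \<exists>f::real \<Rightarrow> real.
           (\<forall>x y. a \<le> x \<longrightarrow> x \<le> y \<longrightarrow> f y \<le> f x)
         \<and> (\<forall>x\<ge>a. 0 \<le> f x \<and> f x \<le> 1)
         \<and> (\<integral>\<^sup>+ x\<in>{a..}. ennreal (f x / x) \<partial>lborel) < \<infinity>
         \<and> (\<forall>x\<ge>a. \<forall>k. 1 - measure M {\<omega>\<in>space M. cmod (A k \<omega>) \<le> x} \<le> f x)"
    and "\<exists>b. 0 < b \<and> b < 1 \<and> (\<exists>g::real \<Rightarrow> real.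
           (\<forall>x y. 0 \<le> x \<longrightarrow> x \<le> y \<longrightarrow> y \<le> b \<longrightarrow> g x \<le> g y)
         \<and> (\<forall>x\<in>{0..b}. 0 \<le> g x \<and> g x \<le> 1)
         \<and> (\<integral>\<^sup>+ x\<in>{0..b}. ennreal (g x / x) \<partial>lborel) < \<infinity>
         \<and> (\<forall>x\<in>{0..b}. \<forall>k. measure M {\<omega>\<in>space M. cmod (A k \<omega>) \<le> x} \<le> g x))"
  shows "AE \<omega> in M. weak_conv_cmplx
           (\<lambda>n. zero_counting_measure (\<Sum>k\<le>n. smult (A k \<omega>) (B k)))
           (equilibrium_measure E)"
proof -
  interpret prob_space M by fact
  obtain V where V: "min_energy E = ereal V" "log_capacity E = exp (- V)"
    using min_energy_real[OF assms(2,3)] by metis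
  obtain \<mu> where \<mu>: "\<mu> \<in> prob_measures_on E" "log_energy \<mu> = min_energy E"
    using energy_minimizer_exists[OF assms(2) V(1)] by metis
  interpret min: energy_minimizer E V \<mu>
    by (rule energy_minimizer.intro) (simp_all only: assms(2) V \<mu> order.refl)
  \<comment> \<open>\<open>equilibrium_measure\<close> is a definite description, so existence and
    uniqueness of the minimizer are what give it meaning.\<close>
  have eq_measure: "equilibrium_measure E = \<mu>"
    unfolding equilibrium_measure_def
  proof (rule the_equality)
    show "\<mu> \<in> prob_measures_on E \<and> log_energy \<mu> = min_energy E" using \<mu> by blast
    show "\<nu> = \<mu>" if "\<nu> \<in> prob_measures_on E \<and> log_energy \<nu> = min_energy E" for \<nu>
      by (rule min.energy_minimizer_unique) (simp_all only: that V(1)[symmetric] order.refl)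
  qed
  from assms(10) obtain a f where f: "\<And>x y. a \<le> x \<Longrightarrow> x \<le> y \<Longrightarrow> f y \<le> f x" "\<And>x. x \<ge> a \<Longrightarrow> 0 \<le> (f x :: real)"
      "(\<integral>\<^sup>+ x\<in>{a..}. ennreal (f x / x) \<partial>lborel) < \<infinity>"
      "\<And>x k. x \<ge> a \<Longrightarrow> 1 - measure M {\<omega>\<in>space M. cmod (A k \<omega>) \<le> x} \<le> f x"
    by blast
  from assms(11) obtain b g where b: "0 < b"
    and g: "\<And>x y. 0 \<le> x \<Longrightarrow> x \<le> y \<Longrightarrow> y \<le> b \<Longrightarrow> g x \<le> g y" "\<And>x. x \<in> {0..b} \<Longrightarrow> 0 \<le> (g x :: real)"
      "(\<integral>\<^sup>+ x\<in>{0..b}. ennreal (g x / x) \<partial>lborel) < \<infinity>"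
      "\<And>x k. x \<in> {0..b} \<Longrightarrow> measure M {\<omega>\<in>space M. cmod (A k \<omega>) \<le> x} \<le> g x"
    by blast
  have lead: "(\<lambda>k. cmod (coeff (B k) k) powr (1 / real k)) \<longlonglongrightarrow> exp V"
  proof -
    have "1 / log_capacity E = exp V" unfolding V(2) by (simp add: exp_minus field_simps)
    then show ?thesis using assms(8) by simp
  qed
  have "AE \<omega> in M. \<forall>\<^sub>F n in sequentially.
      exp (- (e * real n)) < cmod (A n \<omega>) \<and> cmod (A n \<omega>) \<le> exp (e * real n)" if "0 < e" for e
    by (rule AE_eventually_exp_bounds[OF _ f b g that]) (use assms(9) in blast)
  \<comment> \<open>Countably many rates 1 / (j + 1) leave a single null set outside which the
    bounds hold for every \<open>e > 0\<close>.\<close>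
  then have "AE \<omega> in M. \<forall>j. \<forall>\<^sub>F n in sequentially.
      exp (- (inverse (real (Suc j)) * real n)) < cmod (A n \<omega>) \<and> cmod (A n \<omega>) \<le> exp (inverse (real (Suc j)) * real n)"
    by (simp add: AE_all_countable del: of_nat_Suc)
  then show ?thesis
  proof eventually_elim
    case (elim \<omega>)
    have bounds: "\<forall>\<^sub>F n in sequentially. exp (- (e * real n)) < cmod (A n \<omega>) \<and> cmod (A n \<omega>) \<le> exp (e * real n)"
      if "0 < e" for e
    proof -
      obtain j where j: "inverse (real (Suc j)) < e" using reals_Archimedean[OF \<open>0 < e\<close>] by auto
      from elim have "\<forall>\<^sub>F n in sequentially. exp (- (inverse (real (Suc j)) * real n)) < cmod (A n \<omega>) \<and>
          cmod (A n \<omega>) \<le> exp (inverse (real (Suc j)) * real n)" by blast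
      then show ?thesis
      proof eventually_elim
        case (elim n)
        have le: "inverse (real (Suc j)) * real n \<le> e * real n"
          using j by (intro mult_right_mono) auto
        then have "exp (- (e * real n)) \<le> exp (- (inverse (real (Suc j)) * real n))"
          "exp (inverse (real (Suc j)) * real n) \<le> exp (e * real n)" by (simp_all del: of_nat_Suc)
        then show ?case using elim by linarith
      qed
    qed
    interpret extremal_sequence E V \<mu> "\<lambda>n. \<Sum>k\<le>n. smult (A k \<omega>) (B k)"
    proof unfold_locales
      fix e :: real assume "0 < e"
      then show "\<forall>\<^sub>F n in sequentially. degree (\<Sum>k\<le>n. smult (A k \<omega>) (B k)) = n \<and>
        (\<Sum>k\<le>n. smult (A k \<omega>) (B k)) \<noteq> 0 \<and>
        (\<forall>z\<in>E. cmod (poly (\<Sum>k\<le>n. smult (A k \<omega>) (B k)) z)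
          \<le> cmod (lead_coeff (\<Sum>k\<le>n. smult (A k \<omega>) (B k))) * exp (real n * (e - V)))"
        by (intro extremal_polynomials_bound[OF assms(2) bounds _ _ assms(7) lead]) (use assms(6) in auto)
    qed (rule assms(4), rule assms(5))
    show ?case unfolding eq_measure by (rule zero_counting_weak_conv)
  qed
qed

end
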